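(* Let $(\Omega,\mathcal{F},\mathbb{P})$ be the canonical space of a $d$-dimensional Brownian motion $W$. Let $f$ be a locally bounded Lipschitz function from $\mathbb{R}^n$ to $\mathbb{R}^n$ and let $g$ be a locally bounded Lipschitz function from $\mathbb{R}^n$ to $M_{n\times d}(\mathbb{R})$. Consider the stochastic differential equation on $\mathbb{R}^n$ $$X_t^x=x+\int_0^t f(X^x_u)\,du+\int_0^tg(X^x_u)\cdot dW_u$$ and the associated dynamical system $$\widetilde T_t(x,\omega)=\left(X^x_t(\omega),\theta_t(\omega)\right)$$ on $\mathbb{R}^n\times\Omega$. For any bounded measurable function $h$ on $\mathbb{R}^n$ put $$P_t\,h(x)=\mathbb{E}\left[T_t(h\otimes\mathbf{1})(x,\cdot)\right]=\int_\Omega h(X^x_t(\omega))\,d\mathbb{P}(\omega).$$ Then $(P_t)_{t\in\mathbb{R}^+}$ is a Markov semigroup on $\mathbb{R}^n$ with generator $$A=\sum_{i=1}^n f_i(x)\,\frac{\partial}{\partial x_i}+\frac12\sum_{i,j=1}^n\sum_{\alpha=1}^d g^i_\alpha(x)\,g^j_\alpha(x)\,\frac{\partial^2}{\partial x_i\,\partial x_j}.$$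
   Context: Canonical space: $\Omega=C_0(\mathbb{R}^+;\mathbb{R}^d)$ is the space of continuous functions $\mathbb{R}^+\to\mathbb{R}^d$ vanishing at $0$, with the topology of uniform convergence on compact sets, $\mathcal{F}$ its Borel $\sigma$-field, $\mathbb{P}$ the Wiener measure, and $W_t(\omega)=\omega(t)$ (measurability is understood up to $\mathbb{P}$-null sets). The shift $\theta_s:\Omega\to\Omega$ is $\theta_s(\omega)(t)=\omega(t+s)-\omega(s)$. The equation is shorthand for $(X_t^x)^i=x^i+\int_0^tf(X^x_u)^i\,du+\sum_{j=1}^d\int_0^tg(X^x_u)^i_j\,dW^j_u$, $i=1,\dots,n$ (Itô integrals); $f_i$ denotes the $i$-th component of $f$ and $g^i_\alpha$ the $(i,\alpha)$ entry of $g$. Lipschitz means globally Lipschitz. For each $x$ the solution exists and is unique up to almost sure equality of processes; a version continuous in $(t,x)$ for almost every $\omega$ is used. $T_t$ is the operator $T_tk=k\circ\widetilde T_t$ on bounded measurable functions $k$ on $\mathbb{R}^n\times\Omega$, and $(h\otimes\mathbf{1})(x,\omega)=h(x)$. A Markov operator on $\mathbb{R}^n$ is an operator on bounded measurable functions of the form $h\mapsto\int h(y)\,\nu(\cdot,dy)$ for a Markov (probability) kernel $\nu$. A Markov semigroup is a family $(P_t)_{t\ge0}$ of Markov operators with $P_0=I$ and $P_t\circ P_s=P_{s+t}$ for all $s,t\ge0$. That it has the second-order differential operator $A$ as generator means: for every $h\in C^2_c(\mathbb{R}^n)$ (twice continuously differentiable with compact support), $\lim_{t\downarrow0}\frac{P_th-h}{t}=Ah$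 uniformly on $\mathbb{R}^n$. *)

theory Defs
  imports "HOL-Probability.Probability"
begin

section \<open>The canonical space of Brownian motion\<close>

text \<open>
  The half-line of times is the set of nonnegative reals. A path on it that vanishes at 0 is
  represented by its extension to the real line by 0.
\<close>

definition path_space :: "(real \<Rightarrow> 'a::real_normed_vector) set" where
  "path_space = {\<omega>. continuous_on {0..} \<omega> \<and> (\<forall>t\<le>0. \<omega> t = 0)}"

definition compact_conv_open :: "(real \<Rightarrow> 'a::real_normed_vector) set \<Rightarrow> bool" where
  "compact_conv_open U \<longleftrightarrow> U \<subseteq> path_space \<and>
     (\<forall>\<omega>\<in>U. \<exists>K e. compact K \<and> K \<subseteq> {0..} \<and> e > 0 \<and>
        {\<eta>\<in>path_space. \<forall>t\<in>K. dist (\<eta> t) (\<omega> t) < e} \<subseteq> U)"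

definition path_topology :: "(real \<Rightarrow> 'a::real_normed_vector) topology" where
  "path_topology = topology compact_conv_open"

lemma istopology_compact_conv_open: "istopology compact_conv_open"
  unfolding istopology_def
proof (intro conjI allI impI)
  fix S T :: "(real \<Rightarrow> 'a) set"
  assume S: "compact_conv_open S" and T: "compact_conv_open T"
  show "compact_conv_open (S \<inter> T)"
    unfolding compact_conv_open_def
  proof (intro conjI ballI)
    show "S \<inter> T \<subseteq> path_space"
      using S by (auto simp: compact_conv_open_def)
    fix \<omega> assume \<omega>: "\<omega> \<in> S \<inter> T"
    from S \<omega> obtain K e where K: "compact K" "K \<subseteq> {0..}" "e > 0"
      "{\<eta>\<in>path_space. \<forall>t\<in>K. dist (\<eta> t) (\<omega> t) < e} \<subseteq> S"
      unfolding compact_conv_open_def by blast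
    from T \<omega> obtain L d where L: "compact L" "L \<subseteq> {0..}" "d > 0"
      "{\<eta>\<in>path_space. \<forall>t\<in>L. dist (\<eta> t) (\<omega> t) < d} \<subseteq> T"
      unfolding compact_conv_open_def by blast
    have "{\<eta>\<in>path_space. \<forall>t\<in>K \<union> L. dist (\<eta> t) (\<omega> t) < min e d} \<subseteq> S \<inter> T"
      using K(4) L(4) by fastforce
    moreover have "compact (K \<union> L)" "K \<union> L \<subseteq> {0..}" "0 < min e d"
      using K(1-3) L(1-3) by (simp_all add: compact_Un)
    ultimately show "\<exists>K e. compact K \<and> K \<subseteq> {0..} \<and> e > 0 \<and>
        {\<eta>\<in>path_space. \<forall>t\<in>K. dist (\<eta> t) (\<omega> t) < e} \<subseteq> S \<inter> T"
      by (intro exI conjI)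
  qed
next
  fix \<K> :: "(real \<Rightarrow> 'a) set set"
  assume \<K>: "\<forall>U\<in>\<K>. compact_conv_open U"
  show "compact_conv_open (\<Union>\<K>)"
    unfolding compact_conv_open_def
  proof (intro conjI ballI)
    show "\<Union>\<K> \<subseteq> path_space"
      using \<K> by (auto simp: compact_conv_open_def)
    fix \<omega> assume "\<omega> \<in> \<Union>\<K>"
    then obtain U where U: "U \<in> \<K>" "\<omega> \<in> U" by blast
    from U(1) \<K> have "compact_conv_open U" by blast
    with U(2) obtain K e where K: "compact K" "K \<subseteq> {0..}" "e > 0"
      "{\<eta>\<in>path_space. \<forall>t\<in>K. dist (\<eta> t) (\<omega> t) < e} \<subseteq> U"
      unfolding compact_conv_open_def by blast
    from K(4) U(1) have "{\<eta>\<in>path_space. \<forall>t\<in>K. dist (\<eta> t) (\<omega> t) < e} \<subseteq> \<Union>\<K>"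
      by (meson Sup_upper order_trans)
    with K(1-3) show "\<exists>K e. compact K \<and> K \<subseteq> {0..} \<and> e > 0 \<and>
        {\<eta>\<in>path_space. \<forall>t\<in>K. dist (\<eta> t) (\<omega> t) < e} \<subseteq> \<Union>\<K>"
      by (intro exI conjI)
  qed
qed

lemma openin_path_topology: "openin path_topology = compact_conv_open"
  unfolding path_topology_def
  by (rule topology_inverse'[OF istopology_compact_conv_open])

definition path_borel :: "(real \<Rightarrow> 'a::real_normed_vector) measure" where
  "path_borel = sigma path_space {U. openin path_topology U}"

text \<open>
  \<open>P\<close> is the Wiener measure: under \<open>P\<close> the coordinate process, which starts at 0 and is
  continuous by the choice of the space, has independent increments, and the increment between
  \<open>s\<close> and \<open>t\<close> is Gaussian with mean 0 and covariance \<open>(t - s)\<close> times the identity.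
\<close>

definition wiener_measure :: "(real \<Rightarrow> real^'d) measure \<Rightarrow> bool" where
  "wiener_measure P \<longleftrightarrow>
     prob_space P \<and> space P = path_space \<and> sets P = sets path_borel \<and>
     (\<forall>s t j. 0 \<le> s \<and> s < t \<longrightarrow>
        distributed P lborel (\<lambda>\<omega>. \<omega> t $ j - \<omega> s $ j) (normal_density 0 (sqrt (t - s)))) \<and>
     (\<forall>m \<tau>. 0 \<le> \<tau> 0 \<and> (\<forall>k<m. \<tau> k < \<tau> (Suc k)) \<longrightarrow>
        prob_space.indep_vars P (\<lambda>_. borel)
          (\<lambda>(k, j) \<omega>. \<omega> (\<tau> (Suc k)) $ j - \<omega> (\<tau> k) $ j) ({..<m::nat} \<times> UNIV))"

definition shift :: "real \<Rightarrow> (real \<Rightarrow> 'a::real_normed_vector) \<Rightarrow> real \<Rightarrow> 'a" where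
  "shift s \<omega> = (\<lambda>t. if t \<ge> 0 then \<omega> (t + s) - \<omega> s else 0)"

text \<open>
  The filtration of the coordinate process, augmented by all \<open>P\<close>-null sets.
\<close>

definition wiener_filtration ::
    "(real \<Rightarrow> real^'d) measure \<Rightarrow> real \<Rightarrow> (real \<Rightarrow> real^'d) measure" where
  "wiener_filtration P t = sigma path_space
     ({(\<lambda>\<omega>. \<omega> s) -` B \<inter> path_space | s B. 0 \<le> s \<and> s \<le> t \<and> B \<in> sets borel}
        \<union> null_sets (completion P))"


section \<open>The Ito integral\<close>

definition tendsto_in_prob ::
    "'a measure \<Rightarrow> (nat \<Rightarrow> 'a \<Rightarrow> real) \<Rightarrow> ('a \<Rightarrow> real) \<Rightarrow> bool" where
  "tendsto_in_prob M Y Z \<longleftrightarrow>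
     (\<forall>k. Y k \<in> borel_measurable M) \<and> Z \<in> borel_measurable M \<and>
     (\<forall>e>0. (\<lambda>k. measure M {\<omega>\<in>space M. \<bar>Y k \<omega> - Z \<omega>\<bar> > e}) \<longlonglongrightarrow> 0)"

text \<open>
  The elementary process \<open>\<Sum>k<m. \<xi> k\<close> on \<open>(\<tau> k, \<tau> (k+1)]\<close> and its integral over \<open>(0, t]\<close> against
  the \<open>j\<close>-th coordinate of the Brownian motion.
\<close>

definition elementary ::
    "(real \<Rightarrow> real^'d) measure \<Rightarrow> nat \<Rightarrow> (nat \<Rightarrow> real) \<Rightarrow>
     (nat \<Rightarrow> (real \<Rightarrow> real^'d) \<Rightarrow> real) \<Rightarrow> bool" where
  "elementary P m \<tau> \<xi> \<longleftrightarrow> 0 \<le> \<tau> 0 \<and> (\<forall>k<m. \<tau> k < \<tau> (Suc k)) \<and>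
     (\<forall>k<m. \<xi> k \<in> borel_measurable (wiener_filtration P (\<tau> k)) \<and> bounded (\<xi> k ` path_space))"

definition elementary_process ::
    "nat \<Rightarrow> (nat \<Rightarrow> real) \<Rightarrow> (nat \<Rightarrow> 'w \<Rightarrow> real) \<Rightarrow> real \<Rightarrow> 'w \<Rightarrow> real" where
  "elementary_process m \<tau> \<xi> s \<omega> = (\<Sum>k<m. \<xi> k \<omega> * indicator {\<tau> k<..\<tau> (Suc k)} s)"

definition elementary_integral ::
    "'d \<Rightarrow> nat \<Rightarrow> (nat \<Rightarrow> real) \<Rightarrow> (nat \<Rightarrow> (real \<Rightarrow> real^'d) \<Rightarrow> real) \<Rightarrow>
     real \<Rightarrow> (real \<Rightarrow> real^'d) \<Rightarrow> real" where
  "elementary_integral j m \<tau> \<xi> t \<omega> =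
     (\<Sum>k<m. \<xi> k \<omega> * (\<omega> (min t (\<tau> (Suc k))) $ j - \<omega> (min t (\<tau> k)) $ j))"

definition progressive ::
    "(real \<Rightarrow> real^'d) measure \<Rightarrow> (real \<Rightarrow> (real \<Rightarrow> real^'d) \<Rightarrow> real) \<Rightarrow> bool" where
  "progressive P H \<longleftrightarrow> (\<forall>t\<ge>0. (\<lambda>(s, \<omega>). H s \<omega>) \<in>
     borel_measurable (restrict_space borel {0..t} \<Otimes>\<^sub>M wiener_filtration P t))"

text \<open>
  Integrands are progressive, up to indistinguishability, with almost surely locally
  square-integrable paths.
\<close>

definition ito_integrand ::
    "(real \<Rightarrow> real^'d) measure \<Rightarrow> (real \<Rightarrow> (real \<Rightarrow> real^'d) \<Rightarrow> real) \<Rightarrow> bool" where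
  "ito_integrand P H \<longleftrightarrow>
     (\<exists>H'. progressive P H' \<and> (AE \<omega> in P. \<forall>t\<ge>0. H t \<omega> = H' t \<omega>)) \<and>
     (AE \<omega> in P. \<forall>t\<ge>0. set_integrable lborel {0..t} (\<lambda>s. (H s \<omega>)\<^sup>2))"

text \<open>
  The process \<open>I\<close> is a continuous version of \<open>t \<mapsto> \<integral>\<^sub>0\<^sup>t H dW\<^sup>j\<close>. The integral is the limit in
  probability of the integrals of elementary processes that approximate \<open>H\<close> in
  \<open>L\<^sup>2([0,t])\<close>, in probability. The limit does not depend on the approximating sequence, so \<open>I\<close> is
  determined up to indistinguishability.
\<close>

definition has_ito_integral ::
    "(real \<Rightarrow> real^'d) measure \<Rightarrow> 'd \<Rightarrow> (real \<Rightarrow> (real \<Rightarrow> real^'d) \<Rightarrow> real) \<Rightarrow>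
     (real \<Rightarrow> (real \<Rightarrow> real^'d) \<Rightarrow> real) \<Rightarrow> bool" where
  "has_ito_integral P j H I \<longleftrightarrow>
     ito_integrand P H \<and>
     (AE \<omega> in P. continuous_on {0..} (\<lambda>t. I t \<omega>)) \<and>
     (\<exists>m \<tau> \<xi>. (\<forall>k. elementary P (m k) (\<tau> k) (\<xi> k)) \<and>
        (\<forall>t\<ge>0.
           tendsto_in_prob (completion P)
             (\<lambda>k \<omega>. LBINT s:{0..t}. (elementary_process (m k) (\<tau> k) (\<xi> k) s \<omega> - H s \<omega>)\<^sup>2)
             (\<lambda>_. 0) \<and>
           tendsto_in_prob (completion P)
             (\<lambda>k. elementary_integral j (m k) (\<tau> k) (\<xi> k) t) (I t)))"


section \<open>The stochastic differential equation and its dynamical system\<close>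

definition locally_bounded ::
    "('a::topological_space \<Rightarrow> 'b::real_normed_vector) \<Rightarrow> bool" where
  "locally_bounded F \<longleftrightarrow> (\<forall>x. \<exists>U. open U \<and> x \<in> U \<and> bounded (F ` U))"

definition sde_solution ::
    "(real \<Rightarrow> real^'d) measure \<Rightarrow> (real^'n \<Rightarrow> real^'n) \<Rightarrow> (real^'n \<Rightarrow> real^'d^'n) \<Rightarrow> real^'n \<Rightarrow>
     (real \<Rightarrow> (real \<Rightarrow> real^'d) \<Rightarrow> real^'n) \<Rightarrow> bool" where
  "sde_solution P f g x Y \<longleftrightarrow>
     (\<forall>t\<ge>0. Y t \<in> borel_measurable (wiener_filtration P t)) \<and>
     (AE \<omega> in P. continuous_on {0..} (\<lambda>t. Y t \<omega>)) \<and>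
     (\<exists>I. (\<forall>i j. has_ito_integral P j (\<lambda>u \<omega>. g (Y u \<omega>) $ i $ j) (I i j)) \<and>
        (AE \<omega> in P. \<forall>t\<ge>0. \<forall>i. Y t \<omega> $ i =
           x $ i + (LBINT u:{0..t}. f (Y u \<omega>) $ i) + (\<Sum>j\<in>UNIV. I i j t \<omega>)))"

definition skew_product ::
    "(real \<Rightarrow> 'x \<Rightarrow> (real \<Rightarrow> real^'d) \<Rightarrow> 'x) \<Rightarrow> real \<Rightarrow>
     'x \<times> (real \<Rightarrow> real^'d) \<Rightarrow> 'x \<times> (real \<Rightarrow> real^'d)" where
  "skew_product X t = (\<lambda>(x, \<omega>). (X t x \<omega>, shift t \<omega>))"

definition koopman ::
    "(real \<Rightarrow> 'x \<Rightarrow> (real \<Rightarrow> real^'d) \<Rightarrow> 'x) \<Rightarrow> real \<Rightarrow>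
     ('x \<times> (real \<Rightarrow> real^'d) \<Rightarrow> real) \<Rightarrow> 'x \<times> (real \<Rightarrow> real^'d) \<Rightarrow> real" where
  "koopman X t k = k \<circ> skew_product X t"

definition tensor_one :: "('x \<Rightarrow> real) \<Rightarrow> 'x \<times> 'w \<Rightarrow> real" where
  "tensor_one h = (\<lambda>(x, \<omega>). h x)"

text \<open>
  The expectation is taken under the completed measure because measurability on the canonical
  space is meant up to null sets.
\<close>

definition expected_op ::
    "(real \<Rightarrow> real^'d) measure \<Rightarrow> (real \<Rightarrow> 'x \<Rightarrow> (real \<Rightarrow> real^'d) \<Rightarrow> 'x) \<Rightarrow> real \<Rightarrow>
     ('x \<Rightarrow> real) \<Rightarrow> 'x \<Rightarrow> real" where
  "expected_op P X t h x = (LINT \<omega>|completion P. koopman X t (tensor_one h) (x, \<omega>))"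


section \<open>Markov semigroups and generators\<close>

definition bounded_measurable :: "('x::topological_space \<Rightarrow> real) \<Rightarrow> bool" where
  "bounded_measurable h \<longleftrightarrow> h \<in> borel_measurable borel \<and> bounded (range h)"

definition markov_operator :: "((real^'n \<Rightarrow> real) \<Rightarrow> real^'n \<Rightarrow> real) \<Rightarrow> bool" where
  "markov_operator L \<longleftrightarrow> (\<exists>\<nu> \<in> borel \<rightarrow>\<^sub>M prob_algebra borel.
     \<forall>h. bounded_measurable h \<longrightarrow> (\<forall>x. L h x = (LINT y|\<nu> x. h y)))"

definition markov_semigroup :: "(real \<Rightarrow> (real^'n \<Rightarrow> real) \<Rightarrow> real^'n \<Rightarrow> real) \<Rightarrow> bool" where
  "markov_semigroup Q \<longleftrightarrow>
     (\<forall>t\<ge>0. markov_operator (Q t)) \<and>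
     (\<forall>h. bounded_measurable h \<longrightarrow> Q 0 h = h) \<and>
     (\<forall>s\<ge>0. \<forall>t\<ge>0. \<forall>h. bounded_measurable h \<longrightarrow> Q t (Q s h) = Q (s + t) h)"

definition partial_deriv :: "'n \<Rightarrow> (real^'n \<Rightarrow> real) \<Rightarrow> real^'n \<Rightarrow> real" where
  "partial_deriv i h x = deriv (\<lambda>s. h (x + s *\<^sub>R axis i 1)) 0"

definition C1 :: "(real^'n \<Rightarrow> real) \<Rightarrow> bool" where
  "C1 h \<longleftrightarrow> (\<forall>x. h differentiable (at x)) \<and> (\<forall>i. continuous_on UNIV (partial_deriv i h))"

definition C2 :: "(real^'n \<Rightarrow> real) \<Rightarrow> bool" where
  "C2 h \<longleftrightarrow> C1 h \<and> (\<forall>i. C1 (partial_deriv i h))"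

definition has_generator ::
    "(real \<Rightarrow> (real^'n \<Rightarrow> real) \<Rightarrow> real^'n \<Rightarrow> real) \<Rightarrow>
     ((real^'n \<Rightarrow> real) \<Rightarrow> real^'n \<Rightarrow> real) \<Rightarrow> bool" where
  "has_generator Q A \<longleftrightarrow> (\<forall>h. C2 h \<and> compact (closure {x. h x \<noteq> 0}) \<longrightarrow>
     uniform_limit UNIV (\<lambda>t x. (Q t h x - h x) / t) (A h) (at_right 0))"

definition sde_generator ::
    "(real^'n \<Rightarrow> real^'n) \<Rightarrow> (real^'n \<Rightarrow> real^'d^'n) \<Rightarrow> (real^'n \<Rightarrow> real) \<Rightarrow> real^'n \<Rightarrow> real" where
  "sde_generator f g h x =
     (\<Sum>i\<in>UNIV. f x $ i * partial_deriv i h x) +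
     1/2 * (\<Sum>i\<in>UNIV. \<Sum>j\<in>UNIV. \<Sum>\<alpha>\<in>UNIV.
        g x $ i $ \<alpha> * g x $ j $ \<alpha> * partial_deriv i (partial_deriv j h) x)"

end

theory Submission
  imports Defs
begin

text \<open>
  Neither Ito's formula nor a substitution of random initial values into stochastic integrals is
  needed: everything is read off the Euler scheme. Stopping the martingale of an elementary
  integral gives Lenglart's inequality, and with it the Riemann sums of an Ito integral with a
  continuous adapted integrand converge in probability, uniformly over the nodes. A Gronwall
  argument, in which the increments are switched off once the Riemann sum error of the equation is
  no longer small, turns this into convergence in probability of the Euler scheme to the solution.

  Let \<open>Q\<^sub>\<delta> h x\<close> be the expectation of \<open>h\<close> after one Euler step of length \<open>\<delta>\<close> from \<open>x\<close>. By the
  independence of the increments the scheme iterates the operators \<open>Q\<^sub>\<delta>\<close>, so that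
  \<open>P\<^sub>t h = lim Q\<^bsub>t/N\<^esub>\<^sup>N h\<close>; these iterates of a Lipschitz function are Lipschitz uniformly in \<open>N\<close>. The
  semigroup law is the limit of the scheme on \<open>N\<close> steps of length \<open>t/N\<close> followed by \<open>N\<close> steps of
  length \<open>s/N\<close>. For the generator, Taylor's formula and Gaussian moments give
  \<open>Q\<^sub>\<delta> h - h = \<delta> A h + o(\<delta>)\<close> uniformly, and the telescoping sum over the steps gives
  \<open>P\<^sub>t h - h = t A h + o(t)\<close> because the scheme does not move far in a short time.
\<close>

section \<open>The Brownian filtration\<close>

text \<open>The definitions give little to start from: a stochastic integral is only a limit in
  probability, for each time separately, along one unspecified sequence of elementary processes, and
  a solution comes without any moments. So the solution enters through one estimate only, that its
  equation with Riemann sums in place of integrals has a small residual off a small event; moment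
  bounds are proved for discrete recursions, where they follow step by step. Bounded Lipschitz
  functions carry all weak limits: convergence in probability suffices for them, the scheme
  preserves them with constants free of the mesh, and they determine a probability measure, so
  identities extend to bounded measurable functions. In the semigroup law the equi-Lipschitz bound
  is what lets the function and its random argument vary together. The generator is needed uniformly
  in space although the coefficients are unbounded. Compact support helps: a far point must move by
  about \<open>norm x / 2\<close> to be noticed, while the size of its moves grows at most linearly
  in \<open>norm x\<close>, so the estimates lose their dependence on x.\<close>

lemma strict_mono_enumeration:
  fixes S :: "real set"
  assumes "finite S" "S \<noteq> {}"
  obtains m s where "S = s ` {..m::nat}" "\<And>i. i < m \<Longrightarrow> s i < s (Suc i)"
proof
  let ?l = "sorted_list_of_set S"
  have len: "length ?l > 0" using assms by (simp add: card_gt_0_iff)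
  have "S = set ?l" using assms by simp
  also have "\<dots> = (!) ?l ` {..length ?l - 1}"
  proof -
    have "{..length ?l - 1} = {..<length ?l}" using len by auto
    then show ?thesis by (simp only: set_conv_nth) blast
  qed
  finally show "S = (!) ?l ` {..length ?l - 1}" .
  fix i assume "i < length ?l - 1"
  then show "?l ! i < ?l ! Suc i"
    using strict_sorted_list_of_set[of S] by (auto simp: sorted_wrt_iff_nth_less)
qed

lemma steps_mono:
  fixes s :: "nat \<Rightarrow> real"
  assumes "\<And>i. i < m \<Longrightarrow> s i < s (Suc i)" "i \<le> j" "j \<le> m"
  shows "s i \<le> s j"
  using assms(2,3)
proof (induction j rule: dec_induct)
  case (step n)
  then show ?case using assms(1)[of n] by auto
qed auto

lemma borel_measurable_vecI:
  fixes f :: "'a \<Rightarrow> real^'n"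
  assumes "\<And>j. (\<lambda>x. f x $ j) \<in> borel_measurable M"
  shows "f \<in> borel_measurable M"
proof (rule borel_measurable_euclidean_space[THEN iffD2], rule ballI)
  fix b :: "real^'n" assume "b \<in> Basis"
  then obtain j where b: "b = axis j 1" unfolding Basis_vec_def by fastforce
  then show "(\<lambda>x. f x \<bullet> b) \<in> borel_measurable M"
    using assms[of j] unfolding b inner_axis by simp
qed

text \<open>The singleton \<open>{s}\<close> is compact, so the topology of compact convergence
  controls the value at a single time.\<close>

lemma open_evaluation:
  fixes U :: "'a::real_normed_vector set"
  assumes "open U" "0 \<le> s"
  shows "openin path_topology {\<omega>\<in>path_space. \<omega> s \<in> U}"
  unfolding openin_path_topology compact_conv_open_def
proof (intro conjI ballI)
  fix \<omega> :: "real \<Rightarrow> 'a" assume \<omega>: "\<omega> \<in> {\<omega>\<in>path_space. \<omega> s \<in> U}"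
  then obtain e where "e > 0" "ball (\<omega> s) e \<subseteq> U"
    using assms openE by auto
  then show "\<exists>K e. compact K \<and> K \<subseteq> {0..} \<and> 0 < e \<and>
      {\<eta> \<in> path_space. \<forall>t\<in>K. dist (\<eta> t) (\<omega> t) < e} \<subseteq> {\<omega>\<in>path_space. \<omega> s \<in> U}"
    using assms by (intro exI[of _ "{s}"] exI[of _ e]) (auto simp: subset_iff dist_commute)
qed auto

lemma space_path_borel: "space path_borel = path_space"
  by (simp add: path_borel_def space_measure_of_conv)

lemma measurable_evaluation:
  assumes "0 \<le> s"
  shows "(\<lambda>\<omega>. \<omega> s :: 'a::real_normed_vector) \<in> borel_measurable path_borel"
proof (rule borel_measurableI)
  fix U :: "'a set" assume "open U"
  then have "openin path_topology {\<omega>\<in>path_space. \<omega> s \<in> U}"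
    using assms by (rule open_evaluation)
  moreover have "{U :: (real \<Rightarrow> 'a) set. openin path_topology U} \<subseteq> Pow path_space"
    by (auto simp: openin_path_topology compact_conv_open_def)
  moreover have "(\<lambda>\<omega>. \<omega> s) -` U \<inter> space path_borel = {\<omega>\<in>path_space. \<omega> s \<in> U}"
    by (auto simp: space_path_borel)
  ultimately show "(\<lambda>\<omega>. \<omega> s) -` U \<inter> space path_borel \<in> sets path_borel"
    by (auto simp: path_borel_def sets_measure_of)
qed

locale wiener =
  fixes P :: "(real \<Rightarrow> real^'d) measure"
  assumes wiener: "wiener_measure P"
begin

text \<open>All probability takes place in the completion: each \<open>F t\<close> contains its null
  sets and is therefore a sub-sigma-field of \<open>M\<close>, in general not of
  \<open>P\<close>.\<close>

abbreviation "M \<equiv> completion P"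
abbreviation "F \<equiv> wiener_filtration P"

lemma prob_space_P: "prob_space P"
  and space_P: "space P = path_space"
  and sets_P: "sets P = sets path_borel"
  using wiener by (auto simp: wiener_measure_def)

end

sublocale wiener \<subseteq> prob_space "completion P"
  by (rule prob_space.prob_space_completion[OF prob_space_P])

context wiener
begin

lemma space_M: "space M = path_space"
  by (simp add: space_P)

lemma measurable_coord_P: "0 \<le> s \<Longrightarrow> (\<lambda>\<omega>. \<omega> s) \<in> borel_measurable P"
  using measurable_evaluation[of s] measurable_cong_sets[OF sets_P refl] by blast

lemma measurable_coord_M: "0 \<le> s \<Longrightarrow> (\<lambda>\<omega>. \<omega> s) \<in> borel_measurable M"
  by (rule measurable_completion[OF measurable_coord_P])

definition filtration_gen :: "real \<Rightarrow> (real \<Rightarrow> real^'d) set set" where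
  "filtration_gen t = {(\<lambda>\<omega>. \<omega> s) -` B \<inter> path_space | s B. 0 \<le> s \<and> s \<le> t \<and> B \<in> sets borel}
        \<union> null_sets M"

lemma filtration_gen_sub: "filtration_gen t \<subseteq> sets M"
  using measurable_sets[OF measurable_coord_M]
  by (auto simp: filtration_gen_def space_P null_sets_def)

lemma filtration_gen_Pow: "filtration_gen t \<subseteq> Pow path_space"
  using filtration_gen_sub[of t] sets.sets_into_space[of _ M] by (auto simp: space_P)

lemma space_F: "space (F t) = path_space"
  by (simp add: wiener_filtration_def space_measure_of_conv)

lemma sets_F: "sets (F t) = sigma_sets path_space (filtration_gen t)"
  using filtration_gen_Pow[of t]
  by (simp add: wiener_filtration_def filtration_gen_def sets_measure_of)

lemma sets_F_sub: "sets (F t) \<subseteq> sets M"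
  using sets.sigma_sets_subset[OF filtration_gen_sub[of t]] by (simp add: sets_F space_P)

lemma sets_F_mono: "s \<le> t \<Longrightarrow> sets (F s) \<subseteq> sets (F t)"
proof -
  assume st: "s \<le> t"
  have "filtration_gen s \<subseteq> filtration_gen t"
  proof
    fix A assume "A \<in> filtration_gen s"
    then consider u B where "A = (\<lambda>\<omega>. \<omega> u) -` B \<inter> path_space" "0 \<le> u" "u \<le> s" "B \<in> sets borel"
      | "A \<in> null_sets M"
      unfolding filtration_gen_def by blast
    then show "A \<in> filtration_gen t"
    proof cases
      case 1
      moreover have "u \<le> t" using 1(3) st by (rule order_trans)
      ultimately show ?thesis unfolding filtration_gen_def by blast
    next
      case 2
      then show ?thesis unfolding filtration_gen_def by (rule UnI2)
    qed
  qed
  then show ?thesis unfolding sets_F by (rule sigma_sets_mono')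
qed

lemma measurable_F_mono: "f \<in> measurable (F s) N \<Longrightarrow> s \<le> t \<Longrightarrow> f \<in> measurable (F t) N"
  using sets_F_mono[of s t] by (auto simp: measurable_def space_F)

lemma measurable_F_M: "f \<in> measurable (F s) N \<Longrightarrow> f \<in> measurable M N"
  using sets_F_sub[of s] by (auto simp: measurable_def space_F space_P)

lemma measurable_coord_F:
  assumes "0 \<le> s" "s \<le> t" shows "(\<lambda>\<omega>. \<omega> s) \<in> borel_measurable (F t)"
proof (rule measurableI)
  fix A :: "(real^'d) set" assume "A \<in> sets borel"
  then have "(\<lambda>\<omega>. \<omega> s) -` A \<inter> space (F t) \<in> filtration_gen t"
    using assms by (auto simp: filtration_gen_def space_F)
  then show "(\<lambda>\<omega>. \<omega> s) -` A \<inter> space (F t) \<in> sets (F t)"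
    by (auto simp: sets_F)
qed simp

lemma path_0: "\<omega> \<in> path_space \<Longrightarrow> \<omega> 0 = 0"
  by (simp add: path_space_def)

text \<open>Independence is moved from \<open>P\<close> to its completion through the joint law,
  which is the same under both for variables that are measurable with respect to
  \<open>P\<close>.\<close>

lemma indep_increments:
  assumes "0 \<le> \<tau> 0" "\<And>k. k < m \<Longrightarrow> \<tau> k < \<tau> (Suc k)"
  shows "indep_vars (\<lambda>_. borel) (\<lambda>(k, j) \<omega>. \<omega> (\<tau> (Suc k)) $ j - \<omega> (\<tau> k) $ j) ({..<m::nat} \<times> UNIV)"
proof (cases "m = 0")
  case True
  then show ?thesis by (simp add: indep_vars_def2 indep_sets_def)
next
  case False
  let ?X = "\<lambda>(k, j) (\<omega> :: real \<Rightarrow> real^'d). \<omega> (\<tau> (Suc k)) $ j - \<omega> (\<tau> k) $ j"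
  let ?I = "{..<m} \<times> (UNIV :: 'd set)"
  have tau: "0 \<le> \<tau> k" if "k \<le> m" for k
    using steps_mono[of m \<tau> 0 k] assms that by auto
  have meas: "?X i \<in> borel_measurable P" if "i \<in> ?I" for i
  proof -
    obtain k j where i: "i = (k, j)" "k < m" using \<open>i \<in> ?I\<close> by auto
    have "(\<lambda>\<omega>. \<omega> (\<tau> l) $ j) \<in> borel_measurable P" if "l \<le> m" for l
      by (rule measurable_compose[OF measurable_coord_P[OF tau[OF that]] borel_measurable_nth])
    then show ?thesis unfolding i using \<open>k < m\<close> by (simp add: borel_measurable_diff)
  qed
  have I: "?I \<noteq> {}" using False by auto
  \<comment> \<open>The criterion by product laws asks for measurability at every index, but only
    the times belonging to \<open>?I\<close> are known to be nonnegative; hence the value 0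
    elsewhere.\<close>
  define X where "X i = (if i \<in> ?I then ?X i else (\<lambda>_. 0))" for i
  have X: "X i \<in> borel_measurable P" for i
  proof (cases "i \<in> ?I")
    case True
    then show ?thesis unfolding X_def if_P[OF True] by (rule meas)
  next
    case False
    then show ?thesis unfolding X_def if_not_P[OF False] by simp
  qed
  have X_M: "X i \<in> borel_measurable M" for i
    by (rule measurable_completion[OF X])
  have XX: "X i = ?X i" if "i \<in> ?I" for i
    unfolding X_def using that by (rule if_P)
  have P: "prob_space.indep_vars P (\<lambda>_. borel) ?X ?I"
    using wiener assms unfolding wiener_measure_def by blast
  have "prob_space.indep_vars P (\<lambda>_. borel) X ?I = prob_space.indep_vars P (\<lambda>_. borel) ?X ?I"
    by (rule prob_space.indep_vars_cong[OF prob_space_P refl XX refl])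
  with P have "prob_space.indep_vars P (\<lambda>_. borel) X ?I" by (rule rev_iffD2)
  then have "distr P (\<Pi>\<^sub>M i\<in>?I. borel) (\<lambda>x. \<lambda>i\<in>?I. X i x) = (\<Pi>\<^sub>M i\<in>?I. distr P borel (X i))"
    using X prob_space.indep_vars_iff_distr_eq_PiM[OF prob_space_P I, where X = X and M' = "\<lambda>_. borel"]
    by (simp only:)
  then have "distr M (\<Pi>\<^sub>M i\<in>?I. borel) (\<lambda>x. \<lambda>i\<in>?I. X i x) = (\<Pi>\<^sub>M i\<in>?I. distr M borel (X i))"
    using X by (simp add: distr_completion)
  then have "indep_vars (\<lambda>_. borel) X ?I"
    using indep_vars_iff_distr_eq_PiM[OF I, where X = X and M' = "\<lambda>_. borel"] X_M by (simp only:)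
  moreover have "indep_vars (\<lambda>_. borel) X ?I = indep_vars (\<lambda>_. borel) ?X ?I"
    by (rule indep_vars_cong[OF refl XX refl])
  ultimately show ?thesis by (rule iffD1[rotated])
qed


text \<open>Unlike the one-time events that generate \<open>F s\<close>, these sets are stable under
  intersection, as needed to extend independence to the generated sigma-field.\<close>

definition cylinders :: "real \<Rightarrow> (real \<Rightarrow> real^'d) set set" where
  "cylinders s = {{\<omega>\<in>path_space. \<forall>u\<in>S. \<omega> u \<in> B u} | S B.
     finite S \<and> S \<subseteq> {0..s} \<and> (\<forall>u. B u \<in> sets borel)}"

lemma cylinders_sub: "cylinders s \<subseteq> sets M"
proof
  fix A assume "A \<in> cylinders s"
  then obtain S B where A: "A = {\<omega>\<in>path_space. \<forall>u\<in>S. \<omega> u \<in> B u}"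
    and S: "finite S" "S \<subseteq> {0..s}" and B: "\<And>u. B u \<in> sets borel"
    unfolding cylinders_def by blast
  have "{\<omega>\<in>space M. \<omega> u \<in> B u} \<in> sets M" if "u \<in> S" for u
    using measurable_sets[OF measurable_coord_M[of u] B[of u]] that S
    by (auto simp: vimage_def Int_def conj_commute)
  then have "{\<omega>\<in>space M. \<forall>u\<in>S. \<omega> u \<in> B u} \<in> sets M"
    using S(1) by (intro sets.sets_Collect_finite_All) auto
  then show "A \<in> sets M" unfolding A by (simp add: space_P)
qed

lemma Int_stable_cylinders: "Int_stable (cylinders s)"
proof (rule Int_stableI)
  fix a b assume "a \<in> cylinders s" "b \<in> cylinders s"
  then obtain S B S' B' where a: "a = {\<omega>\<in>path_space. \<forall>u\<in>S. \<omega> u \<in> B u}"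
    "finite S" "S \<subseteq> {0..s}" "\<And>u. B u \<in> sets borel"
    and b: "b = {\<omega>\<in>path_space. \<forall>u\<in>S'. \<omega> u \<in> B' u}"
    "finite S'" "S' \<subseteq> {0..s}" "\<And>u. B' u \<in> sets borel"
    unfolding cylinders_def by blast
  let ?B = "\<lambda>u. (if u \<in> S then B u else UNIV) \<inter> (if u \<in> S' then B' u else UNIV)"
  have "a \<inter> b = {\<omega>\<in>path_space. \<forall>u\<in>S\<union>S'. \<omega> u \<in> ?B u}"
    unfolding a b by auto
  moreover have "finite (S \<union> S')" "S \<union> S' \<subseteq> {0..s}" "\<forall>u. ?B u \<in> sets borel"
    using a(2-4) b(2-4) by auto
  ultimately show "a \<inter> b \<in> cylinders s"
    unfolding cylinders_def by (intro CollectI exI[of _ "S \<union> S'"] exI[of _ ?B] conjI)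
qed

text \<open>Paths start at 0, so the values at the nodes up to \<open>s\<close> are partial sums of
  consecutive increments. The event \<open>A\<close> is thus a function of increments before
  \<open>s\<close>, and these are independent of the increment after \<open>s\<close>.\<close>

lemma cylinder_indep_increment:
  assumes st: "0 \<le> s" "s < t" and A: "A \<in> cylinders s" and C: "C \<in> sets borel"
  shows "prob (A \<inter> {\<omega>\<in>space M. \<omega> t - \<omega> s \<in> C}) = prob A * prob {\<omega>\<in>space M. \<omega> t - \<omega> s \<in> C}"
proof -
  obtain S B where A: "A = {\<omega>\<in>path_space. \<forall>u\<in>S. \<omega> u \<in> B u}"
    and S: "finite S" "S \<subseteq> {0..s}" and B: "\<And>u. B u \<in> sets borel"
    using A unfolding cylinders_def by blast
  \<comment> \<open>Adding 0 makes the partial sums start from the known value; adding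
    \<open>s\<close> makes the last of the old increments end where the new one begins.\<close>
  obtain m \<sigma> where \<sigma>: "S \<union> {0, s} = \<sigma> ` {..m::nat}" "\<And>i. i < m \<Longrightarrow> \<sigma> i < \<sigma> (Suc i)"
    using strict_mono_enumeration[of "S \<union> {0,s}"] S(1) by (metis Un_empty finite.emptyI finite.insertI finite_UnI insert_not_empty)
  have S_range: "u \<in> {0..s}" if "u \<in> \<sigma> ` {..m}" for u
    using that S(2) st unfolding \<sigma>(1)[symmetric] by auto
  have "0 \<in> \<sigma> ` {..m}" "s \<in> \<sigma> ` {..m}" unfolding \<sigma>(1)[symmetric] by auto
  then obtain i0 i1 where i0: "i0 \<le> m" "\<sigma> i0 = 0" and i1: "i1 \<le> m" "\<sigma> i1 = s" by auto
  have \<sigma>0: "\<sigma> 0 = 0"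
    using steps_mono[of m \<sigma> 0 i0, OF \<sigma>(2)] i0 S_range[of "\<sigma> 0"] by auto
  have \<sigma>m: "\<sigma> m = s"
    using steps_mono[of m \<sigma> i1 m, OF \<sigma>(2)] i1 S_range[of "\<sigma> m"] by auto
  define \<tau> where "\<tau> k = (if k \<le> m then \<sigma> k else t)" for k
  have \<tau>: "\<tau> 0 = 0" "\<tau> m = s" "\<tau> (Suc m) = t" "\<And>k. k \<le> m \<Longrightarrow> \<tau> k = \<sigma> k"
    using \<sigma>0 \<sigma>m by (auto simp: \<tau>_def)
  have \<tau>_step: "\<tau> k < \<tau> (Suc k)" if "k < Suc m" for k
    using that \<sigma>(2)[of k] st \<sigma>m by (cases "k = m") (auto simp: \<tau>_def)
  let ?X = "\<lambda>(k, j) (\<omega> :: real \<Rightarrow> real^'d). \<omega> (\<tau> (Suc k)) $ j - \<omega> (\<tau> k) $ j"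
  let ?A = "{..<m} \<times> (UNIV :: 'd set)" and ?B = "{m} \<times> (UNIV :: 'd set)"
  have "indep_vars (\<lambda>_. borel) ?X ({..<Suc m} \<times> UNIV)"
    proof (rule indep_increments)
    show "0 \<le> \<tau> 0" by (simp add: \<tau>(1))
  qed (rule \<tau>_step)
  then have ind: "indep_var (PiM ?A (\<lambda>_. borel)) (\<lambda>\<omega>. restrict (\<lambda>i. ?X i \<omega>) ?A)
      (PiM ?B (\<lambda>_. borel)) (\<lambda>\<omega>. restrict (\<lambda>i. ?X i \<omega>) ?B)"
    by (rule indep_var_restrict) auto
  \<comment> \<open>\<open>pos\<close> rebuilds the position at node k from the increments before
    \<open>s\<close>, and \<open>inc\<close> reads off the increment after \<open>s\<close>; they
    turn both events into preimages under independent vectors.\<close>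
  define pos :: "nat \<Rightarrow> (nat \<times> 'd \<Rightarrow> real) \<Rightarrow> real^'d" where "pos k z = (\<chi> j. \<Sum>l<k. z (l, j))" for k z
  define inc :: "(nat \<times> 'd \<Rightarrow> real) \<Rightarrow> real^'d" where "inc z = (\<chi> j. z (m, j))" for z
  have pos_meas: "pos k \<in> borel_measurable (PiM ?A (\<lambda>_. borel))" if "k \<le> m" for k
  proof (rule borel_measurable_vecI)
    fix j
    have "(\<lambda>z. z (l, j)) \<in> borel_measurable (PiM ?A (\<lambda>_. borel :: real measure))" if "l < k" for l
      using that \<open>k \<le> m\<close> by (intro measurable_component_singleton) auto
    then show "(\<lambda>x. pos k x $ j) \<in> borel_measurable (PiM ?A (\<lambda>_. borel))"
      unfolding pos_def by (simp add: borel_measurable_sum)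
  qed
  have inc_meas: "inc \<in> borel_measurable (PiM ?B (\<lambda>_. borel))"
  proof (rule borel_measurable_vecI)
    fix j
    have "(\<lambda>z. z (m, j)) \<in> borel_measurable (PiM ?B (\<lambda>_. borel :: real measure))"
      by (intro measurable_component_singleton) auto
    then show "(\<lambda>x. inc x $ j) \<in> borel_measurable (PiM ?B (\<lambda>_. borel))"
      unfolding inc_def by simp
  qed
  let ?U = "{z\<in>space (PiM ?A (\<lambda>_. borel)). \<forall>k\<in>{k. k \<le> m \<and> \<sigma> k \<in> S}. pos k z \<in> B (\<sigma> k)}"
  let ?V = "inc -` C \<inter> space (PiM ?B (\<lambda>_. borel))"
  have U: "?U \<in> sets (PiM ?A (\<lambda>_. borel))"
  proof (intro sets.sets_Collect_finite_All)
    fix k assume "k \<in> {k. k \<le> m \<and> \<sigma> k \<in> S}"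
    then show "{z\<in>space (PiM ?A (\<lambda>_. borel)). pos k z \<in> B (\<sigma> k)} \<in> sets (PiM ?A (\<lambda>_. borel))"
      using measurable_sets[OF pos_meas[of k] B[of "\<sigma> k"]]
      by (auto simp: vimage_def Int_def conj_commute)
  qed simp
  have V: "?V \<in> sets (PiM ?B (\<lambda>_. borel))"
    by (rule measurable_sets[OF inc_meas C])
  have pos_eq: "pos k (restrict (\<lambda>i. ?X i \<omega>) ?A) = \<omega> (\<sigma> k)" if "k \<le> m" "\<omega> \<in> path_space" for k \<omega>
  proof -
    have "pos k (restrict (\<lambda>i. ?X i \<omega>) ?A) = (\<chi> j. \<Sum>l<k. \<omega> (\<tau> (Suc l)) $ j - \<omega> (\<tau> l) $ j)"
      unfolding pos_def using that by (intro arg_cong[where f = vec_lambda] ext sum.cong) auto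
    also have "\<dots> = \<omega> (\<tau> k)"
      using \<tau>(1) path_0[OF that(2)] sum_lessThan_telescope[of "\<lambda>l. \<omega> (\<tau> l) $ j" k for j]
      by (simp add: vec_eq_iff)
    finally show ?thesis using \<tau>(4)[OF that(1)] by simp
  qed
  have inc_eq: "inc (restrict (\<lambda>i. ?X i \<omega>) ?B) = \<omega> t - \<omega> s" for \<omega>
    unfolding inc_def by (simp add: vec_eq_iff \<tau>(2,3))
  have sp: "restrict (\<lambda>i. ?X i \<omega>) K \<in> space (PiM K (\<lambda>_. borel))" for K \<omega>
    by (simp add: space_PiM)
  have A_eq: "(\<lambda>\<omega>. restrict (\<lambda>i. ?X i \<omega>) ?A) -` ?U \<inter> space M = A"
  proof (rule set_eqI)
    fix \<omega>
    have "(\<forall>k\<in>{k. k \<le> m \<and> \<sigma> k \<in> S}. \<omega> (\<sigma> k) \<in> B (\<sigma> k)) \<longleftrightarrow> (\<forall>u\<in>S. \<omega> u \<in> B u)"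
    proof safe
      fix u assume *: "\<forall>k\<in>{k. k \<le> m \<and> \<sigma> k \<in> S}. \<omega> (\<sigma> k) \<in> B (\<sigma> k)" "u \<in> S"
      then have "u \<in> \<sigma> ` {..m}" using \<sigma>(1) by blast
      then show "\<omega> u \<in> B u" using * by auto
    qed auto
    then show "\<omega> \<in> (\<lambda>\<omega>. restrict (\<lambda>i. ?X i \<omega>) ?A) -` ?U \<inter> space M \<longleftrightarrow> \<omega> \<in> A"
      unfolding A using sp[of \<omega> ?A] pos_eq by (auto simp: space_P simp del: restrict_apply)
  qed
  have C_eq: "(\<lambda>\<omega>. restrict (\<lambda>i. ?X i \<omega>) ?B) -` ?V \<inter> space M = {\<omega>\<in>space M. \<omega> t - \<omega> s \<in> C}"
    using sp[of _ ?B] inc_eq by (auto simp del: restrict_apply)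
  have "prob ((\<lambda>x. (restrict (\<lambda>i. ?X i x) ?A, restrict (\<lambda>i. ?X i x) ?B)) -` (?U \<times> ?V) \<inter> space M)
      = prob A * prob {\<omega>\<in>space M. \<omega> t - \<omega> s \<in> C}"
    using indep_varD[OF ind U V] unfolding A_eq C_eq .
  moreover have "(\<lambda>x. (restrict (\<lambda>i. ?X i x) ?A, restrict (\<lambda>i. ?X i x) ?B)) -` (?U \<times> ?V) \<inter> space M
      = A \<inter> {\<omega>\<in>space M. \<omega> t - \<omega> s \<in> C}"
  proof -
    have "(\<lambda>x. (f x, g x)) -` (U' \<times> V') \<inter> space M = (f -` U' \<inter> space M) \<inter> (g -` V' \<inter> space M)"
      for f :: "_ \<Rightarrow> nat \<times> 'd \<Rightarrow> real" and g :: "_ \<Rightarrow> nat \<times> 'd \<Rightarrow> real" and U' V'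
      by auto
    then show ?thesis by (simp only: A_eq C_eq)
  qed
  ultimately show ?thesis by (simp only:)
qed

text \<open>A pi-system argument: cylinders together with the null sets are stable under
  intersection and contain the generators of \<open>F s\<close>. For null sets both sides of the
  product formula vanish.\<close>

lemma filtration_indep_increment:
  assumes st: "0 \<le> s" "s < t" and A: "A \<in> sets (F s)" and C: "C \<in> sets borel"
  shows "prob (A \<inter> {\<omega>\<in>space M. \<omega> t - \<omega> s \<in> C}) = prob A * prob {\<omega>\<in>space M. \<omega> t - \<omega> s \<in> C}"
proof -
  let ?C = "{\<omega>\<in>space M. \<omega> t - \<omega> s \<in> C}"
  let ?G = "cylinders s \<union> null_sets M"
  have C': "?C \<in> sets M"
    using measurable_sets[OF borel_measurable_diff[OF measurable_coord_M measurable_coord_M] C, of t s] st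
    by (simp add: vimage_def Int_def conj_commute)
  have "indep_set ?G {?C}"
  proof (rule indep_setI)
    show "?G \<subseteq> events" using cylinders_sub by auto
    show "{?C} \<subseteq> events" using C' by simp
    fix a b assume a: "a \<in> ?G" and "b \<in> {?C}"
    then have b: "b = ?C" by simp
    show "prob (a \<inter> b) = prob a * prob b"
    proof (cases "a \<in> cylinders s")
      case True
      then show ?thesis unfolding b by (rule cylinder_indep_increment[OF st _ C])
    next
      case False
      then have a: "a \<in> null_sets M" using a by blast
      then have "a \<inter> ?C \<in> null_sets M" using C' by (rule null_set_Int2)
      with a show ?thesis unfolding b by (simp add: measure_def null_setsD1)
    qed
  qed
  moreover have "Int_stable ?G"
  proof (rule Int_stableI)
    fix a b assume ab: "a \<in> ?G" "b \<in> ?G"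
    then have sets: "a \<in> sets M" "b \<in> sets M" using cylinders_sub by auto
    show "a \<inter> b \<in> ?G"
    proof (cases "a \<in> cylinders s \<and> b \<in> cylinders s")
      case True
      then show ?thesis using Int_stable_cylinders[of s] by (auto simp: Int_stable_def)
    next
      case False
      then have "a \<in> null_sets M \<or> b \<in> null_sets M" using ab by blast
      then have "a \<inter> b \<in> null_sets M" using sets by (auto intro: null_set_Int1 null_set_Int2)
      then show ?thesis by blast
    qed
  qed
  moreover have "Int_stable {?C}" by (auto simp: Int_stable_def)
  ultimately have ind: "indep_set (sigma_sets (space M) ?G) (sigma_sets (space M) {?C})"
    by (rule indep_set_sigma_sets)
  have "filtration_gen s \<subseteq> ?G"
  proof
    fix A assume "A \<in> filtration_gen s"
    then consider u B where "A = (\<lambda>\<omega>. \<omega> u) -` B \<inter> path_space" "0 \<le> u" "u \<le> s" "B \<in> sets borel"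
      | "A \<in> null_sets M"
      unfolding filtration_gen_def by blast
    then show "A \<in> ?G"
    proof cases
      case 1
      then have "A = {\<omega>\<in>path_space. \<forall>v\<in>{u}. \<omega> v \<in> (\<lambda>_. B) v}" by auto
      moreover have "finite {u}" "{u} \<subseteq> {0..s}" "\<forall>v. (\<lambda>_. B) v \<in> sets borel"
        using 1 by auto
      ultimately have "A \<in> cylinders s" unfolding cylinders_def
        by (intro CollectI exI[of _ "{u}"] exI[of _ "\<lambda>_. B"] conjI)
      then show ?thesis by blast
    qed blast
  qed
  then have "sets (F s) \<subseteq> sigma_sets (space M) ?G"
    unfolding sets_F space_completion space_P by (rule sigma_sets_mono')
  then show ?thesis
    using indep_setD[OF ind, of A ?C] A by auto
qed

lemma indep_var_filtration_increment:
  assumes st: "0 \<le> s" "s < t" and X: "X \<in> measurable (F s) N" and \<phi>: "\<phi> \<in> measurable borel L"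
  shows "indep_var N X L (\<lambda>\<omega>. \<phi> (\<omega> t - \<omega> s))"
proof -
  let ?D = "\<lambda>\<omega>. \<phi> (\<omega> t - \<omega> s)"
  have "(\<lambda>\<omega>. \<omega> t - \<omega> s) \<in> borel_measurable M"
    using st by (intro borel_measurable_diff measurable_coord_M) auto
  then have D: "?D \<in> measurable M L"
    by (rule measurable_compose[OF _ \<phi>])
  have X': "X \<in> measurable M N" by (rule measurable_F_M[OF X])
  have "indep_set {X -` A \<inter> space M |A. A \<in> sets N} {?D -` A \<inter> space M |A. A \<in> sets L}"
  proof (rule indep_setI)
    fix a b assume "a \<in> {X -` A \<inter> space M |A. A \<in> sets N}"
      and "b \<in> {?D -` A \<inter> space M |A. A \<in> sets L}"
    then obtain A B where a: "a = X -` A \<inter> space M" "A \<in> sets N"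
      and b: "b = ?D -` B \<inter> space M" "B \<in> sets L" by blast
    have "a \<in> sets (F s)" using measurable_sets[OF X a(2)] unfolding a(1) space_F space_M .
    moreover have "b = {\<omega>\<in>space M. \<omega> t - \<omega> s \<in> \<phi> -` B}" unfolding b(1) by blast
    moreover have "\<phi> -` B \<in> sets borel" using measurable_sets[OF \<phi> b(2)] by simp
    ultimately show "prob (a \<inter> b) = prob a * prob b"
      using filtration_indep_increment[OF st, of a "\<phi> -` B"] by simp
  qed (use measurable_sets[OF X'] measurable_sets[OF D] in blast)+
  moreover have "Int_stable {X -` A \<inter> space M |A. A \<in> sets N}"
    unfolding Int_stable_def
  proof safe
    fix A B assume "A \<in> sets N" "B \<in> sets N"
    then show "\<exists>C. X -` A \<inter> space M \<inter> (X -` B \<inter> space M) = X -` C \<inter> space M \<and> C \<in> sets N"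
      by (intro exI[of _ "A \<inter> B"]) auto
  qed
  moreover have "Int_stable {?D -` A \<inter> space M |A. A \<in> sets L}"
    unfolding Int_stable_def
  proof safe
    fix A B assume "A \<in> sets L" "B \<in> sets L"
    then show "\<exists>C. ?D -` A \<inter> space M \<inter> (?D -` B \<inter> space M) = ?D -` C \<inter> space M \<and> C \<in> sets L"
      by (intro exI[of _ "A \<inter> B"]) auto
  qed
  ultimately show ?thesis
    unfolding indep_var_eq using X' D by (blast intro: indep_set_sigma_sets)
qed

end

section \<open>Moments of Brownian increments\<close>

lemma norm_matrix_vector_mult_le:
  fixes A :: "real^'d^'n"
  shows "norm (A *v x) \<le> norm A * norm x"
proof -
  have "norm (A *v x) = L2_set (\<lambda>i. \<bar>A $ i \<bullet> x\<bar>) UNIV"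
    by (simp add: norm_vec_def matrix_vector_mul_component)
  also have "\<dots> \<le> L2_set (\<lambda>i. norm (A $ i) * norm x) UNIV"
    by (rule L2_set_mono) (simp_all add: Cauchy_Schwarz_ineq2)
  also have "\<dots> = norm A * norm x"
    unfolding norm_vec_def[of A] by (simp add: L2_set_left_distrib)
  finally show ?thesis .
qed

lemma borel_measurable_matrix_nth:
  "(\<lambda>A :: real^'d^'n. A $ i $ j) \<in> borel_measurable borel"
  by (intro borel_measurable_continuous_onI continuous_intros)

lemma borel_measurable_matrix_vector_mult:
  fixes f :: "_ \<Rightarrow> real^'d^'n"
  assumes f: "f \<in> borel_measurable N" and g: "g \<in> borel_measurable N"
  shows "(\<lambda>x. f x *v g x) \<in> borel_measurable N"
proof (rule borel_measurable_vecI)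
  fix i
  have "(\<lambda>x. f x $ i $ j * g x $ j) \<in> borel_measurable N" for j
    by (intro borel_measurable_times measurable_compose[OF g borel_measurable_nth]
        measurable_compose[OF f borel_measurable_matrix_nth])
  then show "(\<lambda>x. (f x *v g x) $ i) \<in> borel_measurable N"
    unfolding matrix_vector_mult_def by (simp add: borel_measurable_sum)
qed

lemma norm_sq_vec: "(norm (x :: real^'n))\<^sup>2 = (\<Sum>i\<in>UNIV. (x $ i)\<^sup>2)"
  unfolding norm_vec_def L2_set_def by (simp add: sum_nonneg)

context wiener
begin

text \<open>The components are independent with known Gaussian laws. Written as the image of a
  product measure, the law involves \<open>s\<close> and \<open>t\<close> only through
  \<open>t - s\<close>, which yields stationarity.\<close>

lemma distr_increment:
  assumes "0 \<le> s" "s < t"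
  shows "distr M borel (\<lambda>\<omega>. \<omega> t - \<omega> s) = distr (Pi\<^sub>M ({0::nat} \<times> UNIV)
     (\<lambda>_. density lborel (\<lambda>x. ennreal (normal_density 0 (sqrt (t - s)) x)))) borel (\<lambda>z. \<chi> j. z (0, j))"
proof -
  let ?I = "{0::nat} \<times> (UNIV :: 'd set)"
  define \<tau> where "\<tau> k = (if k = 0 then s else t)" for k :: nat
  define X where "X = (\<lambda>(k, j) (\<omega> :: real \<Rightarrow> real^'d). \<omega> (\<tau> (Suc k)) $ j - \<omega> (\<tau> k) $ j)"
  have I: "{..<1::nat} \<times> (UNIV::'d set) = ?I" by auto
  have \<tau>0: "0 \<le> \<tau> k" for k using assms by (simp add: \<tau>_def)
  have "indep_vars (\<lambda>_. borel) X ({..<1} \<times> UNIV)"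
    unfolding X_def by (rule indep_increments) (use assms in \<open>simp_all add: \<tau>_def\<close>)
  then have ind: "indep_vars (\<lambda>_. borel) X ?I" unfolding I .
  have X_P: "X i \<in> borel_measurable P" for i
    unfolding X_def split_beta
    by (intro borel_measurable_diff measurable_compose[OF measurable_coord_P[OF \<tau>0] borel_measurable_nth])
  then have X_M: "X i \<in> borel_measurable M" for i by (rule measurable_completion)
  have law: "distr M borel (X (0, j)) = density lborel (\<lambda>x. ennreal (normal_density 0 (sqrt (t - s)) x))" for j
  proof -
    have D: "distributed P lborel (X (0, j)) (normal_density 0 (sqrt (t - s)))"
      using wiener assms unfolding wiener_measure_def X_def \<tau>_def by simp
    have "distr M borel (X (0, j)) = distr P lborel (X (0, j))"
      using X_P by (subst distr_completion) (auto intro: distr_cong)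
    then show ?thesis using distributed_distr_eq_density[OF D] by simp
  qed
  let ?inc = "\<lambda>z :: nat \<times> 'd \<Rightarrow> real. \<chi> j. z (0, j)"
  have inc: "?inc \<in> borel_measurable (Pi\<^sub>M ?I (\<lambda>_. borel))"
    by (rule borel_measurable_vecI) (simp add: measurable_component_singleton)
  have rv: "(\<lambda>\<omega>. \<lambda>i\<in>?I. X i \<omega>) \<in> measurable M (Pi\<^sub>M ?I (\<lambda>_. borel))"
    by (rule measurable_restrict) (rule X_M)
  have "distr M borel (\<lambda>\<omega>. \<omega> t - \<omega> s) = distr M borel (?inc \<circ> (\<lambda>\<omega>. \<lambda>i\<in>?I. X i \<omega>))"
    by (rule distr_cong) (simp_all add: X_def \<tau>_def vec_eq_iff)
  also have "\<dots> = distr (distr M (Pi\<^sub>M ?I (\<lambda>_. borel)) (\<lambda>\<omega>. \<lambda>i\<in>?I. X i \<omega>)) borel ?inc"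
    by (rule distr_distr[symmetric, OF inc rv])
  also have "distr M (Pi\<^sub>M ?I (\<lambda>_. borel)) (\<lambda>\<omega>. \<lambda>i\<in>?I. X i \<omega>) = (\<Pi>\<^sub>M i\<in>?I. distr M borel (X i))"
    using indep_vars_iff_distr_eq_PiM[of ?I X "\<lambda>_. borel", OF _ X_M] ind by simp
  also have "\<dots> = Pi\<^sub>M ?I (\<lambda>_. density lborel (\<lambda>x. ennreal (normal_density 0 (sqrt (t - s)) x)))"
    by (rule PiM_cong) (auto simp: law)
  finally show ?thesis .
qed

lemma distr_increment_stationary:
  assumes "0 \<le> s" "s < t"
  shows "distr M borel (\<lambda>\<omega>. \<omega> t - \<omega> s) = distr M borel (\<lambda>\<omega>. \<omega> (t - s))"
proof -
  have "distr M borel (\<lambda>\<omega>. \<omega> (t - s)) = distr M borel (\<lambda>\<omega>. \<omega> (t - s) - \<omega> 0)"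
    by (rule distr_cong) (simp_all add: space_P path_0)
  also have "\<dots> = distr M borel (\<lambda>\<omega>. \<omega> t - \<omega> s)"
    using distr_increment[of 0 "t - s"] distr_increment[of s t] assms by simp
  finally show ?thesis by simp
qed

text \<open>Second moments drive the recursions for the scheme and Lenglart's inequality; the fourth
  moment controls the Taylor remainder in the generator.\<close>

lemma increment_moments:
  assumes st: "0 \<le> s" "s < t"
  shows "integrable M (\<lambda>\<omega>. (\<omega> t $ j - \<omega> s $ j) ^ k)"
    and "expectation (\<lambda>\<omega>. \<omega> t $ j - \<omega> s $ j) = 0"
    and "expectation (\<lambda>\<omega>. (\<omega> t $ j - \<omega> s $ j)\<^sup>2) = t - s"
    and "expectation (\<lambda>\<omega>. (\<omega> t $ j - \<omega> s $ j) ^ 4) = 3 * (t - s)\<^sup>2"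
proof -
  let ?d = "normal_density 0 (sqrt (t - s))"
  have D: "distributed P lborel (\<lambda>\<omega>. \<omega> t $ j - \<omega> s $ j) ?d"
    using wiener assms unfolding wiener_measure_def by simp
  have pos: "0 < sqrt (t - s)" using st by simp
  have meas: "(\<lambda>\<omega>. (\<omega> t $ j - \<omega> s $ j) ^ k) \<in> borel_measurable P" for k
    using st by (intro borel_measurable_power borel_measurable_diff
        measurable_compose[OF measurable_coord_P borel_measurable_nth]) auto
  have "integrable lborel (\<lambda>x. ?d x * x ^ k)"
    using integrable_normal_moment[OF pos, of 0 k] by simp
  then show "integrable M (\<lambda>\<omega>. (\<omega> t $ j - \<omega> s $ j) ^ k)"
    using distributed_integrable[OF D, of "\<lambda>x. x ^ k"] integrable_completion[OF meas]
    by (simp add: normal_density_nonneg)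
  have E: "expectation (\<lambda>\<omega>. (\<omega> t $ j - \<omega> s $ j) ^ k) = (\<integral>x. ?d x * x ^ k \<partial>lborel)" for k
    using distributed_integral[OF D, of "\<lambda>x. x ^ k"] integral_completion[OF meas]
    by (simp add: normal_density_nonneg)
  show "expectation (\<lambda>\<omega>. \<omega> t $ j - \<omega> s $ j) = 0"
    using E[of 1] integral_normal_moment_odd[OF pos, of 0 0] by simp
  show "expectation (\<lambda>\<omega>. (\<omega> t $ j - \<omega> s $ j)\<^sup>2) = t - s"
    using E[of 2] integral_normal_moment_even[OF pos, of 0 1] st by simp
  show "expectation (\<lambda>\<omega>. (\<omega> t $ j - \<omega> s $ j) ^ 4) = 3 * (t - s)\<^sup>2"
    using E[of 4] integral_normal_moment_even[OF pos, of 0 2] st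
    by (simp add: fact_numeral power2_eq_square)
qed

lemma increment_cross_moment:
  assumes st: "0 \<le> s" "s < t" and ij: "i \<noteq> j"
  shows "integrable M (\<lambda>\<omega>. (\<omega> t $ i - \<omega> s $ i) * (\<omega> t $ j - \<omega> s $ j))"
    and "expectation (\<lambda>\<omega>. (\<omega> t $ i - \<omega> s $ i) * (\<omega> t $ j - \<omega> s $ j)) = 0"
proof -
  define \<tau> where "\<tau> k = (if k = 0 then s else t)" for k :: nat
  define X where "X = (\<lambda>(k, j) (\<omega> :: real \<Rightarrow> real^'d). \<omega> (\<tau> (Suc k)) $ j - \<omega> (\<tau> k) $ j)"
  let ?I = "{(0::nat, i), (0, j)}"
  have "indep_vars (\<lambda>_. borel) X ({..<1} \<times> UNIV)"
    unfolding X_def by (rule indep_increments) (use assms in \<open>simp_all add: \<tau>_def\<close>)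
  then have ind: "indep_vars (\<lambda>_. borel) X ?I" by (rule indep_vars_subset) auto
  have X: "X (0, i) = (\<lambda>\<omega>. \<omega> t $ i - \<omega> s $ i)" for i
    by (simp add: X_def \<tau>_def)
  have int: "integrable M (X l)" if "l \<in> ?I" for l
    using that increment_moments(1)[OF st, of _ 1] by (auto simp: X)
  have fin: "finite ?I" by simp
  show "integrable M (\<lambda>\<omega>. (\<omega> t $ i - \<omega> s $ i) * (\<omega> t $ j - \<omega> s $ j))"
    using indep_vars_integrable[OF fin ind int] ij by (simp add: X)
  show "expectation (\<lambda>\<omega>. (\<omega> t $ i - \<omega> s $ i) * (\<omega> t $ j - \<omega> s $ j)) = 0"
    using indep_vars_lebesgue_integral[OF fin ind int] ij increment_moments(2)[OF st]
    by (simp add: X)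
qed

lemma filtration_times_increment:
  fixes s t :: real and Z :: "_ \<Rightarrow> real" and \<phi> :: "real^'d \<Rightarrow> real"
  assumes st: "0 \<le> s" "s < t" and Z: "Z \<in> borel_measurable (F s)" "integrable M Z"
    and \<phi>: "\<phi> \<in> borel_measurable borel" "integrable M (\<lambda>\<omega>. \<phi> (\<omega> t - \<omega> s))"
  shows "integrable M (\<lambda>\<omega>. Z \<omega> * \<phi> (\<omega> t - \<omega> s))"
    and "expectation (\<lambda>\<omega>. Z \<omega> * \<phi> (\<omega> t - \<omega> s)) = expectation Z * expectation (\<lambda>\<omega>. \<phi> (\<omega> t - \<omega> s))"
proof -
  have ind: "indep_var borel Z borel (\<lambda>\<omega>. \<phi> (\<omega> t - \<omega> s))"
    by (rule indep_var_filtration_increment[OF st Z(1) \<phi>(1)])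
  show "integrable M (\<lambda>\<omega>. Z \<omega> * \<phi> (\<omega> t - \<omega> s))"
    by (rule indep_var_integrable[OF ind Z(2) \<phi>(2)])
  show "expectation (\<lambda>\<omega>. Z \<omega> * \<phi> (\<omega> t - \<omega> s)) = expectation Z * expectation (\<lambda>\<omega>. \<phi> (\<omega> t - \<omega> s))"
    by (rule indep_var_lebesgue_integral[OF ind Z(2) \<phi>(2)])
qed

lemma filtration_increment_mean:
  fixes s t :: real
  assumes st: "0 \<le> s" "s < t" and Z: "Z \<in> borel_measurable (F s)" "integrable M Z"
  shows "integrable M (\<lambda>\<omega>. Z \<omega> * (\<omega> t $ j - \<omega> s $ j))"
    and "expectation (\<lambda>\<omega>. Z \<omega> * (\<omega> t $ j - \<omega> s $ j)) = 0"
  using filtration_times_increment[OF st Z, of "\<lambda>w. w $ j"] increment_moments(1)[OF st, of j 1]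
    increment_moments(2)[OF st, of j] by simp_all

lemma increment_norm_sq:
  fixes s t :: real
  assumes st: "0 \<le> s" "s < t"
  shows "integrable M (\<lambda>\<omega>. (norm (\<omega> t - \<omega> s))\<^sup>2)"
    and "expectation (\<lambda>\<omega>. (norm (\<omega> t - \<omega> s))\<^sup>2) = CARD('d) * (t - s)"
proof -
  have int: "integrable M (\<lambda>\<omega>. ((\<omega> t - \<omega> s) $ j)\<^sup>2)" for j
    using increment_moments(1)[OF st] by simp
  show "integrable M (\<lambda>\<omega>. (norm (\<omega> t - \<omega> s))\<^sup>2)"
    unfolding norm_sq_vec by (rule Bochner_Integration.integrable_sum) (rule int)
  show "expectation (\<lambda>\<omega>. (norm (\<omega> t - \<omega> s))\<^sup>2) = CARD('d) * (t - s)"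
    unfolding norm_sq_vec using int increment_moments(3)[OF st]
    by (subst Bochner_Integration.integral_sum) simp_all
qed

text \<open>\<open>U\<close> and \<open>b\<close> are known at time \<open>s\<close> while the
  increment is centred and independent of \<open>F s\<close>: the cross term has mean zero, and the
  squared noise factorizes after \<open>b\<close> and the increment have been separated by the norm
  inequality.\<close>

lemma step_second_moment:
  fixes s t :: real and U :: "_ \<Rightarrow> real^'n" and b :: "_ \<Rightarrow> real^'d^'n"
  assumes st: "0 \<le> s" "s < t"
    and U: "U \<in> borel_measurable (F s)" "integrable M (\<lambda>\<omega>. (norm (U \<omega>))\<^sup>2)"
    and b: "b \<in> borel_measurable (F s)" "integrable M (\<lambda>\<omega>. (norm (b \<omega>))\<^sup>2)"
  shows "integrable M (\<lambda>\<omega>. (norm (U \<omega> + b \<omega> *v (\<omega> t - \<omega> s)))\<^sup>2)"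
    and "expectation (\<lambda>\<omega>. (norm (U \<omega> + b \<omega> *v (\<omega> t - \<omega> s)))\<^sup>2)
      \<le> expectation (\<lambda>\<omega>. (norm (U \<omega>))\<^sup>2) + CARD('d) * (t - s) * expectation (\<lambda>\<omega>. (norm (b \<omega>))\<^sup>2)"
proof -
  let ?w = "\<lambda>\<omega> :: real \<Rightarrow> real^'d. \<omega> t - \<omega> s"
  have U_M: "U \<in> borel_measurable M" and b_M: "b \<in> borel_measurable M"
    using U(1) b(1) by (auto intro: measurable_F_M)
  have bij: "(\<lambda>\<omega>. b \<omega> $ i $ j) \<in> borel_measurable (F s)" for i j
    by (rule measurable_compose[OF b(1) borel_measurable_matrix_nth])
  have Ui: "(\<lambda>\<omega>. U \<omega> $ i) \<in> borel_measurable (F s)" for i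
    by (rule measurable_compose[OF U(1) borel_measurable_nth])
  have w_M: "?w \<in> borel_measurable M"
    using st by (intro borel_measurable_diff measurable_coord_M) auto
  have bw_M: "(\<lambda>\<omega>. b \<omega> *v ?w \<omega>) \<in> borel_measurable M"
    by (rule borel_measurable_matrix_vector_mult[OF b_M w_M])
  have nb: "(\<lambda>\<omega>. (norm (b \<omega>))\<^sup>2) \<in> borel_measurable (F s)"
    by (intro borel_measurable_power measurable_compose[OF b(1) borel_measurable_norm])
  note bw = filtration_times_increment[OF st nb b(2), of "\<lambda>w. (norm w)\<^sup>2"]
  have bw_int: "integrable M (\<lambda>\<omega>. (norm (b \<omega>))\<^sup>2 * (norm (?w \<omega>))\<^sup>2)"
    using bw(1) increment_norm_sq(1)[OF st] by simp
  have bw_le: "(norm (b \<omega> *v ?w \<omega>))\<^sup>2 \<le> (norm (b \<omega>))\<^sup>2 * (norm (?w \<omega>))\<^sup>2" for \<omega>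
    using power_mono[OF norm_matrix_vector_mult_le[of "b \<omega>" "?w \<omega>"], of 2]
    by (simp add: power_mult_distrib)
  have int1: "integrable M (\<lambda>\<omega>. (norm (b \<omega> *v ?w \<omega>))\<^sup>2)"
    by (rule Bochner_Integration.integrable_bound[OF bw_int])
      (use bw_M bw_le in \<open>auto intro!: AE_I2 borel_measurable_power borel_measurable_norm\<close>)
  have Ub: "integrable M (\<lambda>\<omega>. U \<omega> $ i * b \<omega> $ i $ j)" for i j
  proof (rule Bochner_Integration.integrable_bound[OF Bochner_Integration.integrable_add[OF U(2) b(2)]])
    show "(\<lambda>\<omega>. U \<omega> $ i * b \<omega> $ i $ j) \<in> borel_measurable M"
      by (intro borel_measurable_times measurable_F_M[OF Ui] measurable_F_M[OF bij])
    show "AE \<omega> in M. norm (U \<omega> $ i * b \<omega> $ i $ j) \<le> norm ((norm (U \<omega>))\<^sup>2 + (norm (b \<omega>))\<^sup>2)"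
    proof (rule AE_I2)
      fix \<omega>
      have "\<bar>b \<omega> $ i $ j\<bar> \<le> norm (b \<omega>)"
        using component_le_norm_cart[of "b \<omega> $ i" j] Finite_Cartesian_Product.norm_nth_le[of "b \<omega>" i] by simp
      then have "\<bar>U \<omega> $ i\<bar> * \<bar>b \<omega> $ i $ j\<bar> \<le> norm (U \<omega>) * norm (b \<omega>)"
        by (intro mult_mono component_le_norm_cart) auto
      also have "\<dots> \<le> (norm (U \<omega>))\<^sup>2 + (norm (b \<omega>))\<^sup>2"
        using sum_squares_bound[of "norm (U \<omega>)" "norm (b \<omega>)"]
          mult_nonneg_nonneg[OF norm_ge_zero norm_ge_zero, of "U \<omega>" "b \<omega>"] by linarith
      finally show "norm (U \<omega> $ i * b \<omega> $ i $ j) \<le> norm ((norm (U \<omega>))\<^sup>2 + (norm (b \<omega>))\<^sup>2)"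
        by (simp add: abs_mult)
    qed
  qed
  have dot: "U \<omega> \<bullet> (b \<omega> *v ?w \<omega>) = (\<Sum>i\<in>UNIV. \<Sum>j\<in>UNIV. U \<omega> $ i * b \<omega> $ i $ j * (\<omega> t $ j - \<omega> s $ j))" for \<omega>
    by (simp add: inner_vec_def matrix_vector_mult_def sum_distrib_left mult.assoc)
  have Ubm: "(\<lambda>\<omega>. U \<omega> $ i * b \<omega> $ i $ j) \<in> borel_measurable (F s)" for i j
    by (intro borel_measurable_times Ui bij)
  have cross_int: "integrable M (\<lambda>\<omega>. U \<omega> \<bullet> (b \<omega> *v ?w \<omega>))"
    unfolding dot by (intro Bochner_Integration.integrable_sum filtration_increment_mean(1)[OF st Ubm Ub])
  have cross: "expectation (\<lambda>\<omega>. U \<omega> \<bullet> (b \<omega> *v ?w \<omega>)) = 0"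
    unfolding dot
    by (simp add: filtration_increment_mean[OF st Ubm Ub])
  have sq: "(norm (U \<omega> + b \<omega> *v ?w \<omega>))\<^sup>2 = (norm (U \<omega>))\<^sup>2 + 2 * (U \<omega> \<bullet> (b \<omega> *v ?w \<omega>)) + (norm (b \<omega> *v ?w \<omega>))\<^sup>2" for \<omega>
    by (simp add: power2_norm_eq_inner inner_add_left inner_add_right inner_commute)
  show "integrable M (\<lambda>\<omega>. (norm (U \<omega> + b \<omega> *v ?w \<omega>))\<^sup>2)"
    unfolding sq using U(2) cross_int int1 by simp
  have "expectation (\<lambda>\<omega>. (norm (U \<omega> + b \<omega> *v ?w \<omega>))\<^sup>2)
      = expectation (\<lambda>\<omega>. (norm (U \<omega>))\<^sup>2) + expectation (\<lambda>\<omega>. (norm (b \<omega> *v ?w \<omega>))\<^sup>2)"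
    unfolding sq using U(2) cross_int int1 cross by simp
  also have "expectation (\<lambda>\<omega>. (norm (b \<omega> *v ?w \<omega>))\<^sup>2)
      \<le> expectation (\<lambda>\<omega>. (norm (b \<omega>))\<^sup>2 * (norm (?w \<omega>))\<^sup>2)"
    by (rule integral_mono[OF int1 bw_int bw_le])
  also have "\<dots> = CARD('d) * (t - s) * expectation (\<lambda>\<omega>. (norm (b \<omega>))\<^sup>2)"
    using bw(2) increment_norm_sq[OF st] by simp
  finally show "expectation (\<lambda>\<omega>. (norm (U \<omega> + b \<omega> *v ?w \<omega>))\<^sup>2)
      \<le> expectation (\<lambda>\<omega>. (norm (U \<omega>))\<^sup>2) + CARD('d) * (t - s) * expectation (\<lambda>\<omega>. (norm (b \<omega>))\<^sup>2)"
    by simp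
qed

end

section \<open>Lenglart's inequality\<close>

context wiener
begin

text \<open>In the scalar case the squared noise factorizes exactly, which gives the orthogonality
  of martingale increments as an equality.\<close>

lemma step_second_moment_real:
  fixes s t :: real and U \<xi> :: "_ \<Rightarrow> real"
  assumes st: "0 \<le> s" "s < t"
    and U: "U \<in> borel_measurable (F s)" "integrable M (\<lambda>\<omega>. (U \<omega>)\<^sup>2)"
    and \<xi>: "\<xi> \<in> borel_measurable (F s)" "integrable M (\<lambda>\<omega>. (\<xi> \<omega>)\<^sup>2)"
  shows "integrable M (\<lambda>\<omega>. (U \<omega> + \<xi> \<omega> * (\<omega> t $ j - \<omega> s $ j))\<^sup>2)"
    and "expectation (\<lambda>\<omega>. (U \<omega> + \<xi> \<omega> * (\<omega> t $ j - \<omega> s $ j))\<^sup>2)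
      = expectation (\<lambda>\<omega>. (U \<omega>)\<^sup>2) + (t - s) * expectation (\<lambda>\<omega>. (\<xi> \<omega>)\<^sup>2)"
proof -
  have m: "(\<lambda>\<omega>. U \<omega> * \<xi> \<omega>) \<in> borel_measurable (F s)" "(\<lambda>\<omega>. (\<xi> \<omega>)\<^sup>2) \<in> borel_measurable (F s)"
    using U(1) \<xi>(1) by auto
  have UX: "integrable M (\<lambda>\<omega>. U \<omega> * \<xi> \<omega>)"
  proof (rule Bochner_Integration.integrable_bound[OF Bochner_Integration.integrable_add[OF U(2) \<xi>(2)]])
    show "(\<lambda>\<omega>. U \<omega> * \<xi> \<omega>) \<in> borel_measurable M" by (rule measurable_F_M[OF m(1)])
    show "AE \<omega> in M. norm (U \<omega> * \<xi> \<omega>) \<le> norm ((U \<omega>)\<^sup>2 + (\<xi> \<omega>)\<^sup>2)"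
    proof (rule AE_I2)
      fix \<omega>
      have "2 * (\<bar>U \<omega>\<bar> * \<bar>\<xi> \<omega>\<bar>) \<le> (U \<omega>)\<^sup>2 + (\<xi> \<omega>)\<^sup>2"
        using sum_squares_bound[of "\<bar>U \<omega>\<bar>" "\<bar>\<xi> \<omega>\<bar>"] by simp
      moreover have "0 \<le> \<bar>U \<omega>\<bar> * \<bar>\<xi> \<omega>\<bar>" by simp
      ultimately have "\<bar>U \<omega>\<bar> * \<bar>\<xi> \<omega>\<bar> \<le> (U \<omega>)\<^sup>2 + (\<xi> \<omega>)\<^sup>2" by linarith
      then show "norm (U \<omega> * \<xi> \<omega>) \<le> norm ((U \<omega>)\<^sup>2 + (\<xi> \<omega>)\<^sup>2)"
        by (simp add: abs_mult)
    qed
  qed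
  note i1 = filtration_increment_mean[OF st m(1) UX, of j]
  note i2 = filtration_times_increment[OF st m(2) \<xi>(2), of "\<lambda>w. (w $ j)\<^sup>2"]
  have i2': "integrable M (\<lambda>\<omega>. (\<xi> \<omega>)\<^sup>2 * (\<omega> t $ j - \<omega> s $ j)\<^sup>2)"
    "expectation (\<lambda>\<omega>. (\<xi> \<omega>)\<^sup>2 * (\<omega> t $ j - \<omega> s $ j)\<^sup>2) = (t - s) * expectation (\<lambda>\<omega>. (\<xi> \<omega>)\<^sup>2)"
    using i2 increment_moments[OF st, of j] by simp_all
  have eq: "(U \<omega> + \<xi> \<omega> * (\<omega> t $ j - \<omega> s $ j))\<^sup>2 = (U \<omega>)\<^sup>2 + 2 * (U \<omega> * \<xi> \<omega> * (\<omega> t $ j - \<omega> s $ j))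
      + (\<xi> \<omega>)\<^sup>2 * (\<omega> t $ j - \<omega> s $ j)\<^sup>2" for \<omega>
    by (simp add: power2_eq_square algebra_simps)
  show "integrable M (\<lambda>\<omega>. (U \<omega> + \<xi> \<omega> * (\<omega> t $ j - \<omega> s $ j))\<^sup>2)"
    unfolding eq using U(2) i1(1) i2'(1) by simp
  show "expectation (\<lambda>\<omega>. (U \<omega> + \<xi> \<omega> * (\<omega> t $ j - \<omega> s $ j))\<^sup>2)
      = expectation (\<lambda>\<omega>. (U \<omega>)\<^sup>2) + (t - s) * expectation (\<lambda>\<omega>. (\<xi> \<omega>)\<^sup>2)"
    unfolding eq using U(2) i1 i2' by simp
qed

lemma prob_gt_le_second_moment:
  assumes "X \<in> borel_measurable M" "integrable M (\<lambda>\<omega>. (X \<omega>)\<^sup>2)" "0 < (\<epsilon>::real)"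
  shows "prob {\<omega>\<in>space M. \<bar>X \<omega>\<bar> > \<epsilon>} \<le> expectation (\<lambda>\<omega>. (X \<omega>)\<^sup>2) / \<epsilon>\<^sup>2"
proof -
  have "prob {\<omega>\<in>space M. \<bar>X \<omega>\<bar> > \<epsilon>} \<le> prob {\<omega>\<in>space M. (X \<omega>)\<^sup>2 \<ge> \<epsilon>\<^sup>2}"
  proof (rule finite_measure_mono)
    show "{\<omega>\<in>space M. \<bar>X \<omega>\<bar> > \<epsilon>} \<subseteq> {\<omega>\<in>space M. (X \<omega>)\<^sup>2 \<ge> \<epsilon>\<^sup>2}"
      using assms(3) by (auto simp: abs_le_square_iff[symmetric])
    show "{\<omega>\<in>space M. (X \<omega>)\<^sup>2 \<ge> \<epsilon>\<^sup>2} \<in> events"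
      using assms(1) by measurable
  qed
  also have "\<dots> \<le> expectation (\<lambda>\<omega>. (X \<omega>)\<^sup>2) / \<epsilon>\<^sup>2"
    using assms by (intro integral_Markov_inequality_measure[where A = "{}"]) auto
  finally show ?thesis .
qed

lemma martingale_measurable:
  assumes s: "0 \<le> s 0" "\<And>i. i < m \<Longrightarrow> s i < s (Suc i)"
    and \<zeta>: "\<And>i. i < m \<Longrightarrow> \<zeta> i \<in> borel_measurable (F (s i))" and i: "i \<le> m"
  shows "(\<lambda>\<omega>. \<Sum>l<i. \<zeta> l \<omega> * (\<omega> (s (Suc l)) $ j - \<omega> (s l) $ j) :: real) \<in> borel_measurable (F (s i))"
proof (rule borel_measurable_sum)
  fix l assume "l \<in> {..<i}"
  then have l: "l < i" "l < m" using i by auto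
  have "s l \<le> s i" "s (Suc l) \<le> s i" "0 \<le> s l" "0 \<le> s (Suc l)"
    using l i s steps_mono[of m s, OF s(2)] by (auto intro: order_trans[OF s(1)])
  then show "(\<lambda>\<omega>. \<zeta> l \<omega> * (\<omega> (s (Suc l)) $ j - \<omega> (s l) $ j)) \<in> borel_measurable (F (s i))"
    by (intro borel_measurable_times borel_measurable_diff measurable_F_mono[OF \<zeta>[OF l(2)]]
        measurable_compose[OF measurable_coord_F borel_measurable_nth])
qed

text \<open>The martingale is stopped before its quadratic variation exceeds \<open>\<delta>\<close> or its modulus exceeds
  \<open>\<epsilon>\<close>; the stopped martingale has second moment at most \<open>\<delta>\<close>.\<close>

lemma lenglart_inequality:
  fixes s :: "nat \<Rightarrow> real" and \<zeta> :: "nat \<Rightarrow> (real \<Rightarrow> real^'d) \<Rightarrow> real" and j :: 'd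
  defines "N \<equiv> \<lambda>i \<omega>. \<Sum>l<i. \<zeta> l \<omega> * (\<omega> (s (Suc l)) $ j - \<omega> (s l) $ j)"
  assumes s: "0 \<le> s 0" "\<And>i. i < m \<Longrightarrow> s i < s (Suc i)"
    and \<zeta>: "\<And>i. i < m \<Longrightarrow> \<zeta> i \<in> borel_measurable (F (s i))"
    and pos: "0 < \<delta>" "0 < \<epsilon>"
  shows "prob {\<omega>\<in>space M. \<exists>i\<le>m. \<bar>N i \<omega>\<bar> > \<epsilon>}
    \<le> \<delta> / \<epsilon>\<^sup>2 + prob {\<omega>\<in>space M. (\<Sum>l<m. (\<zeta> l \<omega>)\<^sup>2 * (s (Suc l) - s l)) > \<delta>}"
proof -
  \<comment> \<open>The predictable quadratic variation of the discrete martingale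
    \<open>N\<close>.\<close>
  define A where "A i \<omega> = (\<Sum>l<i. (\<zeta> l \<omega>)\<^sup>2 * (s (Suc l) - s l))" for i \<omega>
  \<comment> \<open>\<open>A (Suc i)\<close> already includes step i, yet it is known at time
    \<open>s i\<close>, since \<open>\<zeta> i\<close> is. So the switch can look one step ahead and
    still be measurable for \<open>F (s i)\<close>.\<close>
  define c where "c i \<omega> = (if A (Suc i) \<omega> \<le> \<delta> \<and> (\<forall>r\<in>{..i}. \<bar>N r \<omega>\<bar> \<le> \<epsilon>) then 1 else 0 :: real)" for i \<omega>
  define K where "K i \<omega> = (\<Sum>l<i. c l \<omega> * \<zeta> l \<omega> * (\<omega> (s (Suc l)) $ j - \<omega> (s l) $ j))" for i \<omega>
  define Q where "Q i \<omega> = (\<Sum>l<i. (c l \<omega> * \<zeta> l \<omega>)\<^sup>2 * (s (Suc l) - s l))" for i \<omega>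
  have s_mono: "s i \<le> s k" if "i \<le> k" "k \<le> m" for i k
    by (rule steps_mono[of m]) (use s that in auto)
  have s_pos: "0 \<le> s i" if "i \<le> m" for i
    using s_mono[of 0 i] s(1) that by simp
  have \<Delta>: "0 < s (Suc i) - s i" if "i < m" for i using s(2)[OF that] by simp
  have N_meas: "N i \<in> borel_measurable (F (s i))" if "i \<le> m" for i
    unfolding N_def using that by (intro martingale_measurable[OF s \<zeta>]) auto
  have A_meas: "A (Suc i) \<in> borel_measurable (F (s i))" if "i < m" for i
    unfolding A_def
  proof (rule borel_measurable_sum)
    fix l assume "l \<in> {..<Suc i}"
    then have l: "l < m" "l \<le> i" using that by auto
    then have "\<zeta> l \<in> borel_measurable (F (s i))"
      using measurable_F_mono[OF \<zeta>[OF l(1)]] s_mono that by auto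
    then show "(\<lambda>\<omega>. (\<zeta> l \<omega>)\<^sup>2 * (s (Suc l) - s l)) \<in> borel_measurable (F (s i))" by simp
  qed
  have c_meas: "c i \<in> borel_measurable (F (s i))" if "i < m" for i
  proof -
    have [measurable]: "A (Suc i) \<in> borel_measurable (F (s i))" by (rule A_meas[OF that])
    have "{\<omega> \<in> space (F (s i)). \<forall>r\<in>{..i}. \<bar>N r \<omega>\<bar> \<le> \<epsilon>} \<in> sets (F (s i))"
    proof (intro sets.sets_Collect_finite_All)
      fix r assume "r \<in> {..i}"
      then have [measurable]: "N r \<in> borel_measurable (F (s i))"
        using measurable_F_mono[OF N_meas[of r]] s_mono that by auto
      show "{\<omega> \<in> space (F (s i)). \<bar>N r \<omega>\<bar> \<le> \<epsilon>} \<in> sets (F (s i))" by measurable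
    qed simp
    then have [measurable]: "Measurable.pred (F (s i)) (\<lambda>\<omega>. \<forall>r\<in>{..i}. \<bar>N r \<omega>\<bar> \<le> \<epsilon>)"
      by (simp add: pred_def)
    show ?thesis unfolding c_def by measurable
  qed
  \<comment> \<open>Inactive steps add nothing, and at an active step the whole sum is dominated by
    \<open>A (Suc i)\<close>, which the switch keeps below \<delta>.\<close>
  have Q_le: "Q i \<omega> \<le> \<delta>" if "i \<le> m" for i \<omega>
    using that
  proof (induction i)
    case 0
    then show ?case using pos by (simp add: Q_def)
  next
    case (Suc i)
    show ?case
    proof (cases "c i \<omega> = 0")
      case True
      then show ?thesis using Suc by (simp add: Q_def)
    next
      case False
      then have "A (Suc i) \<omega> \<le> \<delta>" by (auto simp: c_def split: if_splits)
      moreover have "Q (Suc i) \<omega> \<le> A (Suc i) \<omega>"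
        unfolding Q_def A_def
      proof (rule sum_mono)
        fix l assume "l \<in> {..<Suc i}"
        then have "0 < s (Suc l) - s l" using Suc \<Delta> by auto
        moreover have "(c l \<omega> * \<zeta> l \<omega>)\<^sup>2 \<le> (\<zeta> l \<omega>)\<^sup>2" by (simp add: c_def)
        ultimately show "(c l \<omega> * \<zeta> l \<omega>)\<^sup>2 * (s (Suc l) - s l) \<le> (\<zeta> l \<omega>)\<^sup>2 * (s (Suc l) - s l)"
          by (intro mult_right_mono) auto
      qed
      ultimately show ?thesis by simp
    qed
  qed
  have c\<zeta>_meas: "(\<lambda>\<omega>. c i \<omega> * \<zeta> i \<omega>) \<in> borel_measurable (F (s i))" if "i < m" for i
    using c_meas[OF that] \<zeta>[OF that] by simp
  have c\<zeta>_int: "integrable M (\<lambda>\<omega>. (c i \<omega> * \<zeta> i \<omega>)\<^sup>2)" if "i < m" for i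
  proof (rule integrable_const_bound[where B = "\<delta> / (s (Suc i) - s i)"])
    show "AE \<omega> in M. norm ((c i \<omega> * \<zeta> i \<omega>)\<^sup>2) \<le> \<delta> / (s (Suc i) - s i)"
    proof (rule AE_I2)
      fix \<omega>
      have "(c i \<omega> * \<zeta> i \<omega>)\<^sup>2 * (s (Suc i) - s i) \<le> Q (Suc i) \<omega>"
      proof -
        have "0 \<le> (\<Sum>l<i. (c l \<omega> * \<zeta> l \<omega>)\<^sup>2 * (s (Suc l) - s l))"
          using \<Delta> that by (intro sum_nonneg mult_nonneg_nonneg) (auto simp: less_imp_le)
        then show ?thesis by (simp add: Q_def)
      qed
      also have "\<dots> \<le> \<delta>" using Q_le[of "Suc i"] that by simp
      finally show "norm ((c i \<omega> * \<zeta> i \<omega>)\<^sup>2) \<le> \<delta> / (s (Suc i) - s i)"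
        using \<Delta>[OF that] by (simp add: field_simps)
    qed
    show "(\<lambda>\<omega>. (c i \<omega> * \<zeta> i \<omega>)\<^sup>2) \<in> borel_measurable M"
      using measurable_F_M[OF c\<zeta>_meas[OF that]] by simp
  qed
  have K_meas: "K i \<in> borel_measurable (F (s i))" if "i \<le> m" for i
    unfolding K_def using that by (intro martingale_measurable[OF s c\<zeta>_meas]) auto
  have K: "integrable M (\<lambda>\<omega>. (K i \<omega>)\<^sup>2) \<and> expectation (\<lambda>\<omega>. (K i \<omega>)\<^sup>2) = expectation (Q i)" if "i \<le> m" for i
    using that
  proof (induction i)
    case 0
    then show ?case by (simp add: K_def Q_def)
  next
    case (Suc i)
    then have i: "i < m" "i \<le> m" by auto
    note step = step_second_moment_real[OF s_pos[OF i(2)] s(2)[OF i(1)] K_meas[OF i(2)]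
        conjunct1[OF Suc.IH[OF i(2)]] c\<zeta>_meas[OF i(1)] c\<zeta>_int[OF i(1)], of j]
    have K_Suc: "K (Suc i) \<omega> = K i \<omega> + c i \<omega> * \<zeta> i \<omega> * (\<omega> (s (Suc i)) $ j - \<omega> (s i) $ j)" for \<omega>
      by (simp add: K_def)
    have "expectation (Q (Suc i)) = expectation (Q i) + (s (Suc i) - s i) * expectation (\<lambda>\<omega>. (c i \<omega> * \<zeta> i \<omega>)\<^sup>2)"
    proof -
      have "integrable M (Q i)"
        unfolding Q_def using c\<zeta>_int i by (intro Bochner_Integration.integrable_sum integrable_mult_left) auto
      then show ?thesis
        using c\<zeta>_int[OF i(1)] unfolding Q_def by (simp add: mult.commute)
    qed
    then show ?case using step Suc.IH[OF i(2)] unfolding K_Suc by simp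
  qed
  have Km: "K m \<in> borel_measurable M" by (rule measurable_F_M[OF K_meas]) simp
  have "expectation (Q m) \<le> \<delta>"
  proof -
    have "integrable M (Q m)"
      unfolding Q_def using c\<zeta>_int by (intro Bochner_Integration.integrable_sum integrable_mult_left) auto
    then have "expectation (Q m) \<le> expectation (\<lambda>_. \<delta>)"
      by (rule integral_mono) (use Q_le in auto)
    then show ?thesis using prob_space.prob_space[OF prob_space_P] by simp
  qed
  then have "expectation (\<lambda>\<omega>. (K m \<omega>)\<^sup>2) \<le> \<delta>" using K[of m] by simp
  then have "expectation (\<lambda>\<omega>. (K m \<omega>)\<^sup>2) / \<epsilon>\<^sup>2 \<le> \<delta> / \<epsilon>\<^sup>2"
    by (rule divide_right_mono) simp
  then have PK: "prob {\<omega>\<in>space M. \<bar>K m \<omega>\<bar> > \<epsilon>} \<le> \<delta> / \<epsilon>\<^sup>2"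
    using prob_gt_le_second_moment[OF Km _ pos(2)] K[of m] by simp
  have sub: "{\<omega>\<in>space M. \<exists>i\<le>m. \<bar>N i \<omega>\<bar> > \<epsilon>} \<subseteq> {\<omega>\<in>space M. \<bar>K m \<omega>\<bar> > \<epsilon>} \<union> {\<omega>\<in>space M. A m \<omega> > \<delta>}"
  proof (rule subsetI)
    fix \<omega> assume \<omega>: "\<omega> \<in> {\<omega>\<in>space M. \<exists>i\<le>m. \<bar>N i \<omega>\<bar> > \<epsilon>}"
    show "\<omega> \<in> {\<omega>\<in>space M. \<bar>K m \<omega>\<bar> > \<epsilon>} \<union> {\<omega>\<in>space M. A m \<omega> > \<delta>}"
    proof (cases "A m \<omega> > \<delta>")
      case True
      then show ?thesis using \<omega> by simp
    next
      case False
      \<comment> \<open>If the quadratic variation stays below \<delta>, the switch is on exactly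
        before the first index at which \<open>N\<close> exceeds \<epsilon>. The stopped martingale
        is then frozen at that value, so its final value reveals the excursion.\<close>
      define i where "i = (LEAST i. \<bar>N i \<omega>\<bar> > \<epsilon>)"
      obtain i' where i': "i' \<le> m" "\<bar>N i' \<omega>\<bar> > \<epsilon>" using \<omega> by blast
      have i: "\<bar>N i \<omega>\<bar> > \<epsilon>" unfolding i_def using i'(2) by (rule LeastI)
      have "i \<le> i'" unfolding i_def using i'(2) by (rule Least_le)
      then have im: "i \<le> m" using i'(1) by simp
      have less: "\<bar>N r \<omega>\<bar> \<le> \<epsilon>" if "r < i" for r
        using not_less_Least[of r "\<lambda>i. \<bar>N i \<omega>\<bar> > \<epsilon>"] that unfolding i_def by simp
      have A_le: "A (Suc l) \<omega> \<le> A m \<omega>" if "l < m" for l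
        unfolding A_def using that \<Delta> by (intro sum_mono2) (auto simp: less_imp_le)
      have "c l \<omega> = (if l < i then 1 else 0)" if "l < m" for l
      proof (cases "l < i")
        case True
        then show ?thesis using A_le[OF that] False less by (auto simp: c_def)
      next
        case F: False
        then have "i \<in> {..l}" by simp
        then show ?thesis using i F unfolding c_def by (meson not_le)
      qed
      then have "K m \<omega> = (\<Sum>l<m. if l < i then \<zeta> l \<omega> * (\<omega> (s (Suc l)) $ j - \<omega> (s l) $ j) else 0)"
        unfolding K_def by (intro sum.cong) auto
      also have "\<dots> = N i \<omega>"
        unfolding N_def using im by (intro sum.mono_neutral_cong_right) auto
      finally show ?thesis using i \<omega> by simp
    qed
  qed
  have A_M: "A m \<in> borel_measurable M"
  proof -
    have "\<zeta> l \<in> borel_measurable M" if "l < m" for l by (rule measurable_F_M[OF \<zeta>[OF that]])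
    then show ?thesis unfolding A_def by (intro borel_measurable_sum) auto
  qed
  have "prob {\<omega>\<in>space M. \<exists>i\<le>m. \<bar>N i \<omega>\<bar> > \<epsilon>}
      \<le> prob ({\<omega>\<in>space M. \<bar>K m \<omega>\<bar> > \<epsilon>} \<union> {\<omega>\<in>space M. A m \<omega> > \<delta>})"
    by (rule finite_measure_mono[OF sub]) (use Km A_M in measurable)
  also have "\<dots> \<le> prob {\<omega>\<in>space M. \<bar>K m \<omega>\<bar> > \<epsilon>} + prob {\<omega>\<in>space M. A m \<omega> > \<delta>}"
    by (rule measure_Un_le) (use Km A_M in measurable)
  also have "\<dots> \<le> \<delta> / \<epsilon>\<^sup>2 + prob {\<omega>\<in>space M. A m \<omega> > \<delta>}" using PK by simp
  finally show ?thesis unfolding A_def .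
qed

end

section \<open>Riemann sums of Ito integrals\<close>

lemma elementary_process_eq:
  assumes \<tau>: "\<And>k. k < m \<Longrightarrow> \<tau> k < \<tau> (Suc k)" and k: "k < m" "\<tau> k < u" "u \<le> \<tau> (Suc k)"
  shows "elementary_process m \<tau> \<xi> u \<omega> = \<xi> k \<omega>"
proof -
  have "u \<notin> {\<tau> i<..\<tau> (Suc i)}" if "i < m" "i \<noteq> k" for i
  proof (cases "i < k")
    case True
    then have "\<tau> (Suc i) \<le> \<tau> k" using steps_mono[of m \<tau> "Suc i" k] \<tau> k by auto
    then show ?thesis using k by auto
  next
    case False
    then have "\<tau> (Suc k) \<le> \<tau> i" using steps_mono[of m \<tau> "Suc k" i] \<tau> that by auto
    then show ?thesis using k by auto
  qed
  then have "elementary_process m \<tau> \<xi> u \<omega> = (\<Sum>i<m. if i = k then \<xi> k \<omega> else 0)"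
    unfolding elementary_process_def using k by (intro sum.cong) (auto simp: indicator_def)
  then show ?thesis using k(1) by simp
qed

lemma steps_find:
  fixes \<tau> :: "nat \<Rightarrow> real"
  assumes "\<tau> 0 < u" "u \<le> \<tau> m"
  obtains k where "k < m" "\<tau> k < u" "u \<le> \<tau> (Suc k)"
proof -
  have "\<exists>k<m. \<tau> k < u \<and> u \<le> \<tau> (Suc k)"
    using assms(2)
  proof (induction m)
    case 0
    then show ?case using assms(1) by simp
  next
    case (Suc m)
    then show ?case
      by (cases "u \<le> \<tau> m") (auto simp: less_Suc_eq)
  qed
  then show ?thesis using that by blast
qed

text \<open>By \<open>compat\<close> neither \<open>a\<close> nor \<open>b\<close> is interior to a
  cell, so each cell lies wholly inside or wholly outside the interval \<open>{a<..b}\<close>; its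
  right end point decides which.\<close>

lemma telescope_refinement:
  fixes w :: "real \<Rightarrow> real"
  assumes s: "\<And>i. i < n \<Longrightarrow> s i < s (Suc i)" and ab: "s 0 \<le> a" "a \<le> b"
    and compat: "\<And>i. i < n \<Longrightarrow> \<not> (s i < a \<and> a < s (Suc i))" "\<And>i. i < n \<Longrightarrow> \<not> (s i < b \<and> b < s (Suc i))"
    and i: "i \<le> n"
  shows "(\<Sum>l<i. indicator {a<..b} (s (Suc l)) * (w (s (Suc l)) - w (s l))) = w (min (s i) b) - w (min (s i) a)"
  using i
proof (induction i)
  case 0
  then show ?case using ab by simp
next
  case (Suc i)
  have 1: "s i < s (Suc i)" "\<not> (s i < a \<and> a < s (Suc i))" "\<not> (s i < b \<and> b < s (Suc i))"
    using Suc s compat by auto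
  have IH: "(\<Sum>l<i. indicator {a<..b} (s (Suc l)) * (w (s (Suc l)) - w (s l))) = w (min (s i) b) - w (min (s i) a)"
    using Suc by simp
  consider "s (Suc i) \<le> a" | "a < s (Suc i)" "s (Suc i) \<le> b" | "b < s (Suc i)" by linarith
  then show ?case
  proof cases
    case 1
    then show ?thesis using IH \<open>s i < s (Suc i)\<close> ab by (simp add: min_absorb1 indicator_def)
  next
    case 2
    then have "a \<le> s i" using 1 by auto
    then show ?thesis using IH 2 \<open>s i < s (Suc i)\<close> by (simp add: min_absorb1 min_absorb2 indicator_def)
  next
    case 3
    then have "b \<le> s i" using 1 by auto
    then show ?thesis using IH 3 \<open>s i < s (Suc i)\<close> ab by (simp add: min_absorb2 indicator_def)
  qed
qed

text \<open>On a common refinement the integrals of two elementary processes become sums over the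
  same Brownian increments and can be subtracted term by term, which produces a discrete
  martingale.\<close>

lemma elementary_integral_refinement:
  assumes \<tau>: "\<And>k. k < m \<Longrightarrow> \<tau> k < \<tau> (Suc k)" and s: "\<And>i. i < n \<Longrightarrow> s i < s (Suc i)"
    and s0: "s 0 \<le> \<tau> 0"
    and compat: "\<And>i k. i < n \<Longrightarrow> k \<le> m \<Longrightarrow> \<not> (s i < \<tau> k \<and> \<tau> k < s (Suc i))"
    and i: "i \<le> n"
  shows "elementary_integral j m \<tau> \<xi> (s i) \<omega>
    = (\<Sum>l<i. elementary_process m \<tau> \<xi> (s (Suc l)) \<omega> * (\<omega> (s (Suc l)) $ j - \<omega> (s l) $ j))"
proof -
  have *: "\<omega> (min (s i) (\<tau> (Suc k))) $ j - \<omega> (min (s i) (\<tau> k)) $ j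
      = (\<Sum>l<i. indicator {\<tau> k<..\<tau> (Suc k)} (s (Suc l)) * (\<omega> (s (Suc l)) $ j - \<omega> (s l) $ j))" if "k < m" for k
  proof (rule telescope_refinement[where w = "\<lambda>t. \<omega> t $ j" and n = n and s = s, symmetric])
    show "s 0 \<le> \<tau> k" using s0 steps_mono[of m \<tau> 0 k] \<tau> that by auto
    show "\<tau> k \<le> \<tau> (Suc k)" using \<tau>[OF that] by simp
    show "\<not> (s i < \<tau> k \<and> \<tau> k < s (Suc i))" "\<not> (s i < \<tau> (Suc k) \<and> \<tau> (Suc k) < s (Suc i))"
      if "i < n" for i using compat that \<open>k < m\<close> by auto
  qed (use i s in auto)
  have "elementary_integral j m \<tau> \<xi> (s i) \<omega>
      = (\<Sum>k<m. \<xi> k \<omega> * (\<Sum>l<i. indicator {\<tau> k<..\<tau> (Suc k)} (s (Suc l)) * (\<omega> (s (Suc l)) $ j - \<omega> (s l) $ j)))"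
    unfolding elementary_integral_def by (intro sum.cong) (simp_all add: *)
  also have "\<dots> = (\<Sum>l<i. \<Sum>k<m. \<xi> k \<omega> * indicator {\<tau> k<..\<tau> (Suc k)} (s (Suc l)) * (\<omega> (s (Suc l)) $ j - \<omega> (s l) $ j))"
    unfolding sum_distrib_left by (subst sum.swap) (simp add: mult.assoc)
  also have "\<dots> = (\<Sum>l<i. elementary_process m \<tau> \<xi> (s (Suc l)) \<omega> * (\<omega> (s (Suc l)) $ j - \<omega> (s l) $ j))"
    unfolding elementary_process_def sum_distrib_right ..
  finally show ?thesis .
qed

lemma elementary_integral_at_node:
  assumes \<tau>: "\<And>k. k < m \<Longrightarrow> \<tau> k < \<tau> (Suc k)" and p: "p \<le> m"
  shows "elementary_integral j m \<tau> \<xi> (\<tau> p) \<omega> = (\<Sum>q<p. \<xi> q \<omega> * (\<omega> (\<tau> (Suc q)) $ j - \<omega> (\<tau> q) $ j))"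
proof -
  have "\<xi> k \<omega> * (\<omega> (min (\<tau> p) (\<tau> (Suc k))) $ j - \<omega> (min (\<tau> p) (\<tau> k)) $ j)
      = (if k < p then \<xi> k \<omega> * (\<omega> (\<tau> (Suc k)) $ j - \<omega> (\<tau> k) $ j) else 0)" if "k < m" for k
  proof (cases "k < p")
    case True
    then have "\<tau> (Suc k) \<le> \<tau> p" "\<tau> k \<le> \<tau> p" using steps_mono[of m \<tau> _ p] \<tau> p by auto
    then show ?thesis using True by (simp add: min_absorb2)
  next
    case False
    then have "\<tau> p \<le> \<tau> k" "\<tau> p \<le> \<tau> (Suc k)" using steps_mono[of m \<tau> p] \<tau> that by auto
    then show ?thesis using False by (simp add: min_absorb1)
  qed
  then have "elementary_integral j m \<tau> \<xi> (\<tau> p) \<omega>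
      = (\<Sum>k<m. if k < p then \<xi> k \<omega> * (\<omega> (\<tau> (Suc k)) $ j - \<omega> (\<tau> k) $ j) else 0)"
    unfolding elementary_integral_def by (intro sum.cong) auto
  also have "\<dots> = (\<Sum>q<p. \<xi> q \<omega> * (\<omega> (\<tau> (Suc q)) $ j - \<omega> (\<tau> q) $ j))"
    using p by (intro sum.mono_neutral_cong_right) auto
  finally show ?thesis .
qed

lemma integrable_elementary_error:
  assumes "continuous_on {0..t} h"
  shows "set_integrable lborel {0..t} (\<lambda>u. (elementary_process m \<tau> \<xi> u \<omega> - h u)\<^sup>2)"
proof -
  let ?G = "\<lambda>u. elementary_process m \<tau> \<xi> u \<omega>"
  let ?f = "\<lambda>u. indicator {0..t} u *\<^sub>R (?G u - h u)\<^sup>2"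
  have [measurable]: "(\<lambda>u. indicator {0..t} u *\<^sub>R h u) \<in> borel_measurable borel"
    by (rule borel_measurable_continuous_on_indicator) (use assms in auto)
  have [measurable]: "?G \<in> borel_measurable borel"
    unfolding elementary_process_def by measurable
  have f_eq: "?f = (\<lambda>u. (indicator {0..t} u *\<^sub>R ?G u - indicator {0..t} u *\<^sub>R h u)\<^sup>2)"
    by (auto simp: indicator_def)
  have f: "?f \<in> borel_measurable borel" unfolding f_eq by measurable
  have "bounded (h ` {0..t})"
    by (rule compact_imp_bounded[OF compact_continuous_image[OF assms compact_Icc]])
  then obtain C where C: "\<And>u. u \<in> {0..t} \<Longrightarrow> \<bar>h u\<bar> \<le> C"
    unfolding bounded_iff by (metis image_eqI real_norm_def)
  let ?B = "(\<Sum>k<m. \<bar>\<xi> k \<omega>\<bar>)"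
  have G: "\<bar>?G u\<bar> \<le> ?B" for u
    unfolding elementary_process_def
    by (rule order_trans[OF sum_abs]) (auto intro!: sum_mono simp: indicator_def)
  have B: "norm (?f u) \<le> (?B + C)\<^sup>2" if "u \<in> {0..t}" for u
  proof -
    have "\<bar>?G u - h u\<bar> \<le> ?B + C" using G[of u] C[OF that] by linarith
    then have "\<bar>?G u - h u\<bar>\<^sup>2 \<le> (?B + C)\<^sup>2" by (rule power_mono) simp
    then show ?thesis using that by simp
  qed
  have "integrable lborel ?f"
    by (rule integrableI_bounded_set[where A = "{0..t}" and B = "(?B + C)\<^sup>2"])
      (use f B in \<open>auto intro!: AE_I2 simp: emeasure_lborel_Icc_eq\<close>)
  then show ?thesis unfolding set_integrable_def .
qed

section \<open>A modulus of continuity off a small event\<close>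

context wiener
begin

text \<open>Paths on \<open>{0..T}\<close> are almost surely uniformly continuous. The events on
  which the step \<open>1 / (n + 1)\<close> works increase with n to almost everything, so one of
  them has probability close to 1.\<close>

lemma modulus_of_continuity:
  fixes H :: "real \<Rightarrow> (real \<Rightarrow> real^'d) \<Rightarrow> real"
  assumes H: "\<And>t. 0 \<le> t \<Longrightarrow> H t \<in> borel_measurable M"
    and cont: "AE \<omega> in P. continuous_on {0..} (\<lambda>t. H t \<omega>)"
    and T: "0 \<le> T" and \<eta>: "0 < \<eta>" and \<epsilon>: "0 < (\<epsilon>::real)"
  obtains d A where "0 < d" "A \<in> sets M" "prob A < \<epsilon>"
    "\<And>\<omega>. \<omega> \<in> space M - A \<Longrightarrow> continuous_on {0..} (\<lambda>t. H t \<omega>)"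
    "\<And>\<omega> s u. \<omega> \<in> space M - A \<Longrightarrow> s \<in> {0..T} \<Longrightarrow> u \<in> {0..T} \<Longrightarrow> \<bar>s - u\<bar> < d \<Longrightarrow> \<bar>H s \<omega> - H u \<omega>\<bar> \<le> \<eta>"
proof -
  obtain N where contP: "\<And>\<omega>. \<omega> \<in> space P - N \<Longrightarrow> continuous_on {0..} (\<lambda>t. H t \<omega>)" and N: "N \<in> null_sets P"
    using AE_E3[OF cont] by metis
  have N_M: "N \<in> null_sets M" by (rule null_sets_completionI[OF N])
  have contN: "continuous_on {0..} (\<lambda>t. H t \<omega>)" if "\<omega> \<in> space M - N" for \<omega>
    using contP that by simp
  \<comment> \<open>Clamping lets rational times approximate every point of \<open>{0..T}\<close>,
    including an end point \<open>T\<close> that may be irrational.\<close>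
  define \<pi> where "\<pi> r = min T (max 0 r)" for r :: real
  have \<pi>: "\<pi> r \<in> {0..T}" for r using T by (auto simp: \<pi>_def)
  have \<pi>_id: "\<pi> r = r" if "r \<in> {0..T}" for r using that by (auto simp: \<pi>_def)
  have \<pi>_cont: "continuous_on UNIV \<pi>" unfolding \<pi>_def by (intro continuous_intros)
  \<comment> \<open>Rational times make this a countable condition, hence an event; by continuity
    the non-strict bound passes to all real times at the end.\<close>
  define good where "good n \<omega> \<longleftrightarrow> (\<forall>r\<in>\<rat>. \<forall>r'\<in>\<rat>. \<bar>\<pi> r - \<pi> r'\<bar> < 1 / real (Suc n) \<longrightarrow> \<bar>H (\<pi> r) \<omega> - H (\<pi> r') \<omega>\<bar> \<le> \<eta>)" for n \<omega>
  define G where "G n = {\<omega>\<in>space M. good n \<omega>}" for n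
  have H\<pi>: "H (\<pi> r) \<in> borel_measurable M" for r using H \<pi>[of r] by auto
  have G_sets: "G n \<in> sets M" for n
  proof -
    have "{\<omega>\<in>space M. \<bar>\<pi> r - \<pi> r'\<bar> < 1 / real (Suc n) \<longrightarrow> \<bar>H (\<pi> r) \<omega> - H (\<pi> r') \<omega>\<bar> \<le> \<eta>} \<in> sets M" for r r'
      using H\<pi>[of r] H\<pi>[of r'] by measurable
    then show ?thesis
      unfolding G_def good_def by (intro sets.sets_Collect_countable_All' countable_rat)
  qed
  have "incseq G"
  proof (rule incseq_SucI, rule subsetI)
    fix n \<omega> assume \<omega>: "\<omega> \<in> G n"
    have "1 / real (Suc (Suc n)) \<le> 1 / real (Suc n)" by (simp add: field_simps)
    then have "good (Suc n) \<omega>" using \<omega> unfolding G_def good_def by (auto intro: less_le_trans)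
    then show "\<omega> \<in> G (Suc n)" using \<omega> by (simp add: G_def)
  qed
  have sub: "space M - N \<subseteq> (\<Union>n. G n)"
  proof
    fix \<omega> assume \<omega>: "\<omega> \<in> space M - N"
    have "continuous_on {0..T} (\<lambda>t. H t \<omega>)"
      by (rule continuous_on_subset[OF contN[OF \<omega>]]) auto
    then have "uniformly_continuous_on {0..T} (\<lambda>t. H t \<omega>)"
      by (rule compact_uniformly_continuous) simp
    then obtain d where d: "0 < d" "\<And>s u. s \<in> {0..T} \<Longrightarrow> u \<in> {0..T} \<Longrightarrow> dist s u < d \<Longrightarrow> dist (H s \<omega>) (H u \<omega>) < \<eta>"
      unfolding uniformly_continuous_on_def using \<eta> by meson
    obtain n where n: "1 / real (Suc n) < d"
      using d(1) reals_Archimedean[of d] by (auto simp: inverse_eq_divide)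
    have "good n \<omega>"
      unfolding good_def
    proof (intro ballI impI)
      fix r r' assume "\<bar>\<pi> r - \<pi> r'\<bar> < 1 / real (Suc n)"
      then have "dist (\<pi> r) (\<pi> r') < d" using n by (simp add: dist_real_def)
      then show "\<bar>H (\<pi> r) \<omega> - H (\<pi> r') \<omega>\<bar> \<le> \<eta>"
        using d(2)[OF \<pi> \<pi>, of r r'] by (simp add: dist_real_def)
    qed
    then show "\<omega> \<in> (\<Union>n. G n)" using \<omega> by (auto simp: G_def)
  qed
  have "prob (space M - N) = 1"
    using N_M prob_compl[of N] by (simp add: null_sets_def measure_def)
  moreover have "prob (space M - N) \<le> prob (\<Union>n. G n)"
    by (rule finite_measure_mono[OF sub]) (use G_sets in auto)
  ultimately have "prob (\<Union>n. G n) \<ge> 1" by simp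
  moreover have "(\<lambda>n. prob (G n)) \<longlonglongrightarrow> prob (\<Union>n. G n)"
    by (rule finite_Lim_measure_incseq) (use G_sets \<open>incseq G\<close> in auto)
  ultimately have "\<forall>\<^sub>F n in sequentially. prob (G n) > 1 - \<epsilon>"
    using \<epsilon> by (intro order_tendstoD(1)) auto
  then obtain n where n: "prob (G n) > 1 - \<epsilon>" by (metis eventually_sequentially order_refl)
  let ?A = "(space M - G n) \<union> N"
  show thesis
  proof (rule that)
    show "0 < 1 / real (Suc n)" by simp
    show A: "?A \<in> sets M" using G_sets N_M by auto
    have "prob ?A \<le> prob (space M - G n) + prob N"
      by (rule measure_Un_le) (use G_sets N_M in auto)
    also have "\<dots> = 1 - prob (G n)"
      using N_M prob_compl[OF G_sets] by (simp add: null_sets_def measure_def)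
    finally show "prob ?A < \<epsilon>" using n by simp
    fix \<omega> assume \<omega>: "\<omega> \<in> space M - ?A"
    then show c: "continuous_on {0..} (\<lambda>t. H t \<omega>)" using contN by auto
    have good: "good n \<omega>" using \<omega> by (auto simp: G_def)
    fix s u assume su: "s \<in> {0..T}" "u \<in> {0..T}" "\<bar>s - u\<bar> < 1 / real (Suc n)"
    have H_lim: "(\<lambda>k. H (\<pi> (x k)) \<omega>) \<longlonglongrightarrow> H v \<omega>" "(\<lambda>k. \<pi> (x k)) \<longlonglongrightarrow> v" if "v \<in> {0..T}" "x \<longlonglongrightarrow> v" for x v
    proof -
      have "(\<lambda>k. \<pi> (x k)) \<longlonglongrightarrow> \<pi> v"
        by (rule continuous_on_tendsto_compose[OF \<pi>_cont that(2)]) auto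
      then show *: "(\<lambda>k. \<pi> (x k)) \<longlonglongrightarrow> v" using \<pi>_id[OF that(1)] by simp
      show "(\<lambda>k. H (\<pi> (x k)) \<omega>) \<longlonglongrightarrow> H v \<omega>"
        by (rule continuous_on_tendsto_compose[OF c *]) (use that \<pi> in auto)
    qed
    have dense: "\<exists>x. (\<forall>k. x k \<in> \<rat>) \<and> x \<longlonglongrightarrow> v" for v :: real
      using Rats_closure_real closure_sequential[of v "\<rat>"] by simp
    obtain x y where x: "\<And>k. x k \<in> \<rat>" "x \<longlonglongrightarrow> s" and y: "\<And>k. y k \<in> \<rat>" "y \<longlonglongrightarrow> u"
      using dense[of s] dense[of u] by blast
    have "(\<lambda>k. \<bar>\<pi> (x k) - \<pi> (y k)\<bar>) \<longlonglongrightarrow> \<bar>s - u\<bar>"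
      by (intro tendsto_intros H_lim(2) su x y)
    then have "\<forall>\<^sub>F k in sequentially. \<bar>\<pi> (x k) - \<pi> (y k)\<bar> < 1 / real (Suc n)"
      using su(3) by (rule order_tendstoD(2))
    then have "\<forall>\<^sub>F k in sequentially. \<bar>H (\<pi> (x k)) \<omega> - H (\<pi> (y k)) \<omega>\<bar> \<le> \<eta>"
      by eventually_elim (use good x(1) y(1) in \<open>auto simp: good_def\<close>)
    moreover have "(\<lambda>k. \<bar>H (\<pi> (x k)) \<omega> - H (\<pi> (y k)) \<omega>\<bar>) \<longlonglongrightarrow> \<bar>H s \<omega> - H u \<omega>\<bar>"
      by (intro tendsto_intros H_lim(1) su x y)
    ultimately show "\<bar>H s \<omega> - H u \<omega>\<bar> \<le> \<eta>"
      by (intro tendsto_upperbound) auto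
  qed
qed

end

text \<open>The end point \<open>\<tau> m\<close> is left free, so that one bound on the mesh serves
  all horizons up to a given \<open>T\<close>; the values of \<open>\<tau>\<close> beyond index m
  are arbitrary.\<close>

definition fine_partition :: "real \<Rightarrow> nat \<Rightarrow> (nat \<Rightarrow> real) \<Rightarrow> bool" where
  "fine_partition d m \<tau> \<longleftrightarrow> \<tau> 0 = 0 \<and> (\<forall>k<m. \<tau> k < \<tau> (Suc k) \<and> \<tau> (Suc k) - \<tau> k < d)"

lemma fine_partitionD:
  assumes "fine_partition d m \<tau>"
  shows "\<tau> 0 = 0" "\<And>k. k < m \<Longrightarrow> \<tau> k < \<tau> (Suc k)" "\<And>k. k < m \<Longrightarrow> \<tau> (Suc k) - \<tau> k < d"
    "\<And>i k. i \<le> k \<Longrightarrow> k \<le> m \<Longrightarrow> \<tau> i \<le> \<tau> k" "\<And>k. k \<le> m \<Longrightarrow> 0 \<le> \<tau> k"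
proof -
  show 1: "\<tau> 0 = 0" "\<And>k. k < m \<Longrightarrow> \<tau> k < \<tau> (Suc k)" "\<And>k. k < m \<Longrightarrow> \<tau> (Suc k) - \<tau> k < d"
    using assms by (auto simp: fine_partition_def)
  show 2: "\<And>i k. i \<le> k \<Longrightarrow> k \<le> m \<Longrightarrow> \<tau> i \<le> \<tau> k"
    by (rule steps_mono[of m]) (use 1 in auto)
  show "\<And>k. k \<le> m \<Longrightarrow> 0 \<le> \<tau> k"
    using 2[of 0] 1(1) by simp
qed

lemma fine_partition_mono: "fine_partition d m \<tau> \<Longrightarrow> d \<le> d' \<Longrightarrow> fine_partition d' m \<tau>"
  by (auto simp: fine_partition_def)

lemma power2_add_le: "(a + b)\<^sup>2 \<le> 2 * a\<^sup>2 + 2 * b\<^sup>2" for a b :: real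
  using sum_squares_bound[of a b] by (simp add: power2_sum)

section \<open>Comparison of Riemann sums with elementary approximations\<close>

context wiener
begin

text \<open>By \<open>compat\<close> a piece that is active at the right end of the cell began no
  later than its left end, so its coefficient is already known there.\<close>

lemma elementary_process_node_measurable:
  assumes s: "\<And>i. i < n \<Longrightarrow> s i < s (Suc i)" and l: "l < n"
    and compat: "\<And>k. k \<le> m \<Longrightarrow> \<not> (s l < \<tau> k \<and> \<tau> k < s (Suc l))"
    and \<xi>: "\<And>k. k < m \<Longrightarrow> \<xi> k \<in> borel_measurable (F (\<tau> k))"
  shows "elementary_process m \<tau> \<xi> (s (Suc l)) \<in> borel_measurable (F (s l))"
proof -
  have "(\<lambda>\<omega>. \<xi> k \<omega> * indicator {\<tau> k<..\<tau> (Suc k)} (s (Suc l))) \<in> borel_measurable (F (s l))" if "k < m" for k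
  proof (cases "s (Suc l) \<in> {\<tau> k<..\<tau> (Suc k)}")
    case True
    then have "\<tau> k \<le> s l" using compat[of k] that by force
    then show ?thesis using measurable_F_mono[OF \<xi>[OF that]] by simp
  qed simp
  then show ?thesis
    unfolding elementary_process_def[abs_def] by (intro borel_measurable_sum) auto
qed

text \<open>Both step processes are constant on the cells of the refinement, so the sum is the
  integral of their squared difference. Inserting \<open>h\<close> between them leaves the
  approximation error of the elementary process and an oscillation of size at most \<eta>.\<close>

lemma quadratic_variation_le:
  fixes \<omega> :: 'w
  assumes s: "\<And>i. i < n \<Longrightarrow> s i < s (Suc i)" and s0: "s 0 = 0"
    and \<tau>: "\<And>k. k < m \<Longrightarrow> \<tau> k < \<tau> (Suc k)" and \<tau>0: "\<tau> 0 = 0" and end_eq: "s n = \<tau> m"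
    and compat\<tau>: "\<And>i k. i < n \<Longrightarrow> k \<le> m \<Longrightarrow> \<not> (s i < \<tau> k \<and> \<tau> k < s (Suc i))"
    and compat\<sigma>: "\<And>i k. i < n \<Longrightarrow> k \<le> r \<Longrightarrow> \<not> (s i < \<sigma> k \<and> \<sigma> k < s (Suc i))"
    and h: "continuous_on {0..} h"
    and close: "\<And>k u. k < m \<Longrightarrow> \<tau> k < u \<Longrightarrow> u \<le> \<tau> (Suc k) \<Longrightarrow> \<bar>h u - h (\<tau> k)\<bar> \<le> \<eta>"
  shows "(\<Sum>l<n. (elementary_process r \<sigma> \<xi> (s (Suc l)) \<omega> - elementary_process m \<tau> (\<lambda>k _. h (\<tau> k)) (s (Suc l)) \<omega>)\<^sup>2
      * (s (Suc l) - s l))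
    \<le> 2 * (LBINT u:{0..\<tau> m}. (elementary_process r \<sigma> \<xi> u \<omega> - h u)\<^sup>2) + 2 * \<eta>\<^sup>2 * \<tau> m"
proof -
  let ?G = "\<lambda>u. elementary_process r \<sigma> \<xi> u \<omega>"
  let ?R = "\<lambda>u. elementary_process m \<tau> (\<lambda>k _. h (\<tau> k)) u \<omega>"
  \<comment> \<open>The sum to be bounded is the integral of the elementary process on the refined
    nodes with these coefficients; the second argument is a dummy required by the format.\<close>
  define D where "D l \<omega>' = (?G (s (Suc l)) - ?R (s (Suc l)))\<^sup>2" for l and \<omega>' :: 'w
  have const: "elementary_process a t z u \<omega> = elementary_process a t z (s (Suc l)) \<omega>"
    if "l < n" "s l < u" "u \<le> s (Suc l)" "\<And>k. k \<le> a \<Longrightarrow> \<not> (s l < t k \<and> t k < s (Suc l))" for a t z u l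
  proof -
    have "indicator {t k<..t (Suc k)} u = (indicator {t k<..t (Suc k)} (s (Suc l)) :: real)" if "k < a" for k
      using that \<open>s l < u\<close> \<open>u \<le> s (Suc l)\<close> \<open>\<And>k. k \<le> a \<Longrightarrow> \<not> (s l < t k \<and> t k < s (Suc l))\<close>[of k]
        \<open>\<And>k. k \<le> a \<Longrightarrow> \<not> (s l < t k \<and> t k < s (Suc l))\<close>[of "Suc k"]
      by (auto simp: indicator_def)
    then show ?thesis unfolding elementary_process_def by (intro sum.cong) auto
  qed
  have \<tau>m: "0 \<le> \<tau> m" using steps_mono[of m \<tau> 0 m] \<tau> \<tau>0 by auto
  have s_mono: "s i \<le> s j" if "i \<le> j" "j \<le> n" for i j
    by (rule steps_mono[of n]) (use s that in auto)
  have int_h: "set_integrable lborel {0..\<tau> m} (\<lambda>u. (?G u - h u)\<^sup>2)"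
    by (rule integrable_elementary_error[OF continuous_on_subset[OF h]]) auto
  have le: "elementary_process n s D u \<omega>
      \<le> 2 * (indicator {0..\<tau> m} u *\<^sub>R (?G u - h u)\<^sup>2) + 2 * \<eta>\<^sup>2 * indicator {0..\<tau> m} u" for u
  proof (cases "s 0 < u \<and> u \<le> s n")
    case True
    then obtain l where l: "l < n" "s l < u" "u \<le> s (Suc l)" using steps_find[of s u n] by auto
    have u: "u \<in> {0..\<tau> m}" using True s0 end_eq by simp
    obtain k where k: "k < m" "\<tau> k < u" "u \<le> \<tau> (Suc k)"
      using steps_find[of \<tau> u m] True s0 end_eq \<tau>0 by auto
    have R: "?R u = h (\<tau> k)" by (rule elementary_process_eq[OF \<tau> k])
    have "elementary_process n s D u \<omega> = D l \<omega>"
      by (rule elementary_process_eq[OF s l])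
    also have "\<dots> = (?G (s (Suc l)) - ?R (s (Suc l)))\<^sup>2" by (simp add: D_def)
    also have "\<dots> = (?G u - ?R u)\<^sup>2"
      using const[OF l compat\<sigma>] const[OF l compat\<tau>] l(1) by simp
    also have "\<dots> = ((?G u - h u) + (h u - h (\<tau> k)))\<^sup>2" unfolding R by simp
    also have "\<dots> \<le> 2 * (?G u - h u)\<^sup>2 + 2 * (h u - h (\<tau> k))\<^sup>2"
      by (rule power2_add_le)
    also have "(h u - h (\<tau> k))\<^sup>2 \<le> \<eta>\<^sup>2"
      using power_mono[OF close[OF k], of 2] by simp
    finally show ?thesis using u by simp
  next
    case False
    have "elementary_process n s D u \<omega> = 0"
      unfolding elementary_process_def
    proof (rule sum.neutral, rule ballI)
      fix l assume "l \<in> {..<n}"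
      then have "s 0 \<le> s l" "s (Suc l) \<le> s n" using s_mono by auto
      then have "u \<notin> {s l<..s (Suc l)}" using False by auto
      then show "D l \<omega> * indicator {s l<..s (Suc l)} u = 0" by simp
    qed
    then show ?thesis by simp
  qed
  have int1: "integrable lborel (\<lambda>u. 2 * (indicator {0..\<tau> m} u *\<^sub>R (?G u - h u)\<^sup>2))"
    using int_h unfolding set_integrable_def by (rule integrable_mult_right)
  have int2: "integrable lborel (\<lambda>u. 2 * \<eta>\<^sup>2 * indicator {0..\<tau> m} u)"
    by (intro integrable_mult_right integrable_real_indicator) (auto simp: emeasure_lborel_Icc_eq)
  have indI: "integrable lborel (indicator {s l<..s (Suc l)} :: real \<Rightarrow> real)"
      "integral\<^sup>L lborel (indicator {s l<..s (Suc l)} :: real \<Rightarrow> real) = s (Suc l) - s l" if "l < n" for l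
    using s[OF that] by (auto intro!: integrable_real_indicator)
  have int3: "integrable lborel (\<lambda>u. elementary_process n s D u \<omega>)"
    unfolding elementary_process_def by (intro Bochner_Integration.integrable_sum integrable_mult_right indI) auto
  have "(\<Sum>l<n. (?G (s (Suc l)) - ?R (s (Suc l)))\<^sup>2 * (s (Suc l) - s l))
      = (\<Sum>l<n. D l \<omega> * (s (Suc l) - s l))"
    by (simp add: D_def)
  also have "\<dots> = (\<integral>u. elementary_process n s D u \<omega> \<partial>lborel)"
    unfolding elementary_process_def
    by (subst Bochner_Integration.integral_sum) (use indI in \<open>auto intro!: sum.cong\<close>)
  also have "\<dots> \<le> (\<integral>u. 2 * (indicator {0..\<tau> m} u *\<^sub>R (?G u - h u)\<^sup>2) + 2 * \<eta>\<^sup>2 * indicator {0..\<tau> m} u \<partial>lborel)"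
    by (rule integral_mono[OF int3 Bochner_Integration.integrable_add[OF int1 int2] le])
  also have "\<dots> = (\<integral>u. 2 * (indicator {0..\<tau> m} u *\<^sub>R (?G u - h u)\<^sup>2) \<partial>lborel) + (\<integral>u. 2 * \<eta>\<^sup>2 * indicator {0..\<tau> m} u \<partial>lborel)"
    by (rule Bochner_Integration.integral_add[OF int1 int2])
  also have "\<dots> = 2 * (LBINT u:{0..\<tau> m}. (?G u - h u)\<^sup>2) + 2 * \<eta>\<^sup>2 * \<tau> m"
    unfolding set_lebesgue_integral_def using \<tau>m by simp
  finally show ?thesis .
qed

lemma tendsto_in_probD:
  assumes "tendsto_in_prob N Y Z" "0 < e" "0 < \<delta>"
  shows "\<forall>\<^sub>F k in sequentially. measure N {\<omega>\<in>space N. \<bar>Y k \<omega> - Z \<omega>\<bar> > e} < \<delta>"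
  using assms unfolding tendsto_in_prob_def by (auto intro: order_tendstoD(2))

text \<open>Smallness in probability, uniform over the nodes and over all partitions of small mesh.
  The exceptional event may depend on the partition, and its mere existence is asked, so that
  \<open>E\<close> need not be known to be measurable.\<close>

definition mesh_negligible :: "real \<Rightarrow> ((nat \<Rightarrow> real) \<Rightarrow> nat \<Rightarrow> (real \<Rightarrow> real^'d) \<Rightarrow> real) \<Rightarrow> bool" where
  "mesh_negligible T E \<longleftrightarrow> (\<forall>\<epsilon>>0. \<exists>d>0. \<forall>m \<tau>. fine_partition d m \<tau> \<longrightarrow> \<tau> m \<le> T \<longrightarrow>
     (\<exists>B\<in>sets M. prob B < \<epsilon> \<and> (\<forall>\<omega>\<in>space M - B. \<forall>p\<le>m. \<bar>E \<tau> p \<omega>\<bar> \<le> \<epsilon>)))"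

lemma mesh_negligibleD:
  assumes "mesh_negligible T E" "0 < \<epsilon>"
  obtains d where "0 < d" "\<And>m \<tau>. fine_partition d m \<tau> \<Longrightarrow> \<tau> m \<le> T \<Longrightarrow>
     \<exists>B\<in>sets M. prob B < \<epsilon> \<and> (\<forall>\<omega>\<in>space M - B. \<forall>p\<le>m. \<bar>E \<tau> p \<omega>\<bar> \<le> \<epsilon>)"
  using assms unfolding mesh_negligible_def by blast

text \<open>The mesh is dictated by the modulus of continuity of \<open>H\<close> alone. For a given
  partition an elementary approximation is taken that is good at its nodes; its difference to the
  Riemann step process has small quadratic variation, and Lenglart's inequality makes the difference
  of the integrals small at all nodes together.\<close>

lemma ito_integral_mesh_negligible:
  assumes I: "has_ito_integral P j H I"
    and H: "\<And>t. 0 \<le> t \<Longrightarrow> H t \<in> borel_measurable (F t)"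
    and cont: "AE \<omega> in P. continuous_on {0..} (\<lambda>t. H t \<omega>)" and T: "0 \<le> T"
  shows "mesh_negligible T (\<lambda>\<tau> p \<omega>. I (\<tau> p) \<omega> - (\<Sum>q<p. H (\<tau> q) \<omega> * (\<omega> (\<tau> (Suc q)) $ j - \<omega> (\<tau> q) $ j)))"
  unfolding mesh_negligible_def
proof (intro allI impI)
  fix \<epsilon> :: real assume \<epsilon>: "0 < \<epsilon>"
  \<comment> \<open>Chosen so that the first term of Lenglart's inequality at level
    \<open>\<epsilon> / 2\<close> equals \<open>\<epsilon> / 8\<close>.\<close>
  define \<delta> where "\<delta> = \<epsilon>^3 / 32"
  have \<delta>: "0 < \<delta>" using \<epsilon> by (simp add: \<delta>_def)
  \<comment> \<open>With this oscillation the term \<open>2 * \<eta>\<^sup>2 * \<tau> m\<close> uses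
    up at most half of \<delta>; the elementary approximation gets the other half.\<close>
  define \<eta> where "\<eta> = sqrt (\<delta> / (4 * (T + 1)))"
  have \<eta>: "0 < \<eta>" using \<delta> T by (simp add: \<eta>_def)
  have \<eta>2: "2 * \<eta>\<^sup>2 * t \<le> \<delta> / 2" if "0 \<le> t" "t \<le> T" for t
  proof -
    have "2 * \<eta>\<^sup>2 * t = \<delta> / 2 * (t / (T + 1))" using \<delta> T by (simp add: \<eta>_def field_simps)
    also have "\<dots> \<le> \<delta> / 2 * 1" using \<delta> T that by (intro mult_left_mono) auto
    finally show ?thesis by simp
  qed
  have \<epsilon>8: "0 < \<epsilon> / 8" using \<epsilon> by simp
  obtain d A where d: "0 < d" and A: "A \<in> sets M" "prob A < \<epsilon> / 8"
    and contA: "\<And>\<omega>. \<omega> \<in> space M - A \<Longrightarrow> continuous_on {0..} (\<lambda>t. H t \<omega>)"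
    and mod: "\<And>\<omega> s u. \<omega> \<in> space M - A \<Longrightarrow> s \<in> {0..T} \<Longrightarrow> u \<in> {0..T} \<Longrightarrow> \<bar>s - u\<bar> < d \<Longrightarrow> \<bar>H s \<omega> - H u \<omega>\<bar> \<le> \<eta>"
    by (rule modulus_of_continuity[OF measurable_F_M[OF H] cont T \<eta> \<epsilon>8]) (assumption, rule that)
  have "\<exists>r \<sigma> \<xi>. (\<forall>k. elementary P (r k) (\<sigma> k) (\<xi> k)) \<and> (\<forall>t\<ge>0.
      tendsto_in_prob M
        (\<lambda>k \<omega>. LBINT s:{0..t}. (elementary_process (r k) (\<sigma> k) (\<xi> k) s \<omega> - H s \<omega>)\<^sup>2) (\<lambda>_. 0) \<and>
      tendsto_in_prob M (\<lambda>k. elementary_integral j (r k) (\<sigma> k) (\<xi> k) t) (I t))"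
    using I unfolding has_ito_integral_def by (elim conjE)
  then obtain r \<sigma> \<xi> where elem: "\<forall>k. elementary P (r k) (\<sigma> k) (\<xi> k)" and *: "\<forall>t\<ge>0.
      tendsto_in_prob M
        (\<lambda>k \<omega>. LBINT s:{0..t}. (elementary_process (r k) (\<sigma> k) (\<xi> k) s \<omega> - H s \<omega>)\<^sup>2) (\<lambda>_. 0) \<and>
      tendsto_in_prob M (\<lambda>k. elementary_integral j (r k) (\<sigma> k) (\<xi> k) t) (I t)"
    by (elim exE conjE) (rule that)
  have lim: "tendsto_in_prob M
        (\<lambda>k \<omega>. LBINT s:{0..t}. (elementary_process (r k) (\<sigma> k) (\<xi> k) s \<omega> - H s \<omega>)\<^sup>2) (\<lambda>_. 0)"
      "tendsto_in_prob M (\<lambda>k. elementary_integral j (r k) (\<sigma> k) (\<xi> k) t) (I t)" if "0 \<le> t" for t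
    using *[rule_format, OF that] by (auto elim: conjE)
  show "\<exists>d>0. \<forall>m \<tau>. fine_partition d m \<tau> \<longrightarrow> \<tau> m \<le> T \<longrightarrow>
     (\<exists>B\<in>sets M. prob B < \<epsilon> \<and> (\<forall>\<omega>\<in>space M - B. \<forall>p\<le>m.
       \<bar>I (\<tau> p) \<omega> - (\<Sum>q<p. H (\<tau> q) \<omega> * (\<omega> (\<tau> (Suc q)) $ j - \<omega> (\<tau> q) $ j))\<bar> \<le> \<epsilon>))"
  proof (rule exI[of _ d], intro conjI allI impI, rule d)
    fix m :: nat and \<tau>
    assume part: "fine_partition d m \<tau>" and \<tau>T: "\<tau> m \<le> T"
    note \<tau>0 = fine_partitionD(1)[OF part] and \<tau> = fine_partitionD(2)[OF part] and mesh = fine_partitionD(3)[OF part]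
    have \<tau>_mono: "\<tau> i \<le> \<tau> k" if "i \<le> k" "k \<le> m" for i k
      by (rule steps_mono[of m]) (use \<tau> that in auto)
    have \<tau>_pos: "0 \<le> \<tau> k" if "k \<le> m" for k using \<tau>_mono[of 0 k] \<tau>0 that by simp
    \<comment> \<open>The index k is chosen after the partition. Convergence at each fixed time then
      suffices, because there are finitely many nodes.\<close>
    let ?E = "\<lambda>k. {\<omega>\<in>space M. \<bar>(LBINT s:{0..\<tau> m}. (elementary_process (r k) (\<sigma> k) (\<xi> k) s \<omega> - H s \<omega>)\<^sup>2) - 0\<bar> > \<delta> / 4}"
    let ?J = "\<lambda>k p. {\<omega>\<in>space M. \<bar>elementary_integral j (r k) (\<sigma> k) (\<xi> k) (\<tau> p) \<omega> - I (\<tau> p) \<omega>\<bar> > \<epsilon> / 2}"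
    have "\<forall>\<^sub>F k in sequentially. prob (?E k) < \<epsilon> / 8"
      by (rule tendsto_in_probD[OF lim(1)]) (use \<tau>_pos \<delta> \<epsilon> in auto)
    moreover have "\<forall>\<^sub>F k in sequentially. \<forall>p\<in>{..m}. prob (?J k p) < \<epsilon> / (8 * real (Suc m))"
      by (intro eventually_ball_finite ballI tendsto_in_probD[OF lim(2)]) (use \<tau>_pos \<epsilon> in auto)
    ultimately have "\<forall>\<^sub>F k in sequentially. prob (?E k) < \<epsilon> / 8 \<and> (\<forall>p\<in>{..m}. prob (?J k p) < \<epsilon> / (8 * real (Suc m)))"
      by (rule eventually_conj)
    then have "\<exists>k. prob (?E k) < \<epsilon> / 8 \<and> (\<forall>p\<in>{..m}. prob (?J k p) < \<epsilon> / (8 * real (Suc m)))"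
      by (rule eventually_happens'[OF sequentially_bot])
    then obtain k where Ek: "prob (?E k) < \<epsilon> / 8" and Jk: "\<forall>p\<in>{..m}. prob (?J k p) < \<epsilon> / (8 * real (Suc m))"
      by (elim exE conjE) (rule that)
    have E_sets: "?E k \<in> sets M"
    proof -
      have "(\<lambda>\<omega>. LBINT s:{0..\<tau> m}. (elementary_process (r k) (\<sigma> k) (\<xi> k) s \<omega> - H s \<omega>)\<^sup>2) \<in> borel_measurable M"
        using lim(1)[OF \<tau>_pos[OF order_refl]] unfolding tendsto_in_prob_def by auto
      then show ?thesis by (intro borel_measurable_less borel_measurable_abs borel_measurable_diff) auto
    qed
    have J_sets: "?J k p \<in> sets M" if "p \<le> m" for p
    proof -
      have [measurable]: "elementary_integral j (r k) (\<sigma> k) (\<xi> k) (\<tau> p) \<in> borel_measurable M" "I (\<tau> p) \<in> borel_measurable M"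
        using lim(2)[OF \<tau>_pos[OF that]] unfolding tendsto_in_prob_def by auto
      show ?thesis by measurable
    qed
    let ?r = "r k" and ?\<sigma> = "\<sigma> k" and ?\<xi> = "\<xi> k"
    have \<sigma>0: "0 \<le> ?\<sigma> 0" and \<sigma>: "\<And>i. i < ?r \<Longrightarrow> ?\<sigma> i < ?\<sigma> (Suc i)"
      and \<xi>: "\<And>i. i < ?r \<Longrightarrow> ?\<xi> i \<in> borel_measurable (F (?\<sigma> i))"
      using elem[rule_format, of k] unfolding elementary_def by auto
    have \<sigma>_pos: "0 \<le> ?\<sigma> i" if "i \<le> ?r" for i
      using steps_mono[of ?r ?\<sigma> 0 i] \<sigma> \<sigma>0 that by fastforce
    \<comment> \<open>The common refinement on \<open>{0..\<tau> m}\<close>; the nodes of the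
      elementary process beyond \<open>\<tau> m\<close> lie after all cells and cannot cut
      one.\<close>
    let ?S = "\<tau> ` {..m} \<union> {x \<in> ?\<sigma> ` {..?r}. x \<le> \<tau> m}"
    have "finite ?S" "?S \<noteq> {}" by auto
    then obtain n s where s: "?S = s ` {..n}" "\<And>i. i < n \<Longrightarrow> s i < s (Suc i)"
      by (rule strict_mono_enumeration) (rule that)
    have S_range: "0 \<le> x \<and> x \<le> \<tau> m" if "x \<in> ?S" for x
      using that \<tau>_mono \<tau>_pos \<sigma>_pos by auto
    have s_mono: "s i \<le> s l" if "i \<le> l" "l \<le> n" for i l
      by (rule steps_mono[of n]) (use s(2) that in auto)
    have s_in: "s i \<in> ?S" if "i \<le> n" for i using s(1) that by blast
    have "0 \<in> ?S" using \<tau>0 by (intro UnI1 image_eqI[of _ _ 0]) auto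
    then obtain i0 where i0: "i0 \<le> n" "s i0 = 0" unfolding s(1) by auto
    have s0: "s 0 = 0" using S_range[OF s_in[of 0]] s_mono[of 0 i0] i0 by simp
    have "\<tau> m \<in> ?S" by auto
    then obtain i1 where i1: "i1 \<le> n" "s i1 = \<tau> m" unfolding s(1) by auto
    have sn: "s n = \<tau> m" using S_range[OF s_in[of n]] s_mono[of i1 n] i1 by simp
    have compat: "\<not> (s i < x \<and> x < s (Suc i))" if "x \<in> ?S" "i < n" for x i
    proof -
      obtain l where "l \<le> n" "x = s l" using \<open>x \<in> ?S\<close> unfolding s(1) by auto
      then show ?thesis using s_mono[of l i] s_mono[of "Suc i" l] \<open>i < n\<close> by (cases "l \<le> i") auto
    qed
    have compat\<tau>: "\<not> (s i < \<tau> q \<and> \<tau> q < s (Suc i))" if "i < n" "q \<le> m" for i q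
      by (rule compat) (use that in auto)
    have compat\<sigma>: "\<not> (s i < ?\<sigma> q \<and> ?\<sigma> q < s (Suc i))" if "i < n" "q \<le> ?r" for i q
    proof (cases "?\<sigma> q \<le> \<tau> m")
      case True
      then show ?thesis by (intro compat) (use that in auto)
    next
      case False
      then show ?thesis using s_mono[of "Suc i" n] sn that by auto
    qed
    let ?H = "\<lambda>q \<omega>. H (\<tau> q) \<omega>"
    \<comment> \<open>Cells are open on the left and closed on the right, so the value at the right
      end point is the value throughout the cell; it is nevertheless known at the left end.\<close>
    define \<zeta> where "\<zeta> l \<omega> = elementary_process ?r ?\<sigma> ?\<xi> (s (Suc l)) \<omega> - elementary_process m \<tau> ?H (s (Suc l)) \<omega>" for l \<omega>
    have \<zeta>_meas: "\<zeta> l \<in> borel_measurable (F (s l))" if l: "l < n" for l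
      unfolding \<zeta>_def
      by (intro borel_measurable_diff elementary_process_node_measurable[where n = n])
        (use s(2) l compat\<sigma> compat\<tau> \<xi> H \<tau>_pos in auto)
    let ?N = "\<lambda>i \<omega>. \<Sum>l<i. \<zeta> l \<omega> * (\<omega> (s (Suc l)) $ j - \<omega> (s l) $ j)"
    let ?BN = "{\<omega>\<in>space M. \<exists>i\<le>n. \<bar>?N i \<omega>\<bar> > \<epsilon> / 2}"
    let ?Q = "{\<omega>\<in>space M. (\<Sum>l<n. (\<zeta> l \<omega>)\<^sup>2 * (s (Suc l) - s l)) > \<delta>}"
    have "prob ?BN \<le> \<delta> / (\<epsilon> / 2)\<^sup>2 + prob ?Q"
      by (rule lenglart_inequality) (use s0 s(2) \<zeta>_meas \<delta> \<epsilon> in auto)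
    moreover have "\<delta> / (\<epsilon> / 2)\<^sup>2 = \<epsilon> / 8"
      using \<epsilon> by (simp add: \<delta>_def power2_eq_square power3_eq_cube)
    moreover have "prob ?Q \<le> prob (A \<union> ?E k)"
    proof (rule finite_measure_mono)
      show "A \<union> ?E k \<in> sets M" using A E_sets by blast
      show "?Q \<subseteq> A \<union> ?E k"
      proof (rule subsetI, rule ccontr)
        fix \<omega> assume \<omega>: "\<omega> \<in> ?Q" "\<omega> \<notin> A \<union> ?E k"
        then have \<omega>A: "\<omega> \<in> space M - A" by blast
        have "(\<Sum>l<n. (\<zeta> l \<omega>)\<^sup>2 * (s (Suc l) - s l))
            \<le> 2 * (LBINT u:{0..\<tau> m}. (elementary_process ?r ?\<sigma> ?\<xi> u \<omega> - H u \<omega>)\<^sup>2) + 2 * \<eta>\<^sup>2 * \<tau> m"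
        proof -
          have "elementary_process m \<tau> ?H u \<omega> = elementary_process m \<tau> (\<lambda>k _. H (\<tau> k) \<omega>) u \<omega>" for u
            by (simp add: elementary_process_def)
          then show ?thesis unfolding \<zeta>_def
          proof (simp only:, intro quadratic_variation_le)
            fix q u assume q: "q < m" "\<tau> q < u" "u \<le> \<tau> (Suc q)"
            have "u \<le> T" using q \<tau>_mono[of "Suc q" m] \<tau>T by simp
            moreover have "0 \<le> \<tau> q" using \<tau>_pos[of q] q by simp
            ultimately show "\<bar>H u \<omega> - H (\<tau> q) \<omega>\<bar> \<le> \<eta>"
              using q mesh[of q] by (intro mod[OF \<omega>A]) auto
          qed (use s0 s(2) \<tau> \<tau>0 sn compat\<tau> compat\<sigma> contA[OF \<omega>A] in auto)
        qed
        also have "\<dots> \<le> 2 * (\<delta> / 4) + \<delta> / 2"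
          using \<omega> \<eta>2[of "\<tau> m"] \<tau>_pos[of m] \<tau>T by (intro add_mono) auto
        finally show False using \<omega> by simp
      qed
    qed
    moreover have "prob (A \<union> ?E k) \<le> prob A + prob (?E k)"
      by (rule measure_Un_le) (use A E_sets in auto)
    ultimately have PN: "prob ?BN < \<epsilon> / 8 + \<epsilon> / 8 + \<epsilon> / 8" using A Ek by linarith
    have "prob (\<Union>p\<in>{..m}. ?J k p) \<le> (\<Sum>p\<in>{..m}. prob (?J k p))"
      by (rule finite_measure_subadditive_finite) (use J_sets in auto)
    also have "\<dots> \<le> (\<Sum>p\<in>{..m}. \<epsilon> / (8 * real (Suc m)))"
      by (rule sum_mono) (use Jk in \<open>auto intro: less_imp_le\<close>)
    also have "\<dots> = \<epsilon> / 8" by (simp add: field_simps)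
    finally have PJ: "prob (\<Union>p\<in>{..m}. ?J k p) \<le> \<epsilon> / 8" .
    have N_M: "?N i \<in> borel_measurable M" if "i \<le> n" for i
      using that s0 s(2) \<zeta>_meas
      by (intro measurable_F_M[OF martingale_measurable[where m = n]]) auto
    have BN_sets: "?BN \<in> sets M"
    proof -
      have "{\<omega>\<in>space M. \<exists>i\<in>{..n}. \<bar>?N i \<omega>\<bar> > \<epsilon> / 2} \<in> sets M"
      proof (intro sets.sets_Collect_countable_Ex')
        fix i assume "i \<in> {..n}"
        then have [measurable]: "?N i \<in> borel_measurable M" using N_M by simp
        show "{\<omega>\<in>space M. \<bar>?N i \<omega>\<bar> > \<epsilon> / 2} \<in> sets M" by measurable
      qed simp
      then show ?thesis by (simp only: Bex_def atMost_iff)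
    qed
    have JU_sets: "(\<Union>p\<in>{..m}. ?J k p) \<in> sets M" using J_sets by (intro sets.finite_UN) auto
    show "\<exists>B\<in>sets M. prob B < \<epsilon> \<and> (\<forall>\<omega>\<in>space M - B. \<forall>p\<le>m.
          \<bar>I (\<tau> p) \<omega> - (\<Sum>q<p. H (\<tau> q) \<omega> * (\<omega> (\<tau> (Suc q)) $ j - \<omega> (\<tau> q) $ j))\<bar> \<le> \<epsilon>)"
    proof (rule bexI[of _ "?BN \<union> (\<Union>p\<in>{..m}. ?J k p)"], intro conjI ballI allI impI)
      show "prob (?BN \<union> (\<Union>p\<in>{..m}. ?J k p)) < \<epsilon>"
        using measure_Un_le[OF BN_sets JU_sets] PN PJ \<epsilon> by linarith
      show "?BN \<union> (\<Union>p\<in>{..m}. ?J k p) \<in> sets M" using BN_sets JU_sets by (rule sets.Un)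
      fix \<omega> p assume \<omega>: "\<omega> \<in> space M - (?BN \<union> (\<Union>p\<in>{..m}. ?J k p))" and p: "p \<le> m"
      have "\<tau> p \<in> ?S" using p by auto
      then obtain i where i: "i \<le> n" "\<tau> p = s i" unfolding s(1) by auto
      have "?N i \<omega> = elementary_integral j ?r ?\<sigma> ?\<xi> (s i) \<omega> - elementary_integral j m \<tau> ?H (s i) \<omega>"
        unfolding \<zeta>_def
        using elementary_integral_refinement[of ?r ?\<sigma> n s i j ?\<xi> \<omega>] elementary_integral_refinement[of m \<tau> n s i j ?H \<omega>]
          \<sigma> \<tau> s(2) s0 \<sigma>0 \<tau>0 compat\<sigma> compat\<tau> i(1)
        by (simp add: left_diff_distrib sum_subtractf)
      also have "elementary_integral j m \<tau> ?H (s i) \<omega> = (\<Sum>q<p. H (\<tau> q) \<omega> * (\<omega> (\<tau> (Suc q)) $ j - \<omega> (\<tau> q) $ j))"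
        unfolding i(2)[symmetric] by (rule elementary_integral_at_node) (use \<tau> p in auto)
      finally have "?N i \<omega> = elementary_integral j ?r ?\<sigma> ?\<xi> (\<tau> p) \<omega>
          - (\<Sum>q<p. H (\<tau> q) \<omega> * (\<omega> (\<tau> (Suc q)) $ j - \<omega> (\<tau> q) $ j))"
        unfolding i(2) .
      moreover have "\<bar>?N i \<omega>\<bar> \<le> \<epsilon> / 2" using \<omega> i(1) by (auto simp: not_less)
      moreover have "\<bar>elementary_integral j ?r ?\<sigma> ?\<xi> (\<tau> p) \<omega> - I (\<tau> p) \<omega>\<bar> \<le> \<epsilon> / 2" using \<omega> p by (auto simp: not_less)
      ultimately show "\<bar>I (\<tau> p) \<omega> - (\<Sum>q<p. H (\<tau> q) \<omega> * (\<omega> (\<tau> (Suc q)) $ j - \<omega> (\<tau> q) $ j))\<bar> \<le> \<epsilon>"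
        by linarith
    qed
  qed
qed

end

section \<open>The Euler scheme\<close>

definition euler_step :: "(real^'n \<Rightarrow> real^'n) \<Rightarrow> (real^'n \<Rightarrow> real^'d^'n) \<Rightarrow> real \<Rightarrow> real^'n \<Rightarrow> real^'d \<Rightarrow> real^'n" where
  "euler_step f g \<delta> x w = x + \<delta> *\<^sub>R f x + g x *v w"

primrec euler :: "(real^'n \<Rightarrow> real^'n) \<Rightarrow> (real^'n \<Rightarrow> real^'d^'n) \<Rightarrow> (nat \<Rightarrow> real) \<Rightarrow> real^'n \<Rightarrow> nat \<Rightarrow>
    (real \<Rightarrow> real^'d) \<Rightarrow> real^'n" where
  "euler f g \<tau> x 0 \<omega> = x"
| "euler f g \<tau> x (Suc p) \<omega> =
    euler_step f g (\<tau> (Suc p) - \<tau> p) (euler f g \<tau> x p \<omega>) (\<omega> (\<tau> (Suc p)) - \<omega> (\<tau> p))"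

lemma euler_sum:
  "euler f g \<tau> x p \<omega> = x + (\<Sum>q<p. (\<tau> (Suc q) - \<tau> q) *\<^sub>R f (euler f g \<tau> x q \<omega>)
     + g (euler f g \<tau> x q \<omega>) *v (\<omega> (\<tau> (Suc q)) - \<omega> (\<tau> q)))"
  by (induction p) (simp_all add: euler_step_def algebra_simps)

text \<open>The drift part of a discrete Gronwall step. The factor
  \<open>3 * (1 + L)\<^sup>2\<close> is a common bound for the two coefficients
  \<open>1 + 3 * L + L\<^sup>2\<close> and \<open>2 + L\<close> that come out of expanding the
  square.\<close>

lemma quadratic_step_bound:
  fixes v A L \<Delta> :: real
  assumes "0 \<le> v" "0 \<le> A" "0 \<le> L" "0 \<le> \<Delta>" "\<Delta> \<le> 1"
  shows "(v + \<Delta> * (L * v + A))\<^sup>2 \<le> v\<^sup>2 + \<Delta> * 3 * (1 + L)\<^sup>2 * (v\<^sup>2 + A\<^sup>2)"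
proof -
  have "2 * v * A \<le> v\<^sup>2 + A\<^sup>2" by (rule sum_squares_bound)
  then have 1: "v * (L * v + A) * 2 \<le> (2 * L + 1) * v\<^sup>2 + A\<^sup>2"
    by (simp add: algebra_simps power2_eq_square)
  have "(L * v + A)\<^sup>2 \<le> L\<^sup>2 * v\<^sup>2 + L * (v\<^sup>2 + A\<^sup>2) + A\<^sup>2"
    using mult_left_mono[OF \<open>2 * v * A \<le> v\<^sup>2 + A\<^sup>2\<close> assms(3)]
    by (simp add: power2_sum power_mult_distrib algebra_simps)
  moreover have "\<Delta>\<^sup>2 * (L * v + A)\<^sup>2 \<le> \<Delta> * (L * v + A)\<^sup>2"
    using assms by (intro mult_right_mono) (auto simp: power2_eq_square mult_left_le)
  ultimately have 2: "\<Delta>\<^sup>2 * (L * v + A)\<^sup>2 \<le> \<Delta> * (L\<^sup>2 * v\<^sup>2 + L * (v\<^sup>2 + A\<^sup>2) + A\<^sup>2)"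
    using mult_left_mono[OF _ assms(4)] by (meson order_trans)
  have "(v + \<Delta> * (L * v + A))\<^sup>2 = v\<^sup>2 + \<Delta> * (v * (L * v + A) * 2) + \<Delta>\<^sup>2 * (L * v + A)\<^sup>2"
    by (simp add: power2_eq_square algebra_simps)
  also have "\<dots> \<le> v\<^sup>2 + \<Delta> * ((2 * L + 1) * v\<^sup>2 + A\<^sup>2) + \<Delta> * (L\<^sup>2 * v\<^sup>2 + L * (v\<^sup>2 + A\<^sup>2) + A\<^sup>2)"
    by (intro add_mono order_refl mult_left_mono[OF 1 assms(4)] 2)
  also have "\<dots> = v\<^sup>2 + \<Delta> * ((1 + 3 * L + L\<^sup>2) * v\<^sup>2 + (2 + L) * A\<^sup>2)"
    by (simp add: algebra_simps)
  also have "\<dots> \<le> v\<^sup>2 + \<Delta> * ((3 * (1 + L)\<^sup>2) * v\<^sup>2 + (3 * (1 + L)\<^sup>2) * A\<^sup>2)"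
    using assms by (intro add_left_mono mult_left_mono add_mono mult_right_mono) (auto simp: power2_sum)
  finally show ?thesis by (simp add: algebra_simps)
qed

context wiener
begin

text \<open>The rate in the Gronwall argument: \<open>3 * (1 + L)\<^sup>2\<close> stems from the
  drift, and \<open>2 * (1 + L)\<^sup>2\<close> from the noise for each of the dimensions of the
  Brownian motion.\<close>

definition growth_rate :: "real \<Rightarrow> real" where
  "growth_rate L = (3 + 2 * real CARD('d)) * (1 + L)\<^sup>2"

lemma growth_rate_pos: "0 \<le> L \<Longrightarrow> 0 < growth_rate L"
  unfolding growth_rate_def by (intro mult_pos_pos zero_less_power) auto

lemma integrable_norm_sq_bound:
  fixes U :: "_ \<Rightarrow> 'b::{real_normed_vector, second_countable_topology}" and V :: "_ \<Rightarrow> 'c::real_normed_vector"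
  assumes U: "U \<in> borel_measurable M" and V: "integrable M (\<lambda>\<omega>. (norm (V \<omega>))\<^sup>2)"
    and le: "\<And>\<omega>. norm (U \<omega>) \<le> K * norm (V \<omega>) + A"
  shows "integrable M (\<lambda>\<omega>. (norm (U \<omega>))\<^sup>2)"
proof (rule Bochner_Integration.integrable_bound)
  show "integrable M (\<lambda>\<omega>. 2 * (K\<^sup>2 * (norm (V \<omega>))\<^sup>2) + 2 * A\<^sup>2)"
    using V by (intro Bochner_Integration.integrable_add integrable_mult_right) auto
  show "(\<lambda>\<omega>. (norm (U \<omega>))\<^sup>2) \<in> borel_measurable M"
    using U by measurable
  show "AE \<omega> in M. norm ((norm (U \<omega>))\<^sup>2) \<le> norm (2 * (K\<^sup>2 * (norm (V \<omega>))\<^sup>2) + 2 * A\<^sup>2)"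
  proof (rule AE_I2)
    fix \<omega>
    have "(norm (U \<omega>))\<^sup>2 \<le> (K * norm (V \<omega>) + A)\<^sup>2" by (rule power_mono[OF le norm_ge_zero])
    also have "\<dots> \<le> 2 * (K * norm (V \<omega>))\<^sup>2 + 2 * A\<^sup>2" by (rule power2_add_le)
    finally show "norm ((norm (U \<omega>))\<^sup>2) \<le> norm (2 * (K\<^sup>2 * (norm (V \<omega>))\<^sup>2) + 2 * A\<^sup>2)"
      by (simp add: power_mult_distrib)
  qed
qed

text \<open>A discrete Gronwall inequality: a step of length \<Delta> multiplies the second moment
  by at most \<open>1 + c * \<Delta>\<close> and adds at most
  \<open>c * \<Delta> * A\<^sup>2\<close>, where c is the growth rate. The general recursion covers
  the difference of two schemes, the displacement of one scheme, and the truncated error against the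
  solution.\<close>

lemma recursion_second_moment:
  fixes V a :: "nat \<Rightarrow> (real \<Rightarrow> real^'d) \<Rightarrow> real^'n" and b :: "nat \<Rightarrow> (real \<Rightarrow> real^'d) \<Rightarrow> real^'d^'n"
  assumes \<tau>: "fine_partition 1 m \<tau>"
    and V0: "\<And>\<omega>. V 0 \<omega> = v"
    and V: "\<And>p \<omega>. p < m \<Longrightarrow> V (Suc p) \<omega> = V p \<omega> + (\<tau> (Suc p) - \<tau> p) *\<^sub>R a p \<omega> + b p \<omega> *v (\<omega> (\<tau> (Suc p)) - \<omega> (\<tau> p))"
    and meas: "\<And>p. p \<le> m \<Longrightarrow> V p \<in> borel_measurable (F (\<tau> p))"
      "\<And>p. p < m \<Longrightarrow> a p \<in> borel_measurable (F (\<tau> p))" "\<And>p. p < m \<Longrightarrow> b p \<in> borel_measurable (F (\<tau> p))"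
    and a: "\<And>p \<omega>. p < m \<Longrightarrow> norm (a p \<omega>) \<le> L * norm (V p \<omega>) + A"
    and b: "\<And>p \<omega>. p < m \<Longrightarrow> norm (b p \<omega>) \<le> L * norm (V p \<omega>) + A"
    and LA: "0 \<le> L" "0 \<le> A" and p: "p \<le> m"
  shows "integrable M (\<lambda>\<omega>. (norm (V p \<omega>))\<^sup>2)"
    and "expectation (\<lambda>\<omega>. (norm (V p \<omega>))\<^sup>2) \<le> exp (growth_rate L * \<tau> p) * ((norm v)\<^sup>2 + growth_rate L * \<tau> p * A\<^sup>2)"
proof -
  note \<tau>D = fine_partitionD[OF \<tau>]
  let ?c = "growth_rate L"
  have c: "0 < ?c" by (rule growth_rate_pos[OF LA(1)])
  have "integrable M (\<lambda>\<omega>. (norm (V p \<omega>))\<^sup>2) \<and>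
      expectation (\<lambda>\<omega>. (norm (V p \<omega>))\<^sup>2) \<le> exp (?c * \<tau> p) * ((norm v)\<^sup>2 + ?c * \<tau> p * A\<^sup>2)"
    using p
  proof (induction p)
    case 0
    have "measure P (space P) = 1" by (rule prob_space.prob_space[OF prob_space_P])
    then show ?case by (simp add: V0 \<tau>D(1))
  next
    case (Suc p)
    then have p: "p < m" "p \<le> m" and IH: "integrable M (\<lambda>\<omega>. (norm (V p \<omega>))\<^sup>2)"
      "expectation (\<lambda>\<omega>. (norm (V p \<omega>))\<^sup>2) \<le> exp (?c * \<tau> p) * ((norm v)\<^sup>2 + ?c * \<tau> p * A\<^sup>2)"
      by auto
    let ?\<Delta> = "\<tau> (Suc p) - \<tau> p"
    have \<Delta>: "0 < ?\<Delta>" "?\<Delta> < 1" "0 \<le> ?\<Delta>" "?\<Delta> \<le> 1" using \<tau>D(2,3)[OF p(1)] by auto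
    define U where "U \<omega> = V p \<omega> + ?\<Delta> *\<^sub>R a p \<omega>" for \<omega>
    have U_meas: "U \<in> borel_measurable (F (\<tau> p))"
      unfolding U_def using meas(1)[OF p(2)] meas(2)[OF p(1)] by measurable
    have U_le: "norm (U \<omega>) \<le> norm (V p \<omega>) + ?\<Delta> * (L * norm (V p \<omega>) + A)" for \<omega>
    proof -
      have "norm (U \<omega>) \<le> norm (V p \<omega>) + norm (?\<Delta> *\<^sub>R a p \<omega>)"
        unfolding U_def by (rule norm_triangle_ineq)
      also have "norm (?\<Delta> *\<^sub>R a p \<omega>) \<le> ?\<Delta> * (L * norm (V p \<omega>) + A)"
        using \<Delta> a[OF p(1), of \<omega>] by (simp add: mult_left_mono)
      finally show ?thesis by simp
    qed
    have U_int: "integrable M (\<lambda>\<omega>. (norm (U \<omega>))\<^sup>2)"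
    proof (rule integrable_norm_sq_bound[OF measurable_F_M[OF U_meas] IH(1)])
      show "norm (U \<omega>) \<le> (1 + ?\<Delta> * L) * norm (V p \<omega>) + ?\<Delta> * A" for \<omega>
        using U_le[of \<omega>] by (simp add: algebra_simps)
    qed
    have b_int: "integrable M (\<lambda>\<omega>. (norm (b p \<omega>))\<^sup>2)"
      by (rule integrable_norm_sq_bound[OF measurable_F_M[OF meas(3)[OF p(1)]] IH(1) b[OF p(1)]])
    note step = step_second_moment[OF \<tau>D(5)[OF p(2)] \<tau>D(2)[OF p(1)] U_meas U_int meas(3)[OF p(1)] b_int]
    have V_eq: "V (Suc p) \<omega> = U \<omega> + b p \<omega> *v (\<omega> (\<tau> (Suc p)) - \<omega> (\<tau> p))" for \<omega>
      unfolding V[OF p(1)] U_def by simp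
    let ?E = "expectation (\<lambda>\<omega>. (norm (V p \<omega>))\<^sup>2)"
    have prob1: "expectation (\<lambda>_. x) = x" for x :: real
      using prob_space.prob_space[OF prob_space_P] by simp
    have EU: "expectation (\<lambda>\<omega>. (norm (U \<omega>))\<^sup>2) \<le> ?E + ?\<Delta> * 3 * (1 + L)\<^sup>2 * (?E + A\<^sup>2)"
    proof -
      have "expectation (\<lambda>\<omega>. (norm (U \<omega>))\<^sup>2)
          \<le> expectation (\<lambda>\<omega>. (norm (V p \<omega>))\<^sup>2 + ?\<Delta> * 3 * (1 + L)\<^sup>2 * ((norm (V p \<omega>))\<^sup>2 + A\<^sup>2))"
      proof (rule integral_mono[OF U_int])
        show "(norm (U \<omega>))\<^sup>2 \<le> (norm (V p \<omega>))\<^sup>2 + ?\<Delta> * 3 * (1 + L)\<^sup>2 * ((norm (V p \<omega>))\<^sup>2 + A\<^sup>2)" for \<omega>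
          by (rule order_trans[OF power_mono[OF U_le norm_ge_zero] quadratic_step_bound])
            (use \<Delta> LA in auto)
      qed (use IH in auto)
      also have "\<dots> = ?E + ?\<Delta> * 3 * (1 + L)\<^sup>2 * (?E + A\<^sup>2)"
        using IH(1) prob1[of "A\<^sup>2"] by simp
      finally show ?thesis .
    qed
    have Eb: "expectation (\<lambda>\<omega>. (norm (b p \<omega>))\<^sup>2) \<le> 2 * (1 + L)\<^sup>2 * (?E + A\<^sup>2)"
    proof -
      have "expectation (\<lambda>\<omega>. (norm (b p \<omega>))\<^sup>2) \<le> expectation (\<lambda>\<omega>. 2 * (1 + L)\<^sup>2 * ((norm (V p \<omega>))\<^sup>2 + A\<^sup>2))"
      proof (rule integral_mono[OF b_int])
        fix \<omega>
        have "(norm (b p \<omega>))\<^sup>2 \<le> (L * norm (V p \<omega>) + A)\<^sup>2"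
          by (rule power_mono[OF b[OF p(1)] norm_ge_zero])
        also have "\<dots> \<le> 2 * (L * norm (V p \<omega>))\<^sup>2 + 2 * A\<^sup>2" by (rule power2_add_le)
        also have "\<dots> = 2 * L\<^sup>2 * (norm (V p \<omega>))\<^sup>2 + 2 * 1 * A\<^sup>2" by (simp add: power_mult_distrib)
        also have "\<dots> \<le> 2 * (1 + L)\<^sup>2 * (norm (V p \<omega>))\<^sup>2 + 2 * (1 + L)\<^sup>2 * A\<^sup>2"
          using LA by (intro add_mono mult_right_mono mult_left_mono) (auto simp: power2_sum)
        finally show "(norm (b p \<omega>))\<^sup>2 \<le> 2 * (1 + L)\<^sup>2 * ((norm (V p \<omega>))\<^sup>2 + A\<^sup>2)"
          by (simp add: algebra_simps)
      qed (use IH in auto)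
      also have "\<dots> = 2 * (1 + L)\<^sup>2 * (?E + A\<^sup>2)"
        using IH(1) prob1[of "A\<^sup>2"] by simp
      finally show ?thesis .
    qed
    have "expectation (\<lambda>\<omega>. (norm (V (Suc p) \<omega>))\<^sup>2)
        \<le> expectation (\<lambda>\<omega>. (norm (U \<omega>))\<^sup>2) + CARD('d) * ?\<Delta> * expectation (\<lambda>\<omega>. (norm (b p \<omega>))\<^sup>2)"
      using step(2) unfolding V_eq .
    also have "\<dots> \<le> (?E + ?\<Delta> * 3 * (1 + L)\<^sup>2 * (?E + A\<^sup>2)) + CARD('d) * ?\<Delta> * (2 * (1 + L)\<^sup>2 * (?E + A\<^sup>2))"
      using \<Delta> by (intro add_mono EU mult_left_mono Eb) auto
    also have "\<dots> = (1 + ?c * ?\<Delta>) * ?E + ?c * ?\<Delta> * A\<^sup>2"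
      unfolding growth_rate_def by (simp add: algebra_simps)
    \<comment> \<open>The inhomogeneous term is enlarged by an exponential factor, which is at least
      1, so that it combines with the propagated bound into the same closed form.\<close>
    also have "\<dots> \<le> exp (?c * ?\<Delta>) * (exp (?c * \<tau> p) * ((norm v)\<^sup>2 + ?c * \<tau> p * A\<^sup>2))
        + exp (?c * \<tau> (Suc p)) * (?c * ?\<Delta> * A\<^sup>2)"
    proof (rule add_mono)
      show "(1 + ?c * ?\<Delta>) * ?E \<le> exp (?c * ?\<Delta>) * (exp (?c * \<tau> p) * ((norm v)\<^sup>2 + ?c * \<tau> p * A\<^sup>2))"
        using IH(2) exp_ge_add_one_self[of "?c * ?\<Delta>"] c \<Delta> by (intro mult_mono) auto
      have "1 * (?c * ?\<Delta> * A\<^sup>2) \<le> exp (?c * \<tau> (Suc p)) * (?c * ?\<Delta> * A\<^sup>2)"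
        using c \<Delta> \<tau>D(5)[of "Suc p"] p by (intro mult_right_mono) auto
      then show "?c * ?\<Delta> * A\<^sup>2 \<le> exp (?c * \<tau> (Suc p)) * (?c * ?\<Delta> * A\<^sup>2)" by simp
    qed
    also have "\<dots> = exp (?c * \<tau> (Suc p)) * ((norm v)\<^sup>2 + ?c * \<tau> (Suc p) * A\<^sup>2)"
    proof -
      have "exp (?c * ?\<Delta>) * exp (?c * \<tau> p) = exp (?c * \<tau> (Suc p))"
        unfolding exp_add[symmetric] by (simp add: algebra_simps)
      then have "exp (?c * ?\<Delta>) * (exp (?c * \<tau> p) * ((norm v)\<^sup>2 + ?c * \<tau> p * A\<^sup>2))
          = exp (?c * \<tau> (Suc p)) * ((norm v)\<^sup>2 + ?c * \<tau> p * A\<^sup>2)"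
        by (simp only: mult.assoc[symmetric])
      then show ?thesis by (simp add: algebra_simps)
    qed
    finally show ?case using step(1) unfolding V_eq by simp
  qed
  then show "integrable M (\<lambda>\<omega>. (norm (V p \<omega>))\<^sup>2)"
    and "expectation (\<lambda>\<omega>. (norm (V p \<omega>))\<^sup>2) \<le> exp (growth_rate L * \<tau> p) * ((norm v)\<^sup>2 + growth_rate L * \<tau> p * A\<^sup>2)"
    by auto
qed

end

lemma borel_measurable_fst: "fst \<in> borel_measurable borel"
  by (intro borel_measurable_continuous_onI continuous_intros)

lemma borel_measurable_snd: "snd \<in> borel_measurable borel"
  by (intro borel_measurable_continuous_onI continuous_intros)

section \<open>Averaging over an independent increment\<close>

context wiener
begin

lemma integrable_bounded:
  fixes X :: "_ \<Rightarrow> real"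
  assumes "X \<in> borel_measurable M" "\<And>\<omega>. \<bar>X \<omega>\<bar> \<le> B"
  shows "integrable M X"
  using assms by (intro integrable_const_bound[where B = B]) auto

lemma expectation_const: "expectation (\<lambda>_. x :: real) = x"
  using prob_space.prob_space[OF prob_space_P] by simp

text \<open>Independence turns the joint law into a product, Fubini's theorem integrates the
  increment first, and stationarity replaces it by the path value at \<open>t - s\<close>.\<close>

lemma expectation_of_increment:
  fixes \<Phi> :: "(real^'n) \<times> (real^'d) \<Rightarrow> real"
  assumes st: "0 \<le> s" "s < t" and e: "e \<in> borel_measurable (F s)"
    and \<Phi>: "\<Phi> \<in> borel_measurable borel" "\<And>z. \<bar>\<Phi> z\<bar> \<le> B"
  shows "expectation (\<lambda>\<omega>. \<Phi> (e \<omega>, \<omega> t - \<omega> s)) = expectation (\<lambda>\<omega>. expectation (\<lambda>\<omega>'. \<Phi> (e \<omega>, \<omega>' (t - s))))"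
proof -
  let ?W = "\<lambda>\<omega> :: real \<Rightarrow> real^'d. \<omega> t - \<omega> s"
  \<comment> \<open>\<open>indep_var\<close> wants both variables in one type, so each is padded
    with a zero into the product space.\<close>
  define X where "X \<omega> = (e \<omega>, 0 :: real^'d)" for \<omega>
  define Y where "Y \<omega> = (0 :: real^'n, ?W \<omega>)" for \<omega>
  define \<Psi> :: "((real^'n) \<times> (real^'d)) \<times> ((real^'n) \<times> (real^'d)) \<Rightarrow> real"
    where "\<Psi> = (\<lambda>(z1, z2). \<Phi> (fst z1, snd z2))"
  have X_F: "X \<in> borel_measurable (F s)" unfolding X_def using e by measurable
  have X_M: "X \<in> borel_measurable M" by (rule measurable_F_M[OF X_F])
  have W_M: "?W \<in> borel_measurable M"
    using st by (intro borel_measurable_diff measurable_coord_M) auto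
  have Y_M: "Y \<in> borel_measurable M" unfolding Y_def using W_M by measurable
  have \<phi>: "(\<lambda>w :: real^'d. (0 :: real^'n, w)) \<in> borel_measurable borel" by measurable
  have "indep_var borel X borel Y"
    unfolding Y_def by (rule indep_var_filtration_increment[OF st X_F \<phi>])
  then have distr_eq: "distr M borel X \<Otimes>\<^sub>M distr M borel Y = distr M (borel \<Otimes>\<^sub>M borel) (\<lambda>\<omega>. (X \<omega>, Y \<omega>))"
    unfolding indep_var_distribution_eq by blast
  interpret DX: prob_space "distr M borel X" by (rule prob_space_distr[OF X_M])
  interpret DY: prob_space "distr M borel Y" by (rule prob_space_distr[OF Y_M])
  interpret DXY: pair_prob_space "distr M borel X" "distr M borel Y" ..
  have "(\<lambda>z :: ((real^'n) \<times> (real^'d)) \<times> ((real^'n) \<times> (real^'d)). (fst (fst z), snd (snd z))) \<in> borel_measurable (borel \<Otimes>\<^sub>M borel)"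
    unfolding borel_prod by (intro borel_measurable_continuous_onI continuous_intros)
  then have \<Psi>_meas: "\<Psi> \<in> borel_measurable (borel \<Otimes>\<^sub>M borel)"
    unfolding \<Psi>_def split_beta by (rule measurable_compose[OF _ \<Phi>(1)])
  have \<Psi>_meas': "\<Psi> \<in> borel_measurable (distr M borel X \<Otimes>\<^sub>M distr M borel Y)"
    using \<Psi>_meas by (simp cong: measurable_cong_sets sets_pair_measure_cong)
  have \<Psi>_bound: "\<bar>\<Psi> z\<bar> \<le> B" for z unfolding \<Psi>_def split_beta by (rule \<Phi>(2))
  have \<Psi>_int: "integrable (distr M borel X \<Otimes>\<^sub>M distr M borel Y) \<Psi>"
    by (rule DXY.integrable_const_bound[where B = B]) (use \<Psi>_meas' \<Psi>_bound in auto)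
  have XY_M: "(\<lambda>\<omega>. (X \<omega>, Y \<omega>)) \<in> measurable M (borel \<Otimes>\<^sub>M borel)"
    using X_M Y_M by measurable
  have inner: "(\<integral>y. \<Psi> (X \<omega>, y) \<partial>distr M borel Y) = expectation (\<lambda>\<omega>'. \<Phi> (e \<omega>, \<omega>' (t - s)))" for \<omega>
  proof -
    have m1: "(\<lambda>y. \<Psi> (X \<omega>, y)) \<in> borel_measurable borel"
      by (rule measurable_compose[OF _ \<Psi>_meas]) measurable
    have m2: "(\<lambda>w. \<Phi> (e \<omega>, w)) \<in> borel_measurable borel"
      by (rule measurable_compose[OF _ \<Phi>(1)]) measurable
    have "(\<integral>y. \<Psi> (X \<omega>, y) \<partial>distr M borel Y) = expectation (\<lambda>\<omega>'. \<Phi> (e \<omega>, ?W \<omega>'))"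
      by (subst integral_distr[OF Y_M m1]) (simp add: \<Psi>_def X_def Y_def)
    also have "\<dots> = (\<integral>w. \<Phi> (e \<omega>, w) \<partial>distr M borel ?W)"
      by (rule integral_distr[OF W_M m2, symmetric])
    also have "\<dots> = (\<integral>w. \<Phi> (e \<omega>, w) \<partial>distr M borel (\<lambda>\<omega>. \<omega> (t - s)))"
      unfolding distr_increment_stationary[OF st] ..
    also have "\<dots> = expectation (\<lambda>\<omega>'. \<Phi> (e \<omega>, \<omega>' (t - s)))"
      by (rule integral_distr[OF measurable_coord_M m2]) (use st in simp)
    finally show ?thesis .
  qed
  have "expectation (\<lambda>\<omega>. \<Phi> (e \<omega>, ?W \<omega>)) = expectation (\<lambda>\<omega>. \<Psi> (X \<omega>, Y \<omega>))"
    by (simp add: \<Psi>_def X_def Y_def)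
  also have "\<dots> = (\<integral>z. \<Psi> z \<partial>(distr M borel X \<Otimes>\<^sub>M distr M borel Y))"
    unfolding distr_eq by (rule integral_distr[OF XY_M \<Psi>_meas, symmetric])
  also have "\<dots> = (\<integral>x. (\<integral>y. \<Psi> (x, y) \<partial>distr M borel Y) \<partial>distr M borel X)"
    by (rule DXY.integral_fst'[OF \<Psi>_int, symmetric])
  also have "\<dots> = expectation (\<lambda>\<omega>. (\<integral>y. \<Psi> (X \<omega>, y) \<partial>distr M borel Y))"
  proof (rule integral_distr[OF X_M])
    have "(\<lambda>x. \<integral>y. \<Psi> (x, y) \<partial>distr M borel Y) \<in> borel_measurable (distr M borel X)"
      by (rule DY.borel_measurable_lebesgue_integral) (use \<Psi>_meas' in simp)
    then show "(\<lambda>x. \<integral>y. \<Psi> (x, y) \<partial>distr M borel Y) \<in> borel_measurable borel" by simp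
  qed
  also have "\<dots> = expectation (\<lambda>\<omega>. expectation (\<lambda>\<omega>'. \<Phi> (e \<omega>, \<omega>' (t - s))))"
    by (simp add: inner)
  finally show ?thesis .
qed

lemma measurable_expectation_coord:
  fixes \<Phi> :: "(real^'n) \<times> (real^'d) \<Rightarrow> real"
  assumes r: "0 \<le> r" and \<Phi>: "\<Phi> \<in> borel_measurable borel"
  shows "(\<lambda>x. expectation (\<lambda>\<omega>. \<Phi> (x, \<omega> r))) \<in> borel_measurable borel"
proof (rule borel_measurable_lebesgue_integral)
  have "(\<lambda>z :: (real^'n) \<times> (real \<Rightarrow> real^'d). (fst z, snd z r)) \<in> borel_measurable (borel \<Otimes>\<^sub>M M)"
    by (intro borel_measurable_Pair measurable_fst measurable_compose[OF measurable_snd measurable_coord_M[OF r]])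
  then show "(\<lambda>(x, \<omega>). \<Phi> (x, \<omega> r)) \<in> borel_measurable (borel \<Otimes>\<^sub>M M)"
    unfolding split_beta by (rule measurable_compose[OF _ \<Phi>])
qed

end

section \<open>Stability of the scheme and its one-step operator\<close>

locale lipschitz_coefficients = wiener P for P :: "(real \<Rightarrow> real^'d) measure" +
  fixes f :: "real^'n \<Rightarrow> real^'n" and g :: "real^'n \<Rightarrow> real^'d^'n" and L :: real
  assumes L_nonneg: "0 \<le> L"
    and f_lipschitz: "norm (f x - f y) \<le> L * norm (x - y)"
    and g_lipschitz: "norm (g x - g y) \<le> L * norm (x - y)"
begin

lemma f_continuous: "continuous_on A f"
  by (rule lipschitz_on_continuous_on[of L]) (use f_lipschitz L_nonneg in \<open>auto intro!: lipschitz_onI simp: dist_norm\<close>)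

lemma g_continuous: "continuous_on A g"
  by (rule lipschitz_on_continuous_on[of L]) (use g_lipschitz L_nonneg in \<open>auto intro!: lipschitz_onI simp: dist_norm\<close>)

lemma f_measurable: "f \<in> borel_measurable borel"
  by (rule borel_measurable_continuous_onI[OF f_continuous])

lemma g_measurable: "g \<in> borel_measurable borel"
  by (rule borel_measurable_continuous_onI[OF g_continuous])

lemma euler_step_measurable:
  assumes "X \<in> borel_measurable N" "W \<in> borel_measurable N"
  shows "(\<lambda>\<omega>. euler_step f g \<delta> (X \<omega>) (W \<omega>)) \<in> borel_measurable N"
  unfolding euler_step_def
  by (intro borel_measurable_add borel_measurable_scaleR borel_measurable_const assms(1)
      measurable_compose[OF assms(1) f_measurable]
      borel_measurable_matrix_vector_mult[OF measurable_compose[OF assms(1) g_measurable] assms(2)])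

lemma euler_measurable:
  assumes \<tau>: "fine_partition d m \<tau>" and p: "p \<le> m"
  shows "euler f g \<tau> x p \<in> borel_measurable (F (\<tau> p))"
  using p
proof (induction p)
  case 0
  have "euler f g \<tau> x 0 = (\<lambda>_. x)" by (rule ext) simp
  then show ?case by simp
next
  case (Suc p)
  note \<tau>D = fine_partitionD[OF \<tau>]
  have "euler f g \<tau> x p \<in> borel_measurable (F (\<tau> (Suc p)))"
    by (rule measurable_F_mono[of _ "\<tau> p"]) (use Suc \<tau>D(2)[of p] in auto)
  moreover have "(\<lambda>\<omega>. \<omega> (\<tau> (Suc p)) - \<omega> (\<tau> p)) \<in> borel_measurable (F (\<tau> (Suc p)))"
    using Suc \<tau>D(5) \<tau>D(2)[of p] by (intro borel_measurable_diff measurable_coord_F) auto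
  ultimately show ?case
    unfolding euler.simps by (rule euler_step_measurable)
qed

text \<open>Both schemes are driven by the same increments, so their difference satisfies the
  general recursion, and the Lipschitz bounds leave no inhomogeneous term.\<close>

lemma euler_contraction:
  assumes \<tau>: "fine_partition 1 m \<tau>" and p: "p \<le> m"
  shows "integrable M (\<lambda>\<omega>. (norm (euler f g \<tau> x p \<omega> - euler f g \<tau> y p \<omega>))\<^sup>2)"
    and "expectation (\<lambda>\<omega>. (norm (euler f g \<tau> x p \<omega> - euler f g \<tau> y p \<omega>))\<^sup>2)
      \<le> exp (growth_rate L * \<tau> p) * (norm (x - y))\<^sup>2"
proof -
  let ?e = "euler f g \<tau> x" and ?e' = "euler f g \<tau> y"
  have 1: "norm (f (?e q \<omega>) - f (?e' q \<omega>)) \<le> L * norm (?e q \<omega> - ?e' q \<omega>) + 0"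
    "norm (g (?e q \<omega>) - g (?e' q \<omega>)) \<le> L * norm (?e q \<omega> - ?e' q \<omega>) + 0" for q \<omega>
    using f_lipschitz g_lipschitz by auto
  have em: "?e q \<in> borel_measurable (F (\<tau> q))" "?e' q \<in> borel_measurable (F (\<tau> q))" if "q \<le> m" for q
    by (rule euler_measurable[OF \<tau> that])+
  have m: "(\<lambda>\<omega>. ?e q \<omega> - ?e' q \<omega>) \<in> borel_measurable (F (\<tau> q))"
      "(\<lambda>\<omega>. f (?e q \<omega>) - f (?e' q \<omega>)) \<in> borel_measurable (F (\<tau> q))"
      "(\<lambda>\<omega>. g (?e q \<omega>) - g (?e' q \<omega>)) \<in> borel_measurable (F (\<tau> q))" if "q \<le> m" for q
    by (intro borel_measurable_diff em[OF that] measurable_compose[OF em(1)[OF that]]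
        measurable_compose[OF em(2)[OF that]] f_measurable g_measurable)+
  have rec: "?e (Suc q) \<omega> - ?e' (Suc q) \<omega> = (?e q \<omega> - ?e' q \<omega>) + (\<tau> (Suc q) - \<tau> q) *\<^sub>R (f (?e q \<omega>) - f (?e' q \<omega>))
      + (g (?e q \<omega>) - g (?e' q \<omega>)) *v (\<omega> (\<tau> (Suc q)) - \<omega> (\<tau> q))" for q \<omega>
    by (simp add: euler_step_def matrix_vector_mult_diff_rdistrib scaleR_diff_right)
  note R = recursion_second_moment[OF \<tau>, where V = "\<lambda>p \<omega>. ?e p \<omega> - ?e' p \<omega>" and a = "\<lambda>p \<omega>. f (?e p \<omega>) - f (?e' p \<omega>)"
      and b = "\<lambda>p \<omega>. g (?e p \<omega>) - g (?e' p \<omega>)" and v = "x - y" and L = L and A = 0, OF _ rec m 1 L_nonneg order_refl p]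
  show "integrable M (\<lambda>\<omega>. (norm (?e p \<omega> - ?e' p \<omega>))\<^sup>2)"
    by (rule R(1)) simp_all
  show "expectation (\<lambda>\<omega>. (norm (?e p \<omega> - ?e' p \<omega>))\<^sup>2) \<le> exp (growth_rate L * \<tau> p) * (norm (x - y))\<^sup>2"
    using R(2) by simp
qed

text \<open>The recursion for the displacement starts at 0 and is fed only by the coefficients at
  the starting point; the bound is therefore proportional to the elapsed time.\<close>

lemma euler_displacement:
  assumes \<tau>: "fine_partition 1 m \<tau>" and p: "p \<le> m"
  shows "integrable M (\<lambda>\<omega>. (norm (euler f g \<tau> x p \<omega> - x))\<^sup>2)"
    and "expectation (\<lambda>\<omega>. (norm (euler f g \<tau> x p \<omega> - x))\<^sup>2)
      \<le> exp (growth_rate L * \<tau> p) * (growth_rate L * \<tau> p * (norm (f x) + norm (g x))\<^sup>2)"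
proof -
  let ?e = "euler f g \<tau> x" and ?A = "norm (f x) + norm (g x)"
  have 1: "norm (f (?e q \<omega>)) \<le> L * norm (?e q \<omega> - x) + ?A"
    "norm (g (?e q \<omega>)) \<le> L * norm (?e q \<omega> - x) + ?A" for q \<omega>
    using f_lipschitz[of "?e q \<omega>" x] g_lipschitz[of "?e q \<omega>" x] norm_ge_zero[of "f x"] norm_ge_zero[of "g x"]
      norm_triangle_sub[of "f (?e q \<omega>)" "f x"] norm_triangle_sub[of "g (?e q \<omega>)" "g x"] by linarith+
  have em: "?e q \<in> borel_measurable (F (\<tau> q))" if "q \<le> m" for q
    by (rule euler_measurable[OF \<tau> that])+
  have m: "(\<lambda>\<omega>. ?e q \<omega> - x) \<in> borel_measurable (F (\<tau> q))"
      "(\<lambda>\<omega>. f (?e q \<omega>)) \<in> borel_measurable (F (\<tau> q))"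
      "(\<lambda>\<omega>. g (?e q \<omega>)) \<in> borel_measurable (F (\<tau> q))" if "q \<le> m" for q
    by (intro borel_measurable_diff borel_measurable_const em[OF that] measurable_compose[OF em[OF that]]
        f_measurable g_measurable)+
  have rec: "?e (Suc q) \<omega> - x = (?e q \<omega> - x) + (\<tau> (Suc q) - \<tau> q) *\<^sub>R f (?e q \<omega>)
      + g (?e q \<omega>) *v (\<omega> (\<tau> (Suc q)) - \<omega> (\<tau> q))" for q \<omega>
    by (simp add: euler_step_def)
  note R = recursion_second_moment[OF \<tau>, where V = "\<lambda>p \<omega>. ?e p \<omega> - x" and a = "\<lambda>p \<omega>. f (?e p \<omega>)"
      and b = "\<lambda>p \<omega>. g (?e p \<omega>)" and v = 0 and L = L and A = ?A, OF _ rec m 1 L_nonneg _ p]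
  show "integrable M (\<lambda>\<omega>. (norm (?e p \<omega> - x))\<^sup>2)"
    by (rule R(1)) simp_all
  show "expectation (\<lambda>\<omega>. (norm (?e p \<omega> - x))\<^sup>2) \<le> exp (growth_rate L * \<tau> p) * (growth_rate L * \<tau> p * ?A\<^sup>2)"
    using R(2) by simp
qed

text \<open>Since paths start at 0, the path value at time \<delta> serves as a Brownian increment
  over a time of length \<delta>.\<close>

definition euler_op :: "real \<Rightarrow> (real^'n \<Rightarrow> real) \<Rightarrow> real^'n \<Rightarrow> real" where
  "euler_op \<delta> h x = expectation (\<lambda>\<omega>. h (euler_step f g \<delta> x (\<omega> \<delta>)))"

lemma euler_op_bounded_measurable:
  assumes \<delta>: "0 \<le> \<delta>" and h: "h \<in> borel_measurable borel" "\<And>x. \<bar>h x\<bar> \<le> B"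
  shows "euler_op \<delta> h \<in> borel_measurable borel" "\<bar>euler_op \<delta> h x\<bar> \<le> B"
proof -
  have "(\<lambda>z. h (euler_step f g \<delta> (fst z) (snd z))) \<in> borel_measurable borel"
    by (intro measurable_compose[OF euler_step_measurable h(1)] borel_measurable_fst borel_measurable_snd)
  from measurable_expectation_coord[OF \<delta> this]
  show "euler_op \<delta> h \<in> borel_measurable borel"
    unfolding euler_op_def[abs_def] by simp
  have "\<bar>euler_op \<delta> h x\<bar> \<le> expectation (\<lambda>\<omega>. \<bar>h (euler_step f g \<delta> x (\<omega> \<delta>))\<bar>)"
    unfolding euler_op_def by (rule integral_abs_bound)
  also have "\<dots> \<le> expectation (\<lambda>_. B)"
  proof (rule integral_mono)
    have "(\<lambda>\<omega>. h (euler_step f g \<delta> x (\<omega> \<delta>))) \<in> borel_measurable M"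
      by (intro measurable_compose[OF euler_step_measurable h(1)] borel_measurable_const measurable_coord_M \<delta>)
    then show "integrable M (\<lambda>\<omega>. \<bar>h (euler_step f g \<delta> x (\<omega> \<delta>))\<bar>)"
      by (intro integrable_abs integrable_bounded[where B = B] h(2))
  qed (use h(2) in auto)
  also have "\<dots> = B" by (rule expectation_const)
  finally show "\<bar>euler_op \<delta> h x\<bar> \<le> B" .
qed

text \<open>The Markov property of the scheme: the position at node p is known at
  \<open>\<tau> p\<close>, and the next increment is independent of it with the law used in
  \<open>euler_op\<close>.\<close>

lemma expectation_euler_Suc:
  assumes \<tau>: "fine_partition d m \<tau>" and p: "p < m"
    and h: "h \<in> borel_measurable borel" "\<And>x. \<bar>h x\<bar> \<le> B"
  shows "expectation (\<lambda>\<omega>. h (euler f g \<tau> x (Suc p) \<omega>))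
    = expectation (\<lambda>\<omega>. euler_op (\<tau> (Suc p) - \<tau> p) h (euler f g \<tau> x p \<omega>))"
proof -
  note \<tau>D = fine_partitionD[OF \<tau>]
  let ?\<Delta> = "\<tau> (Suc p) - \<tau> p"
  have m: "(\<lambda>z. h (euler_step f g ?\<Delta> (fst z) (snd z))) \<in> borel_measurable borel"
    by (intro measurable_compose[OF euler_step_measurable h(1)] borel_measurable_fst borel_measurable_snd)
  have \<tau>p: "0 \<le> \<tau> p" using \<tau>D(5) p by simp
  have e: "euler f g \<tau> x p \<in> borel_measurable (F (\<tau> p))" by (rule euler_measurable[OF \<tau>]) (use p in simp)
  show ?thesis
    using expectation_of_increment[OF \<tau>p \<tau>D(2)[OF p] e m h(2)] unfolding euler_op_def by simp
qed

end

section \<open>Errors that vanish with the mesh\<close>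

context wiener
begin

lemma mesh_negligible_sum:
  fixes E :: "'k::finite \<Rightarrow> _"
  assumes E: "\<And>k. mesh_negligible T (E k)"
  shows "mesh_negligible T (\<lambda>\<tau> p \<omega>. \<Sum>k\<in>UNIV. \<bar>E k \<tau> p \<omega>\<bar>)"
  unfolding mesh_negligible_def
proof (intro allI impI)
  fix \<epsilon> :: real assume \<epsilon>: "0 < \<epsilon>"
  let ?N = "real CARD('k)"
  have N: "0 < ?N" by simp
  have e: "0 < \<epsilon> / ?N" using \<epsilon> by simp
  have "\<exists>d>0. \<forall>m \<tau>. fine_partition d m \<tau> \<longrightarrow> \<tau> m \<le> T \<longrightarrow>
     (\<exists>B\<in>sets M. prob B < \<epsilon> / ?N \<and> (\<forall>\<omega>\<in>space M - B. \<forall>p\<le>m. \<bar>E k \<tau> p \<omega>\<bar> \<le> \<epsilon> / ?N))" for k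
    by (rule E[unfolded mesh_negligible_def, THEN spec, THEN mp, OF e])
  then have "\<forall>k. \<exists>d. 0 < d \<and> (\<forall>m \<tau>. fine_partition d m \<tau> \<longrightarrow> \<tau> m \<le> T \<longrightarrow>
     (\<exists>B\<in>sets M. prob B < \<epsilon> / ?N \<and> (\<forall>\<omega>\<in>space M - B. \<forall>p\<le>m. \<bar>E k \<tau> p \<omega>\<bar> \<le> \<epsilon> / ?N)))"
    by (rule allI)
  then obtain D where D: "\<forall>k. 0 < D k \<and> (\<forall>m \<tau>. fine_partition (D k) m \<tau> \<longrightarrow> \<tau> m \<le> T \<longrightarrow>
     (\<exists>B\<in>sets M. prob B < \<epsilon> / ?N \<and> (\<forall>\<omega>\<in>space M - B. \<forall>p\<le>m. \<bar>E k \<tau> p \<omega>\<bar> \<le> \<epsilon> / ?N)))"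
    by (drule_tac choice) (elim exE, rule that)
  let ?d = "Min (range D)"
  have d: "0 < ?d" "\<And>k. ?d \<le> D k" using D by auto
  show "\<exists>d>0. \<forall>m \<tau>. fine_partition d m \<tau> \<longrightarrow> \<tau> m \<le> T \<longrightarrow>
     (\<exists>B\<in>sets M. prob B < \<epsilon> \<and> (\<forall>\<omega>\<in>space M - B. \<forall>p\<le>m. \<bar>\<Sum>k\<in>UNIV. \<bar>E k \<tau> p \<omega>\<bar>\<bar> \<le> \<epsilon>))"
  proof (rule exI[of _ ?d], intro conjI allI impI, rule d(1))
    fix m :: nat and \<tau> assume \<tau>: "fine_partition ?d m \<tau>" "\<tau> m \<le> T"
    have "\<forall>k. \<exists>B. B \<in> sets M \<and> prob B < \<epsilon> / ?N \<and> (\<forall>\<omega>\<in>space M - B. \<forall>p\<le>m. \<bar>E k \<tau> p \<omega>\<bar> \<le> \<epsilon> / ?N)"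
      using D fine_partition_mono[OF \<tau>(1) d(2)] \<tau>(2) by meson
    then obtain B where B: "\<forall>k. B k \<in> sets M \<and> prob (B k) < \<epsilon> / ?N \<and> (\<forall>\<omega>\<in>space M - B k. \<forall>p\<le>m. \<bar>E k \<tau> p \<omega>\<bar> \<le> \<epsilon> / ?N)"
      by (drule_tac choice) (elim exE, rule that)
    show "\<exists>B\<in>sets M. prob B < \<epsilon> \<and> (\<forall>\<omega>\<in>space M - B. \<forall>p\<le>m. \<bar>\<Sum>k\<in>UNIV. \<bar>E k \<tau> p \<omega>\<bar>\<bar> \<le> \<epsilon>)"
    proof (rule bexI[of _ "\<Union>k\<in>UNIV. B k"], intro conjI ballI allI impI)
      have "prob (\<Union>k\<in>UNIV. B k) \<le> (\<Sum>k\<in>UNIV. prob (B k))"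
        by (rule finite_measure_subadditive_finite) (use B in auto)
      also have "\<dots> < (\<Sum>k\<in>(UNIV :: 'k set). \<epsilon> / ?N)"
        by (rule sum_strict_mono) (use B in auto)
      also have "\<dots> = \<epsilon>" by simp
      finally show "prob (\<Union>k\<in>UNIV. B k) < \<epsilon>" .
      show "(\<Union>k\<in>UNIV. B k) \<in> sets M" using B by (intro sets.finite_UN) auto
      fix \<omega> p assume \<omega>: "\<omega> \<in> space M - (\<Union>k\<in>UNIV. B k)" and p: "p \<le> m"
      have "(\<Sum>k\<in>UNIV. \<bar>E k \<tau> p \<omega>\<bar>) \<le> (\<Sum>k\<in>(UNIV :: 'k set). \<epsilon> / ?N)"
        by (rule sum_mono) (use B \<omega> p in blast)
      also have "\<dots> = \<epsilon>" by simp
      finally show "\<bar>\<Sum>k\<in>UNIV. \<bar>E k \<tau> p \<omega>\<bar>\<bar> \<le> \<epsilon>" by simp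
    qed
  qed
qed

text \<open>The almost sure bound covers all partitions at once, so a single null set can be added
  to the exceptional event of every partition.\<close>

lemma mesh_negligible_AE:
  assumes E: "mesh_negligible T E"
    and le: "AE \<omega> in P. \<forall>\<tau> p. (\<forall>q\<le>p. 0 \<le> \<tau> q) \<longrightarrow> \<bar>E' \<tau> p \<omega>\<bar> \<le> \<bar>E \<tau> p \<omega>\<bar>"
  shows "mesh_negligible T E'"
  unfolding mesh_negligible_def
proof (intro allI impI)
  fix \<epsilon> :: real assume \<epsilon>: "0 < \<epsilon>"
  obtain N where N: "\<And>\<omega>. \<omega> \<in> space P - N \<Longrightarrow> \<forall>\<tau> p. (\<forall>q\<le>p. 0 \<le> \<tau> q) \<longrightarrow> \<bar>E' \<tau> p \<omega>\<bar> \<le> \<bar>E \<tau> p \<omega>\<bar>"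
    "N \<in> null_sets P"
    using AE_E3[OF le] by metis
  then have N_M: "N \<in> null_sets M" by (intro null_sets_completionI)
  obtain d where d: "0 < d" "\<And>m \<tau>. fine_partition d m \<tau> \<Longrightarrow> \<tau> m \<le> T \<Longrightarrow>
     \<exists>B\<in>sets M. prob B < \<epsilon> \<and> (\<forall>\<omega>\<in>space M - B. \<forall>p\<le>m. \<bar>E \<tau> p \<omega>\<bar> \<le> \<epsilon>)"
    by (rule mesh_negligibleD[OF E \<epsilon>]) (rule that)
  show "\<exists>d>0. \<forall>m \<tau>. fine_partition d m \<tau> \<longrightarrow> \<tau> m \<le> T \<longrightarrow>
     (\<exists>B\<in>sets M. prob B < \<epsilon> \<and> (\<forall>\<omega>\<in>space M - B. \<forall>p\<le>m. \<bar>E' \<tau> p \<omega>\<bar> \<le> \<epsilon>))"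
  proof (rule exI[of _ d], intro conjI allI impI, rule d(1))
    fix m \<tau> assume \<tau>: "fine_partition d m \<tau>" "\<tau> m \<le> T"
    obtain B where B: "B \<in> sets M" "prob B < \<epsilon>" "\<forall>\<omega>\<in>space M - B. \<forall>p\<le>m. \<bar>E \<tau> p \<omega>\<bar> \<le> \<epsilon>"
      using d(2)[OF \<tau>] by (elim bexE conjE) (rule that)
    show "\<exists>B\<in>sets M. prob B < \<epsilon> \<and> (\<forall>\<omega>\<in>space M - B. \<forall>p\<le>m. \<bar>E' \<tau> p \<omega>\<bar> \<le> \<epsilon>)"
    proof (rule bexI[of _ "B \<union> N"], intro conjI ballI allI impI)
      have "prob (B \<union> N) \<le> prob B + prob N"
        by (rule measure_Un_le) (use B N_M in auto)
      also have "prob N = 0" using N_M by (simp add: null_sets_def measure_def)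
      finally show "prob (B \<union> N) < \<epsilon>" using B(2) by simp
      show "B \<union> N \<in> sets M" using B(1) N_M by auto
      fix \<omega> p assume \<omega>: "\<omega> \<in> space M - (B \<union> N)" and p: "p \<le> m"
      then have "\<omega> \<in> space P - N" by simp
      moreover have "\<forall>q\<le>p. 0 \<le> \<tau> q" using fine_partitionD(5)[OF \<tau>(1)] p by simp
      ultimately have "\<bar>E' \<tau> p \<omega>\<bar> \<le> \<bar>E \<tau> p \<omega>\<bar>" using N(1) by blast
      also have "\<dots> \<le> \<epsilon>" using B(3) \<omega> p by blast
      finally show "\<bar>E' \<tau> p \<omega>\<bar> \<le> \<epsilon>" .
    qed
  qed
qed

text \<open>Off the event supplied by \<open>modulus_of_continuity\<close> the integrand oscillates
  by at most \<eta> on each cell, so the error is at most \<eta> times the elapsed time. Here one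
  event serves all partitions.\<close>

lemma drift_mesh_negligible:
  fixes H :: "real \<Rightarrow> (real \<Rightarrow> real^'d) \<Rightarrow> real"
  assumes H: "\<And>t. 0 \<le> t \<Longrightarrow> H t \<in> borel_measurable (F t)"
    and cont: "AE \<omega> in P. continuous_on {0..} (\<lambda>t. H t \<omega>)" and T: "0 \<le> T"
  shows "mesh_negligible T (\<lambda>\<tau> p \<omega>. (LBINT u:{0..\<tau> p}. H u \<omega>) - (\<Sum>q<p. H (\<tau> q) \<omega> * (\<tau> (Suc q) - \<tau> q)))"
  unfolding mesh_negligible_def
proof (intro allI impI)
  fix \<epsilon> :: real assume \<epsilon>: "0 < \<epsilon>"
  define \<eta> where "\<eta> = \<epsilon> / (T + 1)"
  have \<eta>: "0 < \<eta>" using \<epsilon> T by (simp add: \<eta>_def)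
  obtain d A where d: "0 < d" and A: "A \<in> sets M" "prob A < \<epsilon>"
    and contA: "\<And>\<omega>. \<omega> \<in> space M - A \<Longrightarrow> continuous_on {0..} (\<lambda>t. H t \<omega>)"
    and mod: "\<And>\<omega> s u. \<omega> \<in> space M - A \<Longrightarrow> s \<in> {0..T} \<Longrightarrow> u \<in> {0..T} \<Longrightarrow> \<bar>s - u\<bar> < d \<Longrightarrow> \<bar>H s \<omega> - H u \<omega>\<bar> \<le> \<eta>"
    by (rule modulus_of_continuity[OF measurable_F_M[OF H] cont T \<eta> \<epsilon>]) (assumption, rule that)
  show "\<exists>d>0. \<forall>m \<tau>. fine_partition d m \<tau> \<longrightarrow> \<tau> m \<le> T \<longrightarrow>
     (\<exists>B\<in>sets M. prob B < \<epsilon> \<and> (\<forall>\<omega>\<in>space M - B. \<forall>p\<le>m.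
       \<bar>(LBINT u:{0..\<tau> p}. H u \<omega>) - (\<Sum>q<p. H (\<tau> q) \<omega> * (\<tau> (Suc q) - \<tau> q))\<bar> \<le> \<epsilon>))"
  proof (rule exI[of _ d], intro conjI allI impI, rule d)
    fix m :: nat and \<tau> assume \<tau>: "fine_partition d m \<tau>" "\<tau> m \<le> T"
    note \<tau>D = fine_partitionD[OF \<tau>(1)]
    show "\<exists>B\<in>sets M. prob B < \<epsilon> \<and> (\<forall>\<omega>\<in>space M - B. \<forall>p\<le>m.
       \<bar>(LBINT u:{0..\<tau> p}. H u \<omega>) - (\<Sum>q<p. H (\<tau> q) \<omega> * (\<tau> (Suc q) - \<tau> q))\<bar> \<le> \<epsilon>)"
    proof (rule bexI[of _ A], intro conjI ballI allI impI, rule A(2))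
      fix \<omega> p assume \<omega>: "\<omega> \<in> space M - A" and p: "p \<le> m"
      have \<tau>p: "0 \<le> \<tau> p" "\<tau> p \<le> T" using \<tau>D(4,5) p \<tau>(2) by (auto intro: order_trans)
      let ?G = "\<lambda>u. elementary_process p \<tau> (\<lambda>q. H (\<tau> q)) u \<omega>"
      have "set_integrable lborel {0..\<tau> p} (\<lambda>u. H u \<omega>)"
        by (rule borel_integrable_atLeastAtMost'[OF continuous_on_subset[OF contA[OF \<omega>]]]) auto
      then have intH: "integrable lborel (\<lambda>u. indicator {0..\<tau> p} u *\<^sub>R H u \<omega>)"
        unfolding set_integrable_def .
      have indI: "integrable lborel (indicator {\<tau> q<..\<tau> (Suc q)} :: real \<Rightarrow> real)"
          "integral\<^sup>L lborel (indicator {\<tau> q<..\<tau> (Suc q)} :: real \<Rightarrow> real) = \<tau> (Suc q) - \<tau> q" if "q < p" for q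
        using \<tau>D(2)[of q] that p by (auto intro!: integrable_real_indicator)
      have intG: "integrable lborel ?G"
        unfolding elementary_process_def by (intro Bochner_Integration.integrable_sum integrable_mult_right indI) auto
      have G: "(\<integral>u. ?G u \<partial>lborel) = (\<Sum>q<p. H (\<tau> q) \<omega> * (\<tau> (Suc q) - \<tau> q))"
        unfolding elementary_process_def
        by (subst Bochner_Integration.integral_sum) (use indI in \<open>auto intro!: sum.cong\<close>)
      have int\<eta>: "integrable lborel (\<lambda>u. \<eta> * indicator {0..\<tau> p} u)"
        by (intro integrable_mult_right integrable_real_indicator) (auto simp: emeasure_lborel_Icc_eq)
      \<comment> \<open>The cells are open on the left, so the step process vanishes at time 0
        whatever the integrand does there; this one point is removed as a null set.\<close>
      have le: "\<bar>indicator {0..\<tau> p} u *\<^sub>R H u \<omega> - ?G u\<bar> \<le> \<eta> * indicator {0..\<tau> p} u" if "u \<noteq> 0" for u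
      proof (cases "0 < u \<and> u \<le> \<tau> p")
        case True
        then obtain q where q: "q < p" "\<tau> q < u" "u \<le> \<tau> (Suc q)"
          using steps_find[of \<tau> u p] \<tau>D(1) by auto
        have "?G u = H (\<tau> q) \<omega>"
          by (rule elementary_process_eq[OF _ q]) (use \<tau>D(2) p in auto)
        moreover have "\<bar>H u \<omega> - H (\<tau> q) \<omega>\<bar> \<le> \<eta>"
          using True q p \<tau>p \<tau>D(3)[of q] \<tau>D(5)[of q] by (intro mod[OF \<omega>]) auto
        ultimately show ?thesis using True by simp
      next
        case False
        then have u: "u \<notin> {0..\<tau> p}" using that by auto
        have "?G u = 0"
          unfolding elementary_process_def
        proof (rule sum.neutral, rule ballI)
          fix q assume "q \<in> {..<p}"
          then have "\<tau> (Suc q) \<le> \<tau> p" "0 \<le> \<tau> q" using \<tau>D(4,5) p by auto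
          then have "u \<notin> {\<tau> q<..\<tau> (Suc q)}" using u by auto
          then show "H (\<tau> q) \<omega> * indicator {\<tau> q<..\<tau> (Suc q)} u = 0" by simp
        qed
        then show ?thesis using u by simp
      qed
      have "(LBINT u:{0..\<tau> p}. H u \<omega>) - (\<Sum>q<p. H (\<tau> q) \<omega> * (\<tau> (Suc q) - \<tau> q))
          = (\<integral>u. indicator {0..\<tau> p} u *\<^sub>R H u \<omega> - ?G u \<partial>lborel)"
        unfolding set_lebesgue_integral_def G[symmetric]
        by (rule Bochner_Integration.integral_diff[OF intH intG, symmetric])
      also have "\<bar>\<dots>\<bar> \<le> (\<integral>u. \<bar>indicator {0..\<tau> p} u *\<^sub>R H u \<omega> - ?G u\<bar> \<partial>lborel)"
        by (rule integral_abs_bound)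
      also have "\<dots> \<le> (\<integral>u. \<eta> * indicator {0..\<tau> p} u \<partial>lborel)"
      proof (rule integral_mono_AE)
        show "integrable lborel (\<lambda>u. \<bar>indicator {0..\<tau> p} u *\<^sub>R H u \<omega> - ?G u\<bar>)"
          by (intro integrable_abs Bochner_Integration.integrable_diff intH intG)
        show "AE u in lborel. \<bar>indicator {0..\<tau> p} u *\<^sub>R H u \<omega> - ?G u\<bar> \<le> \<eta> * indicator {0..\<tau> p} u"
          using AE_lborel_singleton[of 0] by eventually_elim (rule le)
      qed (rule int\<eta>)
      also have "\<dots> = \<eta> * \<tau> p" using \<tau>p by simp
      also have "\<dots> \<le> \<eta> * (T + 1)" using \<eta> \<tau>p by (intro mult_left_mono) auto
      also have "\<dots> = \<epsilon>" using T by (simp add: \<eta>_def)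
      finally show "\<bar>(LBINT u:{0..\<tau> p}. H u \<omega>) - (\<Sum>q<p. H (\<tau> q) \<omega> * (\<tau> (Suc q) - \<tau> q))\<bar> \<le> \<epsilon>" .
    qed (rule A(1))
  qed
qed

end

section \<open>Convergence of the Euler scheme to the solution\<close>

context lipschitz_coefficients
begin

text \<open>The accumulated defect of \<open>Y\<close> in the Euler recursion, that is, in the
  equation with left-point Riemann sums in place of the integrals.\<close>

definition residual :: "real^'n \<Rightarrow> (real \<Rightarrow> (real \<Rightarrow> real^'d) \<Rightarrow> real^'n) \<Rightarrow> (nat \<Rightarrow> real) \<Rightarrow> nat \<Rightarrow>
    (real \<Rightarrow> real^'d) \<Rightarrow> real^'n" where
  "residual x Y \<tau> p \<omega> = Y (\<tau> p) \<omega> - x - (\<Sum>q<p. (\<tau> (Suc q) - \<tau> q) *\<^sub>R f (Y (\<tau> q) \<omega>)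
     + g (Y (\<tau> q) \<omega>) *v (\<omega> (\<tau> (Suc q)) - \<omega> (\<tau> q)))"

text \<open>Subtracting the integral equation leaves, in each component, the Riemann sum errors of
  one drift integral and of the Ito integrals against all coordinates; each of these vanishes with
  the mesh.\<close>

lemma residual_mesh_negligible:
  assumes sol: "sde_solution P f g x Y" and T: "0 \<le> T"
  shows "mesh_negligible T (\<lambda>\<tau> p \<omega>. norm (residual x Y \<tau> p \<omega>))"
proof -
  have Y: "\<And>t. 0 \<le> t \<Longrightarrow> Y t \<in> borel_measurable (F t)"
    and Yc: "AE \<omega> in P. continuous_on {0..} (\<lambda>t. Y t \<omega>)"
    using sol unfolding sde_solution_def by auto
  have "\<exists>I. (\<forall>i j. has_ito_integral P j (\<lambda>u \<omega>. g (Y u \<omega>) $ i $ j) (I i j)) \<and>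
        (AE \<omega> in P. \<forall>t\<ge>0. \<forall>i. Y t \<omega> $ i =
           x $ i + (LBINT u:{0..t}. f (Y u \<omega>) $ i) + (\<Sum>j\<in>UNIV. I i j t \<omega>))"
    using sol unfolding sde_solution_def by (elim conjE)
  then obtain I where I: "\<forall>i j. has_ito_integral P j (\<lambda>u \<omega>. g (Y u \<omega>) $ i $ j) (I i j)"
    and eq: "AE \<omega> in P. \<forall>t\<ge>0. \<forall>i. Y t \<omega> $ i =
           x $ i + (LBINT u:{0..t}. f (Y u \<omega>) $ i) + (\<Sum>j\<in>UNIV. I i j t \<omega>)"
    by (elim exE conjE) (rule that)
  \<comment> \<open>One finite index type for all errors: \<open>None\<close> stands for the drift
    of component i, \<open>Some j\<close> for its noise along coordinate j.\<close>
  define E where "E k \<tau> p \<omega> = (case k of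
      (i, None) \<Rightarrow> (LBINT u:{0..\<tau> p}. f (Y u \<omega>) $ i) - (\<Sum>q<p. f (Y (\<tau> q) \<omega>) $ i * (\<tau> (Suc q) - \<tau> q))
    | (i, Some j) \<Rightarrow> I i j (\<tau> p) \<omega> - (\<Sum>q<p. g (Y (\<tau> q) \<omega>) $ i $ j * (\<omega> (\<tau> (Suc q)) $ j - \<omega> (\<tau> q) $ j)))"
    for k :: "'n \<times> 'd option" and \<tau> p \<omega>
  have "mesh_negligible T (E k)" for k
  proof -
    obtain i l where k: "k = (i, l)" by (cases k)
    show ?thesis
    proof (cases l)
      case None
      have "mesh_negligible T (\<lambda>\<tau> p \<omega>. (LBINT u:{0..\<tau> p}. f (Y u \<omega>) $ i) - (\<Sum>q<p. f (Y (\<tau> q) \<omega>) $ i * (\<tau> (Suc q) - \<tau> q)))"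
      proof (rule drift_mesh_negligible[OF _ _ T])
        show "(\<lambda>\<omega>. f (Y t \<omega>) $ i) \<in> borel_measurable (F t)" if "0 \<le> t" for t
          by (intro measurable_compose[OF _ borel_measurable_nth] measurable_compose[OF Y[OF that] f_measurable])
        show "AE \<omega> in P. continuous_on {0..} (\<lambda>t. f (Y t \<omega>) $ i)"
          using Yc by eventually_elim (intro continuous_intros continuous_on_compose2[OF f_continuous[of UNIV]], auto)
      qed
      then show ?thesis unfolding k None E_def by simp
    next
      case (Some j)
      have "mesh_negligible T (\<lambda>\<tau> p \<omega>. I i j (\<tau> p) \<omega> - (\<Sum>q<p. g (Y (\<tau> q) \<omega>) $ i $ j * (\<omega> (\<tau> (Suc q)) $ j - \<omega> (\<tau> q) $ j)))"
      proof (rule ito_integral_mesh_negligible[OF I[rule_format] _ _ T])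
        show "(\<lambda>\<omega>. g (Y t \<omega>) $ i $ j) \<in> borel_measurable (F t)" if "0 \<le> t" for t
          by (intro measurable_compose[OF _ borel_measurable_matrix_nth] measurable_compose[OF Y[OF that] g_measurable])
        show "AE \<omega> in P. continuous_on {0..} (\<lambda>t. g (Y t \<omega>) $ i $ j)"
          using Yc by eventually_elim (intro continuous_intros continuous_on_compose2[OF g_continuous[of UNIV]], auto)
      qed
      then show ?thesis unfolding k Some E_def by simp
    qed
  qed
  then have "mesh_negligible T (\<lambda>\<tau> p \<omega>. \<Sum>k\<in>UNIV. \<bar>E k \<tau> p \<omega>\<bar>)"
    by (rule mesh_negligible_sum)
  then show ?thesis
  proof (rule mesh_negligible_AE)
    show "AE \<omega> in P. \<forall>\<tau> p. (\<forall>q\<le>p. 0 \<le> \<tau> q) \<longrightarrow> \<bar>norm (residual x Y \<tau> p \<omega>)\<bar> \<le> \<bar>\<Sum>k\<in>UNIV. \<bar>E k \<tau> p \<omega>\<bar>\<bar>"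
      using eq
    proof eventually_elim
      case (elim \<omega>)
      show ?case
      proof (intro allI impI)
        fix \<tau> :: "nat \<Rightarrow> real" and p assume \<tau>: "\<forall>q\<le>p. 0 \<le> \<tau> q"
        have comp: "residual x Y \<tau> p \<omega> $ i = E (i, None) \<tau> p \<omega> + (\<Sum>j\<in>UNIV. E (i, Some j) \<tau> p \<omega>)" for i
        proof -
          have "(\<Sum>j\<in>UNIV. \<Sum>q<p. g (Y (\<tau> q) \<omega>) $ i $ j * (\<omega> (\<tau> (Suc q)) $ j - \<omega> (\<tau> q) $ j))
              = (\<Sum>q<p. (g (Y (\<tau> q) \<omega>) *v (\<omega> (\<tau> (Suc q)) - \<omega> (\<tau> q))) $ i)"
            by (subst sum.swap) (simp add: matrix_vector_mult_def)
          moreover have "Y (\<tau> p) \<omega> $ i = x $ i + (LBINT u:{0..\<tau> p}. f (Y u \<omega>) $ i) + (\<Sum>j\<in>UNIV. I i j (\<tau> p) \<omega>)"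
            using elim \<tau> by blast
          ultimately show ?thesis
            unfolding residual_def E_def by (simp add: sum_subtractf sum.distrib mult.commute)
        qed
        have "norm (residual x Y \<tau> p \<omega>) \<le> (\<Sum>i\<in>UNIV. \<bar>residual x Y \<tau> p \<omega> $ i\<bar>)"
          by (rule norm_le_l1_cart)
        also have "\<dots> \<le> (\<Sum>i\<in>UNIV. \<Sum>l\<in>UNIV. \<bar>E (i, l) \<tau> p \<omega>\<bar>)"
        proof (rule sum_mono)
          fix i
          have "(\<Sum>l\<in>UNIV. \<bar>E (i, l) \<tau> p \<omega>\<bar>) = \<bar>E (i, None) \<tau> p \<omega>\<bar> + (\<Sum>j\<in>UNIV. \<bar>E (i, Some j) \<tau> p \<omega>\<bar>)"
            unfolding UNIV_option_conv by (subst sum.insert) (auto simp: sum.reindex)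
          moreover have "\<bar>\<Sum>j\<in>UNIV. E (i, Some j) \<tau> p \<omega>\<bar> \<le> (\<Sum>j\<in>UNIV. \<bar>E (i, Some j) \<tau> p \<omega>\<bar>)"
            by (rule sum_abs)
          ultimately show "\<bar>residual x Y \<tau> p \<omega> $ i\<bar> \<le> (\<Sum>l\<in>UNIV. \<bar>E (i, l) \<tau> p \<omega>\<bar>)"
            unfolding comp by linarith
        qed
        also have "\<dots> = (\<Sum>k\<in>UNIV. \<bar>E k \<tau> p \<omega>\<bar>)"
          by (simp add: sum.cartesian_product)
        finally show "\<bar>norm (residual x Y \<tau> p \<omega>)\<bar> \<le> \<bar>\<Sum>k\<in>UNIV. \<bar>E k \<tau> p \<omega>\<bar>\<bar>" by simp
      qed
    qed
  qed
qed

text \<open>The increments are switched off once the residual exceeds \<open>\<eta>\<close>, which makes the remaining error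
  square integrable although the solution is not yet known to be.\<close>

lemma euler_error:
  assumes Y: "\<And>t. 0 \<le> t \<Longrightarrow> Y t \<in> borel_measurable (F t)"
    and \<tau>: "fine_partition 1 m \<tau>" "\<tau> m \<le> T" and \<eta>: "0 < \<eta>" "\<eta> < \<epsilon>"
    and B: "B \<in> sets M" "\<And>\<omega> p. \<omega> \<in> space M - B \<Longrightarrow> p \<le> m \<Longrightarrow> norm (residual x Y \<tau> p \<omega>) \<le> \<eta>"
  shows "prob {\<omega>\<in>space M. norm (Y (\<tau> m) \<omega> - euler f g \<tau> x m \<omega>) > \<epsilon>}
    \<le> prob B + exp (growth_rate L * T) * (growth_rate L * T * (L * \<eta>)\<^sup>2) / (\<epsilon> - \<eta>)\<^sup>2"
proof -
  note \<tau>D = fine_partitionD[OF \<tau>(1)]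
  let ?e = "euler f g \<tau> x"
  let ?c = "growth_rate L"
  \<comment> \<open>The switch inspects the residuals up to node q only, so it is known at
    \<open>\<tau> q\<close> and its product with the coefficients remains adapted.\<close>
  define c where "c q \<omega> = (if \<forall>r\<in>{..q}. norm (residual x Y \<tau> r \<omega>) \<le> \<eta> then 1 else 0 :: real)" for q \<omega>
  define a where "a q \<omega> = c q \<omega> *\<^sub>R (f (Y (\<tau> q) \<omega>) - f (?e q \<omega>))" for q \<omega>
  define b where "b q \<omega> = c q \<omega> *\<^sub>R (g (Y (\<tau> q) \<omega>) - g (?e q \<omega>))" for q \<omega>
  define D where "D p \<omega> = (\<Sum>q<p. (\<tau> (Suc q) - \<tau> q) *\<^sub>R a q \<omega> + b q \<omega> *v (\<omega> (\<tau> (Suc q)) - \<omega> (\<tau> q)))" for p \<omega>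
  have Y_F: "Y (\<tau> q) \<in> borel_measurable (F (\<tau> p))" if "q \<le> p" "p \<le> m" for p q
    by (rule measurable_F_mono[OF Y]) (use \<tau>D(4,5) that in auto)
  have W_F: "(\<lambda>\<omega>. \<omega> (\<tau> q)) \<in> borel_measurable (F (\<tau> p))" if "q \<le> p" "p \<le> m" for p q
    by (rule measurable_coord_F) (use \<tau>D(4,5) that in auto)
  have e_F: "?e q \<in> borel_measurable (F (\<tau> p))" if "q \<le> p" "p \<le> m" for p q
    by (rule measurable_F_mono[OF euler_measurable[OF \<tau>(1)]]) (use \<tau>D(4) that in auto)
  have res_F: "residual x Y \<tau> r \<in> borel_measurable (F (\<tau> p))" if "r \<le> p" "p \<le> m" for r p
    unfolding residual_def[abs_def]
    by (intro borel_measurable_diff borel_measurable_sum borel_measurable_add borel_measurable_scaleR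
        borel_measurable_const borel_measurable_matrix_vector_mult measurable_compose[OF Y_F f_measurable]
        measurable_compose[OF Y_F g_measurable] Y_F W_F) (use that in auto)
  have c_F: "c q \<in> borel_measurable (F (\<tau> p))" if "q \<le> p" "p \<le> m" for q p
  proof -
    have "{\<omega> \<in> space (F (\<tau> p)). \<forall>r\<in>{..q}. norm (residual x Y \<tau> r \<omega>) \<le> \<eta>} \<in> sets (F (\<tau> p))"
    proof (intro sets.sets_Collect_finite_All)
      fix r assume "r \<in> {..q}"
      then have [measurable]: "residual x Y \<tau> r \<in> borel_measurable (F (\<tau> p))"
        using res_F that by auto
      show "{\<omega> \<in> space (F (\<tau> p)). norm (residual x Y \<tau> r \<omega>) \<le> \<eta>} \<in> sets (F (\<tau> p))" by measurable
    qed simp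
    then have [measurable]: "Measurable.pred (F (\<tau> p)) (\<lambda>\<omega>. \<forall>r\<in>{..q}. norm (residual x Y \<tau> r \<omega>) \<le> \<eta>)"
      by (simp add: pred_def)
    show ?thesis unfolding c_def by measurable
  qed
  have a_F: "a q \<in> borel_measurable (F (\<tau> p))" and b_F: "b q \<in> borel_measurable (F (\<tau> p))"
    if "q \<le> p" "p \<le> m" for q p
    unfolding a_def b_def
    by (intro borel_measurable_scaleR borel_measurable_diff c_F that measurable_compose[OF Y_F f_measurable]
        measurable_compose[OF Y_F g_measurable] measurable_compose[OF e_F f_measurable]
        measurable_compose[OF e_F g_measurable])+
  have D_F: "D p \<in> borel_measurable (F (\<tau> p))" if "p \<le> m" for p
    unfolding D_def[abs_def]
    by (intro borel_measurable_sum borel_measurable_add borel_measurable_scaleR borel_measurable_diff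
        borel_measurable_const borel_measurable_matrix_vector_mult a_F b_F W_F) (use that in auto)
  have D_eq: "Y (\<tau> p) \<omega> - ?e p \<omega> = D p \<omega> + residual x Y \<tau> p \<omega>" if "\<And>q. q < p \<Longrightarrow> c q \<omega> = 1" for p \<omega>
  proof -
    have "D p \<omega> = (\<Sum>q<p. ((\<tau> (Suc q) - \<tau> q) *\<^sub>R f (Y (\<tau> q) \<omega>) + g (Y (\<tau> q) \<omega>) *v (\<omega> (\<tau> (Suc q)) - \<omega> (\<tau> q)))
        - ((\<tau> (Suc q) - \<tau> q) *\<^sub>R f (?e q \<omega>) + g (?e q \<omega>) *v (\<omega> (\<tau> (Suc q)) - \<omega> (\<tau> q))))"
      unfolding D_def a_def b_def using that
      by (intro sum.cong) (auto simp: matrix_vector_mult_diff_rdistrib scaleR_diff_right)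
    then have "D p \<omega> = (\<Sum>q<p. (\<tau> (Suc q) - \<tau> q) *\<^sub>R f (Y (\<tau> q) \<omega>) + g (Y (\<tau> q) \<omega>) *v (\<omega> (\<tau> (Suc q)) - \<omega> (\<tau> q)))
        - (?e p \<omega> - x)"
      unfolding sum_subtractf using euler_sum[of f g \<tau> x p \<omega>] by simp
    then show ?thesis unfolding residual_def by simp
  qed
  have err: "c q \<omega> * norm (Y (\<tau> q) \<omega> - ?e q \<omega>) \<le> norm (D q \<omega>) + \<eta>" for q \<omega>
  proof (cases "\<forall>r\<in>{..q}. norm (residual x Y \<tau> r \<omega>) \<le> \<eta>")
    case True
    then have "c r \<omega> = 1" if "r \<le> q" for r using that by (auto simp: c_def)
    then have "c q \<omega> = 1" "Y (\<tau> q) \<omega> - ?e q \<omega> = D q \<omega> + residual x Y \<tau> q \<omega>"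
      using D_eq[of q \<omega>] by auto
    moreover have "norm (residual x Y \<tau> q \<omega>) \<le> \<eta>" using True by simp
    ultimately show ?thesis
      using norm_triangle_ineq[of "D q \<omega>" "residual x Y \<tau> q \<omega>"] by simp
  next
    case False
    then have "c q \<omega> = 0" unfolding c_def by (rule if_not_P)
    then show ?thesis using \<eta> by simp
  qed
  have c01: "0 \<le> c q \<omega>" for q \<omega> by (simp add: c_def)
  \<comment> \<open>While the switch is on, solution and scheme differ by \<open>D\<close> plus a
    residual of at most \<eta>. The Lipschitz bound then gives an inhomogeneous term
    \<open>L * \<eta>\<close>, with no moment of the solution involved.\<close>
  have ab: "norm (a q \<omega>) \<le> L * norm (D q \<omega>) + L * \<eta>" "norm (b q \<omega>) \<le> L * norm (D q \<omega>) + L * \<eta>" for q \<omega>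
  proof -
    have *: "c q \<omega> * (L * norm (Y (\<tau> q) \<omega> - ?e q \<omega>)) \<le> L * norm (D q \<omega>) + L * \<eta>"
      using mult_left_mono[OF err[of q \<omega>] L_nonneg] by (simp add: algebra_simps)
    show "norm (a q \<omega>) \<le> L * norm (D q \<omega>) + L * \<eta>"
      using mult_left_mono[OF f_lipschitz[of "Y (\<tau> q) \<omega>" "?e q \<omega>"] c01[of q \<omega>]] * c01[of q \<omega>]
      by (simp add: a_def)
    show "norm (b q \<omega>) \<le> L * norm (D q \<omega>) + L * \<eta>"
      using mult_left_mono[OF g_lipschitz[of "Y (\<tau> q) \<omega>" "?e q \<omega>"] c01[of q \<omega>]] * c01[of q \<omega>]
      by (simp add: b_def)
  qed
  have D_Suc: "D (Suc q) \<omega> = D q \<omega> + (\<tau> (Suc q) - \<tau> q) *\<^sub>R a q \<omega> + b q \<omega> *v (\<omega> (\<tau> (Suc q)) - \<omega> (\<tau> q))" for q \<omega>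
    by (simp add: D_def)
  have D0: "D 0 \<omega> = 0" for \<omega> by (simp add: D_def)
  have L\<eta>: "0 \<le> L * \<eta>" using L_nonneg \<eta> by simp
  have le_refl: "q \<le> q" for q :: nat by simp
  note R = recursion_second_moment[OF \<tau>(1), where V = D and a = a and b = b and v = 0 and L = L and A = "L * \<eta>",
      OF D0 D_Suc D_F a_F[OF le_refl less_imp_le] b_F[OF le_refl less_imp_le] ab L_nonneg L\<eta> le_refl]
  have D_M: "D m \<in> borel_measurable M" by (rule measurable_F_M[OF D_F]) simp
  have "expectation (\<lambda>\<omega>. (norm (D m \<omega>))\<^sup>2) \<le> exp (?c * \<tau> m) * (?c * \<tau> m * (L * \<eta>)\<^sup>2)"
    using R(2) by simp
  also have "\<dots> \<le> exp (?c * T) * (?c * T * (L * \<eta>)\<^sup>2)"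
    using \<tau>(2) \<tau>D(5)[of m] growth_rate_pos[OF L_nonneg]
    by (intro mult_mono mult_right_mono) auto
  finally have ED: "expectation (\<lambda>\<omega>. (norm (D m \<omega>))\<^sup>2) \<le> exp (?c * T) * (?c * T * (L * \<eta>)\<^sup>2)" .
  have "prob {\<omega>\<in>space M. \<bar>norm (D m \<omega>)\<bar> > \<epsilon> - \<eta>} \<le> expectation (\<lambda>\<omega>. (norm (D m \<omega>))\<^sup>2) / (\<epsilon> - \<eta>)\<^sup>2"
    by (rule prob_gt_le_second_moment) (use D_M R(1) \<eta> in auto)
  also have "\<dots> \<le> exp (?c * T) * (?c * T * (L * \<eta>)\<^sup>2) / (\<epsilon> - \<eta>)\<^sup>2"
    by (rule divide_right_mono[OF ED]) simp
  finally have PD: "prob {\<omega>\<in>space M. \<bar>norm (D m \<omega>)\<bar> > \<epsilon> - \<eta>} \<le> exp (?c * T) * (?c * T * (L * \<eta>)\<^sup>2) / (\<epsilon> - \<eta>)\<^sup>2" .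
  have D_sets: "{\<omega>\<in>space M. \<bar>norm (D m \<omega>)\<bar> > \<epsilon> - \<eta>} \<in> sets M"
    using D_M by measurable
  have "prob {\<omega>\<in>space M. norm (Y (\<tau> m) \<omega> - ?e m \<omega>) > \<epsilon>} \<le> prob (B \<union> {\<omega>\<in>space M. \<bar>norm (D m \<omega>)\<bar> > \<epsilon> - \<eta>})"
  proof (rule finite_measure_mono)
    show "{\<omega>\<in>space M. norm (Y (\<tau> m) \<omega> - ?e m \<omega>) > \<epsilon>} \<subseteq> B \<union> {\<omega>\<in>space M. \<bar>norm (D m \<omega>)\<bar> > \<epsilon> - \<eta>}"
    proof
      fix \<omega> assume \<omega>: "\<omega> \<in> {\<omega>\<in>space M. norm (Y (\<tau> m) \<omega> - ?e m \<omega>) > \<epsilon>}"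
      show "\<omega> \<in> B \<union> {\<omega>\<in>space M. \<bar>norm (D m \<omega>)\<bar> > \<epsilon> - \<eta>}"
      proof (cases "\<omega> \<in> B")
        case False
        then have res: "norm (residual x Y \<tau> p \<omega>) \<le> \<eta>" if "p \<le> m" for p
          using B(2) \<omega> that by auto
        then have "c q \<omega> = 1" if "q < m" for q using that by (auto simp: c_def)
        then have "Y (\<tau> m) \<omega> - ?e m \<omega> = D m \<omega> + residual x Y \<tau> m \<omega>" by (rule D_eq)
        then have "\<epsilon> < norm (D m \<omega>) + norm (residual x Y \<tau> m \<omega>)"
          using \<omega> norm_triangle_ineq[of "D m \<omega>" "residual x Y \<tau> m \<omega>"] by auto
        then show ?thesis using res[of m] \<omega> by auto
      qed simp
    qed
  qed (use B(1) D_sets in auto)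
  also have "\<dots> \<le> prob B + prob {\<omega>\<in>space M. \<bar>norm (D m \<omega>)\<bar> > \<epsilon> - \<eta>}"
    by (rule measure_Un_le[OF B(1) D_sets])
  finally show ?thesis using PD by simp
qed

text \<open>The bound of \<open>euler_error\<close> tends to 0 with the threshold \<eta>. First
  \<eta> is fixed so that the bound stays below \<epsilon>, then the mesh is taken so fine that the
  residual respects \<eta> off an event of probability below \<eta>.\<close>

lemma euler_converges:
  assumes sol: "sde_solution P f g x Y" and T: "0 \<le> T" and \<epsilon>: "0 < \<epsilon>"
  obtains d where "0 < d" "d \<le> 1"
    "\<And>m \<tau>. fine_partition d m \<tau> \<Longrightarrow> \<tau> m \<le> T \<Longrightarrow>
       prob {\<omega>\<in>space M. norm (Y (\<tau> m) \<omega> - euler f g \<tau> x m \<omega>) > \<epsilon>} < \<epsilon>"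
proof -
  let ?c = "growth_rate L"
  define C where "C = exp (?c * T) * (?c * T * L\<^sup>2)"
  have C: "0 \<le> C"
    unfolding C_def using growth_rate_pos[OF L_nonneg] T by simp
  have "((\<lambda>\<eta>. \<eta> + C * \<eta>\<^sup>2 / (\<epsilon> - \<eta>)\<^sup>2) \<longlongrightarrow> 0 + C * 0\<^sup>2 / (\<epsilon> - 0)\<^sup>2) (at_right 0)"
    using \<epsilon> by (intro tendsto_intros) auto
  then have "\<forall>\<^sub>F \<eta> in at_right 0. \<eta> + C * \<eta>\<^sup>2 / (\<epsilon> - \<eta>)\<^sup>2 < \<epsilon>"
    using \<epsilon> by (intro order_tendstoD(2)) auto
  moreover have "\<forall>\<^sub>F \<eta> in at_right 0. \<eta> \<in> {0<..<\<epsilon>}"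
    by (rule eventually_at_right_real[OF \<epsilon>])
  ultimately have "\<forall>\<^sub>F \<eta> in at_right 0. \<eta> + C * \<eta>\<^sup>2 / (\<epsilon> - \<eta>)\<^sup>2 < \<epsilon> \<and> \<eta> \<in> {0<..<\<epsilon>}"
    by (rule eventually_conj)
  then have "\<exists>\<eta>. \<eta> + C * \<eta>\<^sup>2 / (\<epsilon> - \<eta>)\<^sup>2 < \<epsilon> \<and> \<eta> \<in> {0<..<\<epsilon>}"
    by (rule eventually_happens'[OF trivial_limit_at_right_real])
  then obtain \<eta> where \<eta>: "\<eta> + C * \<eta>\<^sup>2 / (\<epsilon> - \<eta>)\<^sup>2 < \<epsilon>" "0 < \<eta>" "\<eta> < \<epsilon>"
    by auto
  obtain d where d: "0 < d" "\<And>m \<tau>. fine_partition d m \<tau> \<Longrightarrow> \<tau> m \<le> T \<Longrightarrow>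
     \<exists>B\<in>sets M. prob B < \<eta> \<and> (\<forall>\<omega>\<in>space M - B. \<forall>p\<le>m. \<bar>norm (residual x Y \<tau> p \<omega>)\<bar> \<le> \<eta>)"
    by (rule mesh_negligibleD[OF residual_mesh_negligible[OF sol T] \<eta>(2)]) (rule that)
  show thesis
  proof (rule that[of "min d 1"])
    fix m :: nat and \<tau> assume \<tau>: "fine_partition (min d 1) m \<tau>" "\<tau> m \<le> T"
    have \<tau>1: "fine_partition 1 m \<tau>" and \<tau>d: "fine_partition d m \<tau>"
      by (rule fine_partition_mono[OF \<tau>(1)], simp)+
    obtain B where B: "B \<in> sets M" "prob B < \<eta>"
      "\<forall>\<omega>\<in>space M - B. \<forall>p\<le>m. \<bar>norm (residual x Y \<tau> p \<omega>)\<bar> \<le> \<eta>"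
      using d(2)[OF \<tau>d \<tau>(2)] by (elim bexE conjE) (rule that)
    have Y: "\<And>t. 0 \<le> t \<Longrightarrow> Y t \<in> borel_measurable (F t)"
      using sol unfolding sde_solution_def by auto
    have "prob {\<omega>\<in>space M. norm (Y (\<tau> m) \<omega> - euler f g \<tau> x m \<omega>) > \<epsilon>}
        \<le> prob B + exp (?c * T) * (?c * T * (L * \<eta>)\<^sup>2) / (\<epsilon> - \<eta>)\<^sup>2"
      by (rule euler_error[OF Y \<tau>1 \<tau>(2) \<eta>(2,3) B(1)]) (use B(3) in auto)
    also have "exp (?c * T) * (?c * T * (L * \<eta>)\<^sup>2) = C * \<eta>\<^sup>2"
      by (simp add: C_def power_mult_distrib)
    finally show "prob {\<omega>\<in>space M. norm (Y (\<tau> m) \<omega> - euler f g \<tau> x m \<omega>) > \<epsilon>} < \<epsilon>"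
      using B(2) \<eta>(1) by linarith
  qed (use d in auto)
qed

end

section \<open>The transition semigroup\<close>

definition bounded_lipschitz :: "real \<Rightarrow> real \<Rightarrow> ('a::real_normed_vector \<Rightarrow> real) \<Rightarrow> bool" where
  "bounded_lipschitz B K h \<longleftrightarrow> 0 \<le> B \<and> 0 \<le> K \<and> (\<forall>x. \<bar>h x\<bar> \<le> B) \<and> (\<forall>x y. \<bar>h x - h y\<bar> \<le> K * norm (x - y))"

lemma bounded_lipschitzD:
  assumes "bounded_lipschitz B K h"
  shows "0 \<le> B" "0 \<le> K" "\<And>x. \<bar>h x\<bar> \<le> B" "\<And>x y. \<bar>h x - h y\<bar> \<le> K * norm (x - y)"
    "h \<in> borel_measurable borel"
proof -
  show 1: "0 \<le> B" "0 \<le> K" "\<And>x. \<bar>h x\<bar> \<le> B" "\<And>x y. \<bar>h x - h y\<bar> \<le> K * norm (x - y)"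
    using assms by (auto simp: bounded_lipschitz_def)
  then have "K-lipschitz_on UNIV h" by (auto intro!: lipschitz_onI simp: dist_norm)
  then show "h \<in> borel_measurable borel"
    by (intro borel_measurable_continuous_onI lipschitz_on_continuous_on)
qed

text \<open>Lipschitz functions that decrease with k to the indicator of a nonempty closed
  set.\<close>

definition closed_approx :: "'a::real_normed_vector set \<Rightarrow> nat \<Rightarrow> 'a \<Rightarrow> real" where
  "closed_approx C k x = max 0 (1 - real k * infdist x C)"

lemma bounded_lipschitz_closed_approx: "bounded_lipschitz 1 (real k) (closed_approx C k)"
  unfolding bounded_lipschitz_def
proof (intro conjI allI)
  fix x y :: 'a
  show "\<bar>closed_approx C k x\<bar> \<le> 1"
    using infdist_nonneg[of x C] by (simp add: closed_approx_def)
  have "\<bar>closed_approx C k x - closed_approx C k y\<bar> \<le> \<bar>real k * infdist x C - real k * infdist y C\<bar>"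
    unfolding closed_approx_def by linarith
  also have "\<dots> = real k * \<bar>infdist x C - infdist y C\<bar>"
    by (simp add: right_diff_distrib[symmetric] abs_mult)
  also have "\<dots> \<le> real k * norm (x - y)"
    using infdist_triangle_abs[of x C y] by (intro mult_left_mono) (simp_all add: dist_norm)
  finally show "\<bar>closed_approx C k x - closed_approx C k y\<bar> \<le> real k * norm (x - y)" .
qed simp_all

lemma closed_approx_tendsto_measure:
  fixes \<mu> :: "'a::real_normed_vector measure"
  assumes "finite_measure \<mu>" and \<mu>: "sets \<mu> = sets borel" and C: "closed C" "C \<noteq> {}"
  shows "(\<lambda>k. \<integral>x. closed_approx C k x \<partial>\<mu>) \<longlonglongrightarrow> measure \<mu> C"
proof -
  interpret finite_measure \<mu> by fact
  have [measurable]: "closed_approx C k \<in> borel_measurable \<mu>" for k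
    using bounded_lipschitzD(5)[OF bounded_lipschitz_closed_approx] measurable_cong_sets[OF \<mu> refl] by blast
  have C_sets: "C \<in> sets \<mu>" using C(1) \<mu> by auto
  have "(\<lambda>k. \<integral>x. closed_approx C k x \<partial>\<mu>) \<longlonglongrightarrow> (\<integral>x. indicator C x \<partial>\<mu>)"
  proof (rule integral_dominated_convergence[where w = "\<lambda>_. 1"])
    show "AE x in \<mu>. (\<lambda>k. closed_approx C k x) \<longlonglongrightarrow> indicator C x"
    proof (rule AE_I2)
      fix x
      show "(\<lambda>k. closed_approx C k x) \<longlonglongrightarrow> indicator C x"
      proof (cases "x \<in> C")
        case True
        then show ?thesis by (simp add: closed_approx_def)
      next
        case False
        then have "0 < infdist x C" using infdist_pos_not_in_closed[OF C] by simp
        then obtain k0 where k0: "1 < real k0 * infdist x C"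
          using reals_Archimedean3 by blast
        have "closed_approx C k x = 0" if "k0 \<le> k" for k
        proof -
          have "real k0 * infdist x C \<le> real k * infdist x C"
            using that infdist_nonneg[of x C] by (intro mult_right_mono) auto
          then show ?thesis using k0 by (simp add: closed_approx_def)
        qed
        then have "\<forall>\<^sub>F k in sequentially. closed_approx C k x = indicator C x"
          using False unfolding eventually_sequentially by auto
        then show ?thesis by (rule tendsto_eventually)
      qed
    qed
    show "AE x in \<mu>. norm (closed_approx C k x) \<le> 1" for k
      using bounded_lipschitzD(3)[OF bounded_lipschitz_closed_approx] by auto
    show "(\<lambda>x. indicator C x :: real) \<in> borel_measurable \<mu>"
      using C_sets by (rule borel_measurable_indicator)
  qed simp_all
  then show ?thesis using C_sets by simp
qed

lemma Int_stable_closed: "Int_stable (Collect closed)"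
  by (auto simp: Int_stable_def)

lemma sets_borel_closed: "sets borel = sigma_sets UNIV (Collect closed)"
  by (subst borel_eq_closed) simp

text \<open>Closed sets are stable under intersection and generate the Borel sets, and their
  measures are limits of integrals of bounded Lipschitz functions.\<close>

lemma prob_eqI_lipschitz:
  fixes \<mu> \<nu> :: "'a::real_normed_vector measure"
  assumes \<mu>: "prob_space \<mu>" "sets \<mu> = sets borel" and \<nu>: "prob_space \<nu>" "sets \<nu> = sets borel"
    and eq: "\<And>B K h. bounded_lipschitz B K h \<Longrightarrow> (\<integral>x. h x \<partial>\<mu>) = (\<integral>x. h x \<partial>\<nu>)"
  shows "\<mu> = \<nu>"
proof (rule measure_eqI_generator_eq[where E = "Collect closed" and \<Omega> = UNIV and A = "\<lambda>_. UNIV"])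
  have fin: "finite_measure \<mu>" "finite_measure \<nu>"
    using \<mu>(1) \<nu>(1) by (auto intro: prob_space.finite_measure)
  show "emeasure \<mu> C = emeasure \<nu> C" if "C \<in> Collect closed" for C
  \<comment> \<open>By convention \<open>infdist\<close> to the empty set is 0, so the approximating
    functions are constantly 1 there and this case stands apart.\<close>
  proof (cases "C = {}")
    case False
    then have C: "closed C" "C \<noteq> {}" using that by auto
    have "(\<lambda>k. \<integral>x. closed_approx C k x \<partial>\<mu>) = (\<lambda>k. \<integral>x. closed_approx C k x \<partial>\<nu>)"
      using eq[OF bounded_lipschitz_closed_approx] by auto
    then have "measure \<mu> C = measure \<nu> C"
      using LIMSEQ_unique closed_approx_tendsto_measure[OF fin(1) \<mu>(2) C] closed_approx_tendsto_measure[OF fin(2) \<nu>(2) C]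
      by metis
    then show ?thesis using fin by (simp add: finite_measure.emeasure_eq_measure)
  qed simp
  show "emeasure \<mu> UNIV \<noteq> \<infinity>" for i
    using fin by (simp add: finite_measure.emeasure_eq_measure)
qed (use \<mu> \<nu> sets_borel_closed Int_stable_closed in auto)

section \<open>From closeness in probability to closeness of expectations\<close>

context wiener
begin

text \<open>Off \<open>A\<close> the two values differ by at most \<eta>, on \<open>A\<close> by at
  most \<open>2 * B\<close>.\<close>

lemma expectation_diff_le:
  assumes Y: "Y \<in> borel_measurable M" and Z: "Z \<in> borel_measurable M"
    and h: "h \<in> borel_measurable borel" "\<And>x. \<bar>h x\<bar> \<le> B" and k: "k \<in> borel_measurable borel" "\<And>x. \<bar>k x\<bar> \<le> B"
    and A: "A \<in> sets M" and le: "\<And>\<omega>. \<omega> \<in> space M - A \<Longrightarrow> \<bar>h (Y \<omega>) - k (Z \<omega>)\<bar> \<le> \<eta>" and \<eta>: "0 \<le> \<eta>"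
  shows "\<bar>expectation (\<lambda>\<omega>. h (Y \<omega>)) - expectation (\<lambda>\<omega>. k (Z \<omega>))\<bar> \<le> \<eta> + 2 * B * prob A"
proof -
  have hY: "(\<lambda>\<omega>. h (Y \<omega>)) \<in> borel_measurable M" by (rule measurable_compose[OF Y h(1)])
  have kZ: "(\<lambda>\<omega>. k (Z \<omega>)) \<in> borel_measurable M" by (rule measurable_compose[OF Z k(1)])
  have int: "integrable M (\<lambda>\<omega>. h (Y \<omega>))" "integrable M (\<lambda>\<omega>. k (Z \<omega>))"
    by (rule integrable_bounded[OF hY h(2)], rule integrable_bounded[OF kZ k(2)])
  have intA: "integrable M (\<lambda>\<omega>. \<eta> + 2 * B * indicator A \<omega>)"
    using A by (intro Bochner_Integration.integrable_add integrable_mult_right integrable_const integrable_real_indicator)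
      (auto simp: emeasure_eq_measure)
  have "\<bar>expectation (\<lambda>\<omega>. h (Y \<omega>)) - expectation (\<lambda>\<omega>. k (Z \<omega>))\<bar> = \<bar>expectation (\<lambda>\<omega>. h (Y \<omega>) - k (Z \<omega>))\<bar>"
    using int by simp
  also have "\<dots> \<le> expectation (\<lambda>\<omega>. \<bar>h (Y \<omega>) - k (Z \<omega>)\<bar>)" by (rule integral_abs_bound)
  also have "\<dots> \<le> expectation (\<lambda>\<omega>. \<eta> + 2 * B * indicator A \<omega>)"
  proof (rule integral_mono[OF _ intA])
    show "integrable M (\<lambda>\<omega>. \<bar>h (Y \<omega>) - k (Z \<omega>)\<bar>)" using int by simp
    fix \<omega> assume \<omega>: "\<omega> \<in> space M"
    show "\<bar>h (Y \<omega>) - k (Z \<omega>)\<bar> \<le> \<eta> + 2 * B * indicator A \<omega>"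
      using le[of \<omega>] h(2)[of "Y \<omega>"] k(2)[of "Z \<omega>"] \<omega> \<eta> by (cases "\<omega> \<in> A") auto
  qed
  also have "\<dots> = \<eta> + 2 * B * prob A"
  proof -
    have "integrable M (\<lambda>\<omega>. 2 * B * indicator A \<omega>)"
      using A by (intro integrable_mult_right integrable_real_indicator) (auto simp: emeasure_eq_measure)
    moreover have "expectation (\<lambda>\<omega>. 2 * B * indicator A \<omega>) = 2 * B * prob A"
      using A sets.sets_into_space[OF A] by (simp add: Int_absorb2)
    moreover have "measure P (space P) = 1" by (rule prob_space.prob_space[OF prob_space_P])
    moreover have "A \<inter> space P = A" using sets.sets_into_space[OF A] by auto
    ultimately show ?thesis by simp
  qed
  finally show ?thesis .
qed

text \<open>Jensen's inequality for the square, in the form that a variance is nonnegative.\<close>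

lemma expectation_le_of_second_moment:
  fixes X :: "_ \<Rightarrow> real"
  assumes X: "X \<in> borel_measurable M" "integrable M (\<lambda>\<omega>. (X \<omega>)\<^sup>2)" "expectation (\<lambda>\<omega>. (X \<omega>)\<^sup>2) \<le> c\<^sup>2" and c: "0 \<le> c"
  shows "integrable M X" "expectation X \<le> c"
proof -
  show int: "integrable M X"
  proof (rule Bochner_Integration.integrable_bound[OF _ X(1)])
    show "integrable M (\<lambda>\<omega>. (X \<omega>)\<^sup>2 + 1)" using X(2) by simp
    show "AE \<omega> in M. norm (X \<omega>) \<le> norm ((X \<omega>)\<^sup>2 + 1)"
    proof (rule AE_I2)
      fix \<omega>
      have "2 * \<bar>X \<omega>\<bar> * 1 \<le> \<bar>X \<omega>\<bar>\<^sup>2 + 1\<^sup>2" by (rule sum_squares_bound)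
      then show "norm (X \<omega>) \<le> norm ((X \<omega>)\<^sup>2 + 1)" by simp
    qed
  qed
  have "(expectation X)\<^sup>2 \<le> expectation (\<lambda>\<omega>. (X \<omega>)\<^sup>2)"
    using variance_eq[OF int X(2)] variance_positive[of X] by simp
  then have "(expectation X)\<^sup>2 \<le> c\<^sup>2" using X(3) by simp
  then show "expectation X \<le> c" using c by (rule power2_le_imp_le)
qed

end

context lipschitz_coefficients
begin

text \<open>The two schemes share their noise, so the mean square contraction bounds the mean
  distance. Only the elapsed time enters the constant, not the number of steps.\<close>

lemma euler_expectation_lipschitz:
  assumes \<tau>: "fine_partition 1 m \<tau>" and p: "p \<le> m" and h: "bounded_lipschitz B K h"
  shows "\<bar>expectation (\<lambda>\<omega>. h (euler f g \<tau> x p \<omega>)) - expectation (\<lambda>\<omega>. h (euler f g \<tau> y p \<omega>))\<bar>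
    \<le> K * exp (growth_rate L * \<tau> p) * norm (x - y)"
proof -
  let ?D = "\<lambda>\<omega>. norm (euler f g \<tau> x p \<omega> - euler f g \<tau> y p \<omega>)"
  let ?E = "exp (growth_rate L * \<tau> p)"
  note hD = bounded_lipschitzD[OF h]
  have e: "euler f g \<tau> z p \<in> borel_measurable M" for z
    by (rule measurable_F_M[OF euler_measurable[OF \<tau> p]])
  have D: "?D \<in> borel_measurable M" using e[of x] e[of y] by measurable
  have "0 \<le> \<tau> p" using fine_partitionD(5)[OF \<tau> p] .
  then have E1: "1 \<le> ?E" using growth_rate_pos[OF L_nonneg] by simp
  \<comment> \<open>The exponential factor is at least 1, hence below its square; this spares a
    square root at the price of a larger rate.\<close>
  have "?E * (norm (x - y))\<^sup>2 \<le> ?E\<^sup>2 * (norm (x - y))\<^sup>2"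
    using E1 by (intro mult_right_mono) (auto simp: power2_eq_square)
  then have "expectation (\<lambda>\<omega>. (?D \<omega>)\<^sup>2) \<le> (?E * norm (x - y))\<^sup>2"
    using euler_contraction(2)[OF \<tau> p, of x y] by (simp add: power_mult_distrib)
  from expectation_le_of_second_moment[OF D euler_contraction(1)[OF \<tau> p] this]
  have intD: "integrable M ?D" and ED: "expectation ?D \<le> ?E * norm (x - y)" by auto
  have int: "integrable M (\<lambda>\<omega>. h (euler f g \<tau> z p \<omega>))" for z
    by (rule integrable_bounded[OF measurable_compose[OF e hD(5)] hD(3)])
  have "\<bar>expectation (\<lambda>\<omega>. h (euler f g \<tau> x p \<omega>)) - expectation (\<lambda>\<omega>. h (euler f g \<tau> y p \<omega>))\<bar>
      = \<bar>expectation (\<lambda>\<omega>. h (euler f g \<tau> x p \<omega>) - h (euler f g \<tau> y p \<omega>))\<bar>"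
    using int by simp
  also have "\<dots> \<le> expectation (\<lambda>\<omega>. \<bar>h (euler f g \<tau> x p \<omega>) - h (euler f g \<tau> y p \<omega>)\<bar>)"
    by (rule integral_abs_bound)
  also have "\<dots> \<le> expectation (\<lambda>\<omega>. K * ?D \<omega>)"
    by (rule integral_mono) (use int intD hD(4) in auto)
  also have "\<dots> \<le> K * (?E * norm (x - y))"
    using ED hD(2) by (simp add: mult_left_mono)
  finally show ?thesis by (simp add: mult.assoc)
qed

text \<open>The last step is peeled off by the Markov property, which replaces \<open>h\<close> by
  \<open>euler_op \<delta> h\<close>; hence \<open>h\<close> is generalized. Only the steps after
  node p need the common length \<delta>, so earlier steps may have another one.\<close>

lemma expectation_euler_iterate:
  assumes \<tau>: "fine_partition d m \<tau>" and pk: "p + k \<le> m"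
    and step: "\<And>q. p \<le> q \<Longrightarrow> q < p + k \<Longrightarrow> \<tau> (Suc q) - \<tau> q = \<delta>" and \<delta>: "0 \<le> \<delta>"
    and h: "h \<in> borel_measurable borel" "\<And>x. \<bar>h x\<bar> \<le> B"
  shows "expectation (\<lambda>\<omega>. h (euler f g \<tau> x (p + k) \<omega>)) = expectation (\<lambda>\<omega>. (euler_op \<delta> ^^ k) h (euler f g \<tau> x p \<omega>))"
  using pk step h
proof (induction k arbitrary: h)
  case 0
  then show ?case by simp
next
  case (Suc k)
  have "expectation (\<lambda>\<omega>. h (euler f g \<tau> x (Suc (p + k)) \<omega>))
      = expectation (\<lambda>\<omega>. euler_op (\<tau> (Suc (p + k)) - \<tau> (p + k)) h (euler f g \<tau> x (p + k) \<omega>))"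
    by (rule expectation_euler_Suc[OF \<tau> _ Suc.prems(3,4)]) (use Suc.prems in simp)
  also have "\<dots> = expectation (\<lambda>\<omega>. euler_op \<delta> h (euler f g \<tau> x (p + k) \<omega>))"
    using Suc.prems(2)[of "p + k"] by simp
  also have "\<dots> = expectation (\<lambda>\<omega>. (euler_op \<delta> ^^ k) (euler_op \<delta> h) (euler f g \<tau> x p \<omega>))"
    by (rule Suc.IH) (use Suc.prems euler_op_bounded_measurable[OF \<delta> Suc.prems(3,4)] in auto)
  finally show ?case by (simp add: funpow_swap1)
qed

lemma fine_partition_uniform: "0 < \<delta> \<Longrightarrow> \<delta> < d \<Longrightarrow> fine_partition d N (\<lambda>k. real k * \<delta>)"
  by (simp add: fine_partition_def algebra_simps)

lemma euler_op_iterate: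
  assumes "0 < \<delta>" and h: "h \<in> borel_measurable borel" "\<And>x. \<bar>h x\<bar> \<le> B"
  shows "(euler_op \<delta> ^^ k) h x = expectation (\<lambda>\<omega>. h (euler f g (\<lambda>k. real k * \<delta>) x k \<omega>))"
proof -
  have "fine_partition (\<delta> + 1) k (\<lambda>k. real k * \<delta>)" using assms by (intro fine_partition_uniform) auto
  from expectation_euler_iterate[OF this, of 0 k \<delta> h B x] assms expectation_const
  show ?thesis by (simp add: algebra_simps)
qed

end

section \<open>Weak limits of the scheme and the transition kernels\<close>

locale sde_flow = lipschitz_coefficients P f g L
  for P :: "(real \<Rightarrow> real^'d) measure" and f :: "real^'n \<Rightarrow> real^'n" and g :: "real^'n \<Rightarrow> real^'d^'n" and L +
  fixes X :: "real \<Rightarrow> real^'n \<Rightarrow> (real \<Rightarrow> real^'d) \<Rightarrow> real^'n"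
  assumes solution: "sde_solution P f g x (\<lambda>t. X t x)"
begin

lemma X_measurable: "0 \<le> t \<Longrightarrow> X t x \<in> borel_measurable M"
  using solution[of x] unfolding sde_solution_def by (auto intro: measurable_F_M)

definition transition :: "real \<Rightarrow> real^'n \<Rightarrow> (real^'n) measure" where
  "transition t x = distr M borel (X t x)"

lemma prob_space_transition: "0 \<le> t \<Longrightarrow> prob_space (transition t x)"
  unfolding transition_def by (rule prob_space_distr[OF X_measurable])

lemma sets_transition: "sets (transition t x) = sets borel"
  by (simp add: transition_def)

lemma integral_transition:
  "0 \<le> t \<Longrightarrow> h \<in> borel_measurable borel \<Longrightarrow> (\<integral>y. h y \<partial>transition t x) = expectation (\<lambda>\<omega>. h (X t x \<omega>) :: real)"
  unfolding transition_def by (rule integral_distr[OF X_measurable])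

lemma distance_sets:
  assumes "Y \<in> borel_measurable M" "Z \<in> borel_measurable M"
  shows "{\<omega>\<in>space M. norm (Y \<omega> - Z \<omega> :: real^'n) > \<epsilon>} \<in> sets M"
  using assms by measurable

lemma euler_weak_limit:
  assumes h: "bounded_lipschitz B K h" and T: "0 \<le> T" and \<epsilon>: "0 < \<epsilon>"
  obtains d where "0 < d" "d \<le> 1"
    "\<And>m \<tau>. fine_partition d m \<tau> \<Longrightarrow> \<tau> m \<le> T \<Longrightarrow>
       \<bar>expectation (\<lambda>\<omega>. h (X (\<tau> m) x \<omega>)) - expectation (\<lambda>\<omega>. h (euler f g \<tau> x m \<omega>))\<bar> \<le> \<epsilon>"
proof -
  note hD = bounded_lipschitzD[OF h]
  \<comment> \<open>With e as both the distance and the probability of exceeding it, the total error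
    is at most \<open>K * e + 2 * B * e\<close>, which is below \<epsilon>.\<close>
  define e where "e = \<epsilon> / (K + 2 * B + 1)"
  have e: "0 < e" using \<epsilon> hD(1,2) by (simp add: e_def)
  obtain d where d: "0 < d" "d \<le> 1"
    "\<And>m \<tau>. fine_partition d m \<tau> \<Longrightarrow> \<tau> m \<le> T \<Longrightarrow>
       prob {\<omega>\<in>space M. norm (X (\<tau> m) x \<omega> - euler f g \<tau> x m \<omega>) > e} < e"
    by (rule euler_converges[OF solution T e]) (rule that)
  show thesis
  proof (rule that[OF d(1,2)])
    fix m \<tau> assume \<tau>: "fine_partition d m \<tau>" "\<tau> m \<le> T"
    have Xm: "X (\<tau> m) x \<in> borel_measurable M"
      by (rule X_measurable) (rule fine_partitionD(5)[OF \<tau>(1)], simp)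
    have em: "euler f g \<tau> x m \<in> borel_measurable M"
      by (rule measurable_F_M[OF euler_measurable[OF \<tau>(1)]]) simp
    let ?A = "{\<omega>\<in>space M. norm (X (\<tau> m) x \<omega> - euler f g \<tau> x m \<omega>) > e}"
    have "\<bar>expectation (\<lambda>\<omega>. h (X (\<tau> m) x \<omega>)) - expectation (\<lambda>\<omega>. h (euler f g \<tau> x m \<omega>))\<bar> \<le> K * e + 2 * B * prob ?A"
    proof (rule expectation_diff_le[OF Xm em hD(5,3) hD(5,3) distance_sets[OF Xm em]])
      fix \<omega> assume "\<omega> \<in> space M - ?A"
      then have "norm (X (\<tau> m) x \<omega> - euler f g \<tau> x m \<omega>) \<le> e" by auto
      then show "\<bar>h (X (\<tau> m) x \<omega>) - h (euler f g \<tau> x m \<omega>)\<bar> \<le> K * e"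
        using hD(4)[of "X (\<tau> m) x \<omega>" "euler f g \<tau> x m \<omega>"] mult_left_mono[OF _ hD(2)]
        by (meson order_trans)
    qed (use hD e in simp)
    also have "\<dots> \<le> K * e + 2 * B * e"
      using d(3)[OF \<tau>] hD(1) by (intro add_left_mono mult_left_mono) auto
    also have "\<dots> \<le> (K + 2 * B + 1) * e" using e by (simp add: algebra_simps)
    also have "\<dots> = \<epsilon>" using hD(1,2) by (simp add: e_def)
    finally show "\<bar>expectation (\<lambda>\<omega>. h (X (\<tau> m) x \<omega>)) - expectation (\<lambda>\<omega>. h (euler f g \<tau> x m \<omega>))\<bar> \<le> \<epsilon>" .
  qed
qed

text \<open>The partition without steps has horizon 0, and on it the scheme is the starting point
  itself.\<close>

lemma expectation_X_0:
  assumes h: "bounded_lipschitz B K h"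
  shows "expectation (\<lambda>\<omega>. h (X 0 x \<omega>)) = h x"
proof -
  have "\<bar>expectation (\<lambda>\<omega>. h (X 0 x \<omega>)) - h x\<bar> \<le> \<epsilon>" if \<epsilon>: "0 < \<epsilon>" for \<epsilon>
  proof -
    obtain d where "0 < d" "d \<le> 1" and d: "\<And>m \<tau>. fine_partition d m \<tau> \<Longrightarrow> \<tau> m \<le> 0 \<Longrightarrow>
       \<bar>expectation (\<lambda>\<omega>. h (X (\<tau> m) x \<omega>)) - expectation (\<lambda>\<omega>. h (euler f g \<tau> x m \<omega>))\<bar> \<le> \<epsilon>"
      by (rule euler_weak_limit[OF h order_refl \<epsilon>]) (rule that)
    have "fine_partition d 0 (\<lambda>_. 0)" by (simp add: fine_partition_def)
    from d[OF this] show ?thesis by (simp only: euler.simps expectation_const order_refl)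
  qed
  then have "\<bar>expectation (\<lambda>\<omega>. h (X 0 x \<omega>)) - h x\<bar> \<le> 0" by (rule field_le_epsilon) simp
  then show ?thesis by simp
qed

lemma transition_0: "transition 0 x = return borel x"
proof (rule prob_eqI_lipschitz)
  show "(\<integral>y. h y \<partial>transition 0 x) = (\<integral>y. h y \<partial>return borel x)" if "bounded_lipschitz B K h" for B K h
    using integral_transition[of 0 h x] expectation_X_0[OF that] bounded_lipschitzD(5)[OF that]
    by (simp add: integral_return)
qed (simp_all add: sets_transition prob_space_transition prob_space_return)

lemma mesh_tendsto_0: "(\<lambda>n. t / real (Suc n)) \<longlonglongrightarrow> 0"
  by (rule LIMSEQ_Suc[OF lim_const_over_n])

lemma euler_op_iterate_tendsto:
  assumes h: "bounded_lipschitz B K h" and t: "0 < t"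
  shows "(\<lambda>n. (euler_op (t / real (Suc n)) ^^ Suc n) h x) \<longlonglongrightarrow> expectation (\<lambda>\<omega>. h (X t x \<omega>))"
proof (rule tendstoI)
  fix \<epsilon> :: real assume \<epsilon>: "0 < \<epsilon>"
  then have \<epsilon>2: "0 < \<epsilon> / 2" by simp
  note hD = bounded_lipschitzD[OF h]
  obtain d where "0 < d" "d \<le> 1" and d: "\<And>m \<tau>. fine_partition d m \<tau> \<Longrightarrow> \<tau> m \<le> t \<Longrightarrow>
       \<bar>expectation (\<lambda>\<omega>. h (X (\<tau> m) x \<omega>)) - expectation (\<lambda>\<omega>. h (euler f g \<tau> x m \<omega>))\<bar> \<le> \<epsilon> / 2"
    by (rule euler_weak_limit[OF h less_imp_le[OF t] \<epsilon>2]) (rule that)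
  have "\<forall>\<^sub>F n in sequentially. t / real (Suc n) < d"
    using mesh_tendsto_0 \<open>0 < d\<close> by (rule order_tendstoD(2))
  then show "\<forall>\<^sub>F n in sequentially. dist ((euler_op (t / real (Suc n)) ^^ Suc n) h x) (expectation (\<lambda>\<omega>. h (X t x \<omega>))) < \<epsilon>"
  proof eventually_elim
    case (elim n)
    let ?\<delta> = "t / real (Suc n)"
    have \<delta>: "0 < ?\<delta>" using t by simp
    have "fine_partition d (Suc n) (\<lambda>k. real k * ?\<delta>)" using \<delta> elim by (rule fine_partition_uniform)
    from d[OF this] have "\<bar>expectation (\<lambda>\<omega>. h (X t x \<omega>)) - expectation (\<lambda>\<omega>. h (euler f g (\<lambda>k. real k * ?\<delta>) x (Suc n) \<omega>))\<bar> \<le> \<epsilon> / 2"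
      by simp
    then have "\<bar>expectation (\<lambda>\<omega>. h (X t x \<omega>)) - (euler_op ?\<delta> ^^ Suc n) h x\<bar> \<le> \<epsilon> / 2"
      unfolding euler_op_iterate[OF \<delta> hD(5,3)] .
    then show ?case using \<epsilon> by (simp add: dist_real_def abs_minus_commute del: funpow.simps)
  qed
qed

text \<open>The total time of the \<open>Suc n\<close> steps is always t, so the Lipschitz constant
  is free of n. This equicontinuity is the key to the semigroup law.\<close>

lemma euler_op_iterate_bounded_lipschitz:
  assumes h: "bounded_lipschitz B K h" and t: "0 < t" "t / real (Suc n) < 1"
  shows "bounded_lipschitz B (K * exp (growth_rate L * t)) ((euler_op (t / real (Suc n)) ^^ Suc n) h)"
  unfolding bounded_lipschitz_def
proof (intro conjI allI)
  let ?\<delta> = "t / real (Suc n)"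
  note hD = bounded_lipschitzD[OF h]
  have \<delta>: "0 < ?\<delta>" using t by simp
  have \<tau>: "fine_partition 1 (Suc n) (\<lambda>k. real k * ?\<delta>)" by (rule fine_partition_uniform[OF \<delta> t(2)])
  show "0 \<le> B" "0 \<le> K * exp (growth_rate L * t)" using hD by auto
  fix x y :: "real^'n"
  show "\<bar>(euler_op ?\<delta> ^^ Suc n) h x - (euler_op ?\<delta> ^^ Suc n) h y\<bar> \<le> K * exp (growth_rate L * t) * norm (x - y)"
    unfolding euler_op_iterate[OF \<delta> hD(5,3)]
    using euler_expectation_lipschitz[OF \<tau> order_refl h, of x y] by simp
  have "(\<lambda>\<omega>. h (euler f g (\<lambda>k. real k * ?\<delta>) x (Suc n) \<omega>)) \<in> borel_measurable M"
    by (rule measurable_compose[OF measurable_F_M[OF euler_measurable[OF \<tau> order_refl]] hD(5)])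
  then have int: "integrable M (\<lambda>\<omega>. h (euler f g (\<lambda>k. real k * ?\<delta>) x (Suc n) \<omega>))"
    by (rule integrable_bounded) (rule hD(3))
  have "\<bar>(euler_op ?\<delta> ^^ Suc n) h x\<bar> \<le> expectation (\<lambda>\<omega>. \<bar>h (euler f g (\<lambda>k. real k * ?\<delta>) x (Suc n) \<omega>)\<bar>)"
    unfolding euler_op_iterate[OF \<delta> hD(5,3)] by (rule integral_abs_bound)
  also have "\<dots> \<le> expectation (\<lambda>_. B)"
    by (rule integral_mono) (use int hD(3) in auto)
  also have "\<dots> = B" by (rule expectation_const)
  finally show "\<bar>(euler_op ?\<delta> ^^ Suc n) h x\<bar> \<le> B" .
qed

text \<open>Measurability in the starting point is inherited from the iterates of the one-step
  operator, which converge pointwise.\<close>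

lemma expectation_X_measurable:
  assumes h: "bounded_lipschitz B K h" and t: "0 \<le> t"
  shows "(\<lambda>x. expectation (\<lambda>\<omega>. h (X t x \<omega>))) \<in> borel_measurable borel"
proof (cases "t = 0")
  case True
  then show ?thesis using expectation_X_0[OF h] bounded_lipschitzD(5)[OF h] by simp
next
  case False
  then have t: "0 < t" using t by simp
  note hD = bounded_lipschitzD[OF h]
  show ?thesis
  proof (rule borel_measurable_LIMSEQ_real[OF euler_op_iterate_tendsto[OF h t]])
    fix n
    have "(euler_op (t / real (Suc n)) ^^ k) h \<in> borel_measurable borel \<and> (\<forall>x. \<bar>(euler_op (t / real (Suc n)) ^^ k) h x\<bar> \<le> B)" for k
      by (induction k) (use hD t euler_op_bounded_measurable[of "t / real (Suc n)" _ B] in auto)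
    then show "(euler_op (t / real (Suc n)) ^^ Suc n) h \<in> borel_measurable borel" by blast
  qed
qed

text \<open>Closed sets suffice as a generator, and the measure of a closed set is a limit of
  integrals of bounded Lipschitz functions, which depend measurably on x.\<close>

lemma transition_measurable:
  assumes t: "0 \<le> t"
  shows "transition t \<in> borel \<rightarrow>\<^sub>M prob_algebra borel"
proof (rule measurable_prob_algebra_generated[OF sets_borel_closed Int_stable_closed])
  show "(\<lambda>x. emeasure (transition t x) C) \<in> borel_measurable borel" if "C \<in> Collect closed" for C
  proof (cases "C = {}")
    case False
    then have C: "closed C" "C \<noteq> {}" using that by auto
    have fin: "finite_measure (transition t x)" for x
      using prob_space_transition[OF t] by (rule prob_space.finite_measure)
    have "(\<lambda>x. measure (transition t x) C) \<in> borel_measurable borel"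
    proof (rule borel_measurable_LIMSEQ_real[OF closed_approx_tendsto_measure[OF fin sets_transition C]])
      show "(\<lambda>x. \<integral>y. closed_approx C k y \<partial>transition t x) \<in> borel_measurable borel" for k
        using expectation_X_measurable[OF bounded_lipschitz_closed_approx[of k C] t]
        unfolding integral_transition[OF t bounded_lipschitzD(5)[OF bounded_lipschitz_closed_approx[of k C]]] .
    qed
    then show ?thesis
      using fin by (simp add: finite_measure.emeasure_eq_measure)
  qed simp
qed (use prob_space_transition[OF t] sets_transition in auto)

lemma expectation_transition_measurable:
  assumes t: "0 \<le> t" and h: "h \<in> borel_measurable borel"
  shows "(\<lambda>x. expectation (\<lambda>\<omega>. h (X t x \<omega>) :: real)) \<in> borel_measurable borel"
proof -
  have "(\<lambda>x. \<integral>y. h y \<partial>transition t x) \<in> borel_measurable borel"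
    by (rule measurable_compose[OF measurable_prob_algebraD[OF transition_measurable[OF t]]
          integral_measurable_subprob_algebra[OF h]])
  then show ?thesis unfolding integral_transition[OF t h] .
qed

text \<open>On a partition made of \<open>N\<close> equal steps up to \<open>t\<close> followed by \<open>N\<close> equal steps up to \<open>t + s\<close> the
  Euler scheme has the Markov property by construction; the semigroup property is its limit.\<close>

lemma chapman_kolmogorov_lipschitz:
  assumes h: "bounded_lipschitz B K h" and t: "0 < t" and s: "0 < s"
  shows "expectation (\<lambda>\<omega>. h (X (t + s) x \<omega>)) = expectation (\<lambda>\<omega>. expectation (\<lambda>\<omega>'. h (X s (X t x \<omega>) \<omega>')))"
proof -
  note hD = bounded_lipschitzD[OF h]
  \<comment> \<open>The two formulas agree at the junction \<open>k = Suc n\<close>, where the time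
    is t.\<close>
  define \<tau> where "\<tau> n k = (if k \<le> Suc n then real k * (t / real (Suc n)) else t + real (k - Suc n) * (s / real (Suc n)))" for n k
  define u where "u n = (euler_op (s / real (Suc n)) ^^ Suc n) h" for n
  let ?K = "K * exp (growth_rate L * s)"
  have step1: "\<tau> n (Suc q) - \<tau> n q = t / real (Suc n)" if "q < Suc n" for n q
    using that unfolding \<tau>_def by (simp add: algebra_simps add_divide_distrib[symmetric] diff_divide_distrib[symmetric])
  have step2: "\<tau> n (Suc q) - \<tau> n q = s / real (Suc n)" if "Suc n \<le> q" for n q
  proof -
    have "\<tau> n q = t + real (q - Suc n) * (s / real (Suc n))"
      using that unfolding \<tau>_def by (cases "q = Suc n") auto
    moreover have "\<tau> n (Suc q) = t + real (Suc q - Suc n) * (s / real (Suc n))"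
      using that unfolding \<tau>_def by auto
    moreover have "real (Suc q - Suc n) = real (q - Suc n) + 1" using that by (simp add: of_nat_diff)
    ultimately have "\<tau> n (Suc q) - \<tau> n q
        = (t + (real (q - Suc n) + 1) * (s / real (Suc n))) - (t + real (q - Suc n) * (s / real (Suc n)))"
      by (simp only:)
    then show ?thesis by (simp only: distrib_right)
  qed
  have fine: "fine_partition d m (\<tau> n)" if "t / real (Suc n) < d" "s / real (Suc n) < d" for d n m
    unfolding fine_partition_def
  proof (intro conjI allI impI)
    show "\<tau> n 0 = 0" by (simp add: \<tau>_def)
    fix k
    have "\<tau> n (Suc k) - \<tau> n k = t / real (Suc n) \<or> \<tau> n (Suc k) - \<tau> n k = s / real (Suc n)"
      using step1[of k n] step2[of n k] by linarith
    moreover have "0 < t / real (Suc n)" "0 < s / real (Suc n)" using s t by auto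
    ultimately show "\<tau> n k < \<tau> n (Suc k)" "\<tau> n (Suc k) - \<tau> n k < d" using that by auto
  qed
  have \<tau>N: "\<tau> n (Suc n) = t" "\<tau> n (Suc n + Suc n) = t + s" for n by (simp_all add: \<tau>_def)
  have small: "\<forall>\<^sub>F n in sequentially. t / real (Suc n) < d \<and> s / real (Suc n) < d" if "0 < d" for d
    by (intro eventually_conj order_tendstoD(2)[OF mesh_tendsto_0 that])
  \<comment> \<open>A crude bound on the mesh, valid for every n: the factorization below is exact
    and only needs the nodes to form some partition.\<close>
  have quot_le: "a / real (Suc n) < t + s + 1" if "0 < a" "a \<le> t + s" for a n
  proof -
    have "a / real (Suc n) \<le> a / 1" using that by (intro divide_left_mono) auto
    then show ?thesis using that by simp
  qed
  \<comment> \<open>The second block of steps, all of length \<open>s / real (Suc n)\<close>, is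
    absorbed into iterates of the one-step operator, which act on the position at time t.\<close>
  have factor: "expectation (\<lambda>\<omega>. h (euler f g (\<tau> n) x (Suc n + Suc n) \<omega>)) = expectation (\<lambda>\<omega>. u n (euler f g (\<tau> n) x (Suc n) \<omega>))" for n
    unfolding u_def
    by (rule expectation_euler_iterate[OF fine[of n "t + s + 1" "Suc n + Suc n"] order_refl step2 _ hD(5,3)])
      (use t s in \<open>auto intro!: quot_le divide_nonneg_nonneg simp del: of_nat_Suc\<close>)
  have lim1: "(\<lambda>n. expectation (\<lambda>\<omega>. h (euler f g (\<tau> n) x (Suc n + Suc n) \<omega>))) \<longlonglongrightarrow> expectation (\<lambda>\<omega>. h (X (t + s) x \<omega>))"
  proof (rule tendstoI)
    fix \<epsilon> :: real assume "0 < \<epsilon>"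
    then have \<epsilon>2: "0 < \<epsilon> / 2" by simp
    have ts: "0 \<le> t + s" using t s by simp
    obtain d where "0 < d" "d \<le> 1" and d: "\<And>m \<tau>. fine_partition d m \<tau> \<Longrightarrow> \<tau> m \<le> t + s \<Longrightarrow>
       \<bar>expectation (\<lambda>\<omega>. h (X (\<tau> m) x \<omega>)) - expectation (\<lambda>\<omega>. h (euler f g \<tau> x m \<omega>))\<bar> \<le> \<epsilon> / 2"
      by (rule euler_weak_limit[OF h ts \<epsilon>2]) (rule that)
    show "\<forall>\<^sub>F n in sequentially. dist (expectation (\<lambda>\<omega>. h (euler f g (\<tau> n) x (Suc n + Suc n) \<omega>))) (expectation (\<lambda>\<omega>. h (X (t + s) x \<omega>))) < \<epsilon>"
      using small[OF \<open>0 < d\<close>]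
    proof eventually_elim
      case (elim n)
      then have "fine_partition d (Suc n + Suc n) (\<tau> n)" by (intro fine) auto
      from d[OF this, unfolded \<tau>N, OF order_refl] show ?case
        unfolding dist_real_def using \<open>0 < \<epsilon>\<close> by linarith
    qed
  qed
  \<comment> \<open>The function \<open>u n\<close> varies with n, but with one Lipschitz constant;
    hence convergence in probability of the scheme at time t still makes the difference
    vanish.\<close>
  have lim2: "(\<lambda>n. expectation (\<lambda>\<omega>. u n (X t x \<omega>)) - expectation (\<lambda>\<omega>. u n (euler f g (\<tau> n) x (Suc n) \<omega>))) \<longlonglongrightarrow> 0"
  proof (rule tendstoI)
    fix \<epsilon> :: real assume \<epsilon>: "0 < \<epsilon>"
    have K: "0 \<le> ?K" using hD by simp
    define e where "e = \<epsilon> / (?K + 2 * B + 1)"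
    have e: "0 < e" using \<epsilon> hD(1) K unfolding e_def by (intro divide_pos_pos add_nonneg_pos) auto
    have t0: "0 \<le> t" using t by simp
    obtain d where d: "0 < d" "d \<le> 1"
      "\<And>m \<tau>. fine_partition d m \<tau> \<Longrightarrow> \<tau> m \<le> t \<Longrightarrow>
         prob {\<omega>\<in>space M. norm (X (\<tau> m) x \<omega> - euler f g \<tau> x m \<omega>) > e} < e"
      by (rule euler_converges[OF solution t0 e]) (rule that)
    show "\<forall>\<^sub>F n in sequentially. dist (expectation (\<lambda>\<omega>. u n (X t x \<omega>)) - expectation (\<lambda>\<omega>. u n (euler f g (\<tau> n) x (Suc n) \<omega>))) 0 < \<epsilon>"
      using small[OF d(1)]
    proof eventually_elim
      case (elim n)
      then have \<tau>: "fine_partition d (Suc n) (\<tau> n)" by (intro fine) auto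
      have "s / real (Suc n) < 1" using elim d(2) by linarith
      then have un: "bounded_lipschitz B ?K (u n)"
        unfolding u_def by (rule euler_op_iterate_bounded_lipschitz[OF h s])
      note uD = bounded_lipschitzD[OF un]
      have Xm: "X t x \<in> borel_measurable M" by (rule X_measurable[OF t0])
      have em: "euler f g (\<tau> n) x (Suc n) \<in> borel_measurable M"
        by (rule measurable_F_M[OF euler_measurable[OF \<tau>]]) simp
      let ?A = "{\<omega>\<in>space M. norm (X t x \<omega> - euler f g (\<tau> n) x (Suc n) \<omega>) > e}"
      have PA: "prob ?A < e" using d(3)[OF \<tau>] unfolding \<tau>N by simp
      have "\<bar>expectation (\<lambda>\<omega>. u n (X t x \<omega>)) - expectation (\<lambda>\<omega>. u n (euler f g (\<tau> n) x (Suc n) \<omega>))\<bar> \<le> ?K * e + 2 * B * prob ?A"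
      proof (rule expectation_diff_le[OF Xm em uD(5,3) uD(5,3) distance_sets[OF Xm em]])
        fix \<omega> assume "\<omega> \<in> space M - ?A"
        then have "norm (X t x \<omega> - euler f g (\<tau> n) x (Suc n) \<omega>) \<le> e" by (auto simp: not_less)
        then show "\<bar>u n (X t x \<omega>) - u n (euler f g (\<tau> n) x (Suc n) \<omega>)\<bar> \<le> ?K * e"
          by (rule order_trans[OF uD(4) mult_left_mono[OF _ uD(2)]])
      qed (use K e in simp)
      also have "\<dots> \<le> ?K * e + 2 * B * e"
        using PA hD(1) by (intro add_left_mono mult_left_mono) auto
      also have "\<dots> < (?K + 2 * B + 1) * e" using e by (simp add: algebra_simps)
      also have "\<dots> = \<epsilon>" using hD(1) K unfolding e_def by simp
      finally show ?case by (simp add: dist_real_def)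
    qed
  qed
  \<comment> \<open>Now the argument \<open>X t x\<close> is fixed, so pointwise convergence of the
    iterates and their common bound \<open>B\<close> are enough.\<close>
  have lim3: "(\<lambda>n. expectation (\<lambda>\<omega>. u n (X t x \<omega>))) \<longlonglongrightarrow> expectation (\<lambda>\<omega>. expectation (\<lambda>\<omega>'. h (X s (X t x \<omega>) \<omega>')))"
  proof (rule integral_dominated_convergence[where w = "\<lambda>_. B"])
    have Xm: "X t x \<in> borel_measurable M" using t by (intro X_measurable) simp
    show "(\<lambda>\<omega>. expectation (\<lambda>\<omega>'. h (X s (X t x \<omega>) \<omega>'))) \<in> borel_measurable M"
      using s by (intro measurable_compose[OF Xm expectation_X_measurable[OF h]]) simp
    have iter: "(euler_op (s / real (Suc n)) ^^ k) h \<in> borel_measurable borel \<and> (\<forall>x. \<bar>(euler_op (s / real (Suc n)) ^^ k) h x\<bar> \<le> B)" for n k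
      by (induction k) (use hD s euler_op_bounded_measurable[of "s / real (Suc n)" _ B] in auto)
    show "(\<lambda>\<omega>. u n (X t x \<omega>)) \<in> borel_measurable M" for n
      unfolding u_def using iter[of "Suc n" n] by (intro measurable_compose[OF Xm]) blast
    show "AE \<omega> in M. norm (u n (X t x \<omega>)) \<le> B" for n
      unfolding u_def using iter[of "Suc n" n] by (intro AE_I2) (simp only: real_norm_def)
    show "AE \<omega> in M. (\<lambda>n. u n (X t x \<omega>)) \<longlonglongrightarrow> expectation (\<lambda>\<omega>'. h (X s (X t x \<omega>) \<omega>'))"
      unfolding u_def by (intro AE_I2 euler_op_iterate_tendsto[OF h s])
  qed simp
  have "(\<lambda>n. expectation (\<lambda>\<omega>. u n (X t x \<omega>)) - (expectation (\<lambda>\<omega>. u n (X t x \<omega>))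
      - expectation (\<lambda>\<omega>. u n (euler f g (\<tau> n) x (Suc n) \<omega>)))) \<longlonglongrightarrow> expectation (\<lambda>\<omega>. expectation (\<lambda>\<omega>'. h (X s (X t x \<omega>) \<omega>'))) - 0"
    by (rule tendsto_diff[OF lim3 lim2])
  then have "(\<lambda>n. expectation (\<lambda>\<omega>. h (euler f g (\<tau> n) x (Suc n + Suc n) \<omega>))) \<longlonglongrightarrow> expectation (\<lambda>\<omega>. expectation (\<lambda>\<omega>'. h (X s (X t x \<omega>) \<omega>')))"
    unfolding factor by simp
  with lim1 show ?thesis by (rule LIMSEQ_unique)
qed

text \<open>By the Lipschitz case \<open>transition (t + s) x\<close> and the composition
  \<open>transition t x \<bind> transition s\<close> have equal integrals of bounded Lipschitz
  functions. They are therefore the same measure, which gives the identity for bounded measurable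
  \<open>h\<close>.\<close>

lemma chapman_kolmogorov:
  assumes t: "0 \<le> t" and s: "0 \<le> s" and h: "h \<in> borel_measurable borel" "\<And>x. \<bar>h x :: real\<bar> \<le> B"
  shows "expectation (\<lambda>\<omega>. h (X (t + s) x \<omega>)) = expectation (\<lambda>\<omega>. expectation (\<lambda>\<omega>'. h (X s (X t x \<omega>) \<omega>')))"
proof -
  have h0: "expectation (\<lambda>\<omega>. k (X 0 y \<omega>)) = k y" if "k \<in> borel_measurable borel" for k :: "real^'n \<Rightarrow> real" and y
    using integral_transition[OF order_refl that, of y] that by (simp add: transition_0 integral_return)
  show ?thesis
  \<comment> \<open>The Lipschitz case works with steps of positive length; at time 0 the kernel is
    a point mass.\<close>
  proof (cases "t = 0 \<or> s = 0")
    case True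
    then show ?thesis
      using h0[OF expectation_transition_measurable[OF s h(1)]] h0[OF h(1)] by auto
  next
    case False
    then have ts: "0 < t" "0 < s" "0 \<le> t + s" using s t by auto
    note kernel = measurable_prob_algebraD[OF transition_measurable[OF s]]
    have kernel': "transition s \<in> measurable (transition t x) (subprob_algebra borel)"
      using kernel measurable_cong_sets[OF sets_transition refl] by blast
    have fin: "finite_measure (transition t x)"
      using prob_space_transition[OF t] by (rule prob_space.finite_measure)
    have bound: "AE y in transition t x. emeasure (transition s y) (space (transition s y)) \<le> ennreal 1"
      using prob_space.emeasure_space_1[OF prob_space_transition[OF s]] by simp
    have bind: "(\<integral>y. k y \<partial>(transition t x \<bind> transition s)) = expectation (\<lambda>\<omega>. expectation (\<lambda>\<omega>'. k (X s (X t x \<omega>) \<omega>')))"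
      if k: "k \<in> borel_measurable borel" "\<And>x. \<bar>k x\<bar> \<le> C" for k :: "real^'n \<Rightarrow> real" and C
    proof -
      have "(\<integral>y. k y \<partial>(transition t x \<bind> transition s)) = (\<integral>y. (\<integral>z. k z \<partial>transition s y) \<partial>transition t x)"
        by (rule integral_bind[OF k(1) _ kernel' fin bound]) (use k(2) in auto)
      also have "\<dots> = (\<integral>y. expectation (\<lambda>\<omega>'. k (X s y \<omega>')) \<partial>transition t x)"
        unfolding integral_transition[OF s k(1)] ..
      also have "\<dots> = expectation (\<lambda>\<omega>. expectation (\<lambda>\<omega>'. k (X s (X t x \<omega>) \<omega>')))"
        by (rule integral_transition[OF t expectation_transition_measurable[OF s k(1)]])
      finally show ?thesis .
    qed
    have "transition (t + s) x = transition t x \<bind> transition s"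
    proof (rule prob_eqI_lipschitz[OF prob_space_transition[OF ts(3)] sets_transition])
      show "prob_space (transition t x \<bind> transition s)"
        by (rule prob_space_bind'[of _ borel])
          (use transition_measurable[OF s] prob_space_transition[OF t] sets_transition in \<open>auto simp: space_prob_algebra\<close>)
      show "sets (transition t x \<bind> transition s) = sets borel"
        by (rule sets_bind'[of _ borel])
          (use transition_measurable[OF s] prob_space_transition[OF t] sets_transition in \<open>auto simp: space_prob_algebra\<close>)
      show "(\<integral>y. k y \<partial>transition (t + s) x) = (\<integral>y. k y \<partial>(transition t x \<bind> transition s))"
        if k: "bounded_lipschitz C K k" for C K k
        using integral_transition[OF ts(3) bounded_lipschitzD(5)[OF k], of x]
          bind[OF bounded_lipschitzD(5,3)[OF k]] chapman_kolmogorov_lipschitz[OF k ts(1,2), of x] by simp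
    qed
    then show ?thesis
      using integral_transition[OF ts(3) h(1), of x] bind[OF h] by simp
  qed
qed

lemma expected_op_eq: "expected_op P X t h x = expectation (\<lambda>\<omega>. h (X t x \<omega>))"
  by (simp add: expected_op_def koopman_def skew_product_def tensor_one_def)

lemma bounded_measurableD:
  assumes "bounded_measurable h"
  obtains B where "h \<in> borel_measurable borel" "\<And>x. \<bar>h x\<bar> \<le> B"
  using assms unfolding bounded_measurable_def bounded_iff by auto

lemma markov_semigroup_expected_op: "markov_semigroup (expected_op P X)"
  unfolding markov_semigroup_def
proof (intro conjI allI impI)
  fix t :: real assume t: "0 \<le> t"
  show "markov_operator (expected_op P X t)"
    unfolding markov_operator_def
  proof (intro bexI[OF _ transition_measurable[OF t]] allI impI)
    fix h x assume "bounded_measurable (h :: real^'n \<Rightarrow> real)"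
    then show "expected_op P X t h x = (\<integral>y. h y \<partial>transition t x)"
      unfolding expected_op_eq bounded_measurable_def using integral_transition[OF t] by auto
  qed
next
  fix h :: "real^'n \<Rightarrow> real" assume "bounded_measurable h"
  then have h: "h \<in> borel_measurable borel" by (simp add: bounded_measurable_def)
  show "expected_op P X 0 h = h"
  proof (rule ext)
    fix x
    show "expected_op P X 0 h x = h x"
      using integral_transition[OF order_refl h, of x] h by (simp add: expected_op_eq transition_0 integral_return)
  qed
next
  fix s t :: real and h :: "real^'n \<Rightarrow> real"
  assume st: "0 \<le> s" "0 \<le> t" and h: "bounded_measurable h"
  obtain B where hB: "h \<in> borel_measurable borel" "\<And>x. \<bar>h x\<bar> \<le> B"
    using bounded_measurableD[OF h] by metis
  show "expected_op P X t (expected_op P X s h) = expected_op P X (s + t) h"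
  proof (rule ext)
    fix x
    show "expected_op P X t (expected_op P X s h) x = expected_op P X (s + t) h x"
      unfolding expected_op_eq add.commute[of s t]
      by (rule chapman_kolmogorov[OF st(2,1) hB, symmetric])
  qed
qed

end

section \<open>The generator\<close>

text \<open>The partial derivatives, defined by one-variable derivatives along the axes, are the
  values of the total derivative on the axis vectors; linearity and the chain rule do the
  rest.\<close>

lemma partial_deriv_along_line:
  fixes k :: "real^'n \<Rightarrow> real"
  assumes "\<And>y. k differentiable (at y)"
  shows "((\<lambda>s. k (x + s *\<^sub>R v)) has_real_derivative (\<Sum>i\<in>UNIV. v $ i * partial_deriv i k (x + s *\<^sub>R v))) (at s)"
proof -
  obtain D where D: "(k has_derivative D) (at (x + s *\<^sub>R v))"
    using assms unfolding differentiable_def by blast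
  interpret D: bounded_linear D by (rule has_derivative_bounded_linear[OF D])
  have line: "((\<lambda>r. y + r *\<^sub>R u) has_derivative (\<lambda>r. r *\<^sub>R u)) (at r0)" for y u :: "real^'n" and r0
    by (auto intro!: derivative_eq_intros)
  have pd: "partial_deriv i k (x + s *\<^sub>R v) = D (axis i 1)" for i
  proof -
    have "(k has_derivative D) (at ((\<lambda>r. (x + s *\<^sub>R v) + r *\<^sub>R axis i 1) 0))" using D by simp
    from has_derivative_compose[OF line this]
    have "((\<lambda>r. k ((x + s *\<^sub>R v) + r *\<^sub>R axis i 1)) has_derivative (\<lambda>r. D (r *\<^sub>R axis i 1))) (at 0)" .
    then have "((\<lambda>r. k ((x + s *\<^sub>R v) + r *\<^sub>R axis i 1)) has_real_derivative D (axis i 1)) (at 0)"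
      unfolding has_field_derivative_def D.scaleR by (simp add: mult_commute_abs)
    then show ?thesis unfolding partial_deriv_def by (rule DERIV_imp_deriv)
  qed
  have "D v = (\<Sum>i\<in>UNIV. v $ i * D (axis i 1))"
  proof -
    have "v = (\<Sum>i\<in>UNIV. v $ i *\<^sub>R axis i 1)"
      using basis_expansion[of v] by (simp add: scalar_mult_eq_scaleR)
    then have "D v = D (\<Sum>i\<in>UNIV. v $ i *\<^sub>R axis i 1)" by simp
    then show ?thesis by (simp add: D.sum D.scaleR)
  qed
  moreover have "((\<lambda>s. k (x + s *\<^sub>R v)) has_real_derivative D v) (at s)"
    using has_derivative_compose[OF line D] unfolding has_field_derivative_def D.scaleR
    by (simp add: mult_commute_abs)
  ultimately show ?thesis by (simp add: pd)
qed

lemma second_order_taylor: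
  fixes h :: "real^'n \<Rightarrow> real"
  assumes "C2 h"
  obtains \<xi> where "0 < \<xi>" "\<xi> < 1"
    "h (x + v) = h x + (\<Sum>j\<in>UNIV. v $ j * partial_deriv j h x)
       + 1/2 * (\<Sum>j\<in>UNIV. \<Sum>i\<in>UNIV. v $ j * v $ i * partial_deriv i (partial_deriv j h) (x + \<xi> *\<^sub>R v))"
proof -
  \<comment> \<open>The derivatives of order m of the function along the segment from
    \<open>x\<close> to \<open>x + v\<close>; only the orders 0, 1 and 2 are meant.\<close>
  define \<phi> where "\<phi> m s = (if m = 0 then h (x + s *\<^sub>R v) else if m = 1 then \<Sum>j\<in>UNIV. v $ j * partial_deriv j h (x + s *\<^sub>R v)
    else \<Sum>j\<in>UNIV. v $ j * (\<Sum>i\<in>UNIV. v $ i * partial_deriv i (partial_deriv j h) (x + s *\<^sub>R v)))" for m :: nat and s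
  have "\<forall>m t. m < 2 \<and> 0 \<le> t \<and> t \<le> 1 \<longrightarrow> (\<phi> m has_real_derivative \<phi> (Suc m) t) (at t)"
  proof (intro allI impI)
    fix m :: nat and t :: real assume "m < 2 \<and> 0 \<le> t \<and> t \<le> 1"
    then consider "m = 0" | "m = 1" by linarith
    then show "(\<phi> m has_real_derivative \<phi> (Suc m) t) (at t)"
    proof cases
      case 1
      have "((\<lambda>s. h (x + s *\<^sub>R v)) has_real_derivative (\<Sum>j\<in>UNIV. v $ j * partial_deriv j h (x + t *\<^sub>R v))) (at t)"
        by (rule partial_deriv_along_line) (use assms in \<open>simp add: C2_def C1_def\<close>)
      then show ?thesis unfolding 1 \<phi>_def by simp
    next
      case 2
      have "((\<lambda>s. \<Sum>j\<in>UNIV. v $ j * partial_deriv j h (x + s *\<^sub>R v)) has_real_derivative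
          (\<Sum>j\<in>UNIV. v $ j * (\<Sum>i\<in>UNIV. v $ i * partial_deriv i (partial_deriv j h) (x + t *\<^sub>R v)))) (at t)"
        by (intro DERIV_sum DERIV_cmult partial_deriv_along_line) (use assms in \<open>simp add: C2_def C1_def\<close>)
      then show ?thesis unfolding 2 \<phi>_def by simp
    qed
  qed
  from Maclaurin[of 1 2 \<phi> "\<phi> 0", OF _ _ _ this]
  obtain \<xi> where \<xi>: "0 < \<xi>" "\<xi> < 1" "\<phi> 0 1 = (\<Sum>m<2. \<phi> m 0 / fact m * 1 ^ m) + \<phi> 2 \<xi> / fact 2 * 1 ^ 2"
    by auto
  have "\<phi> 2 \<xi> = (\<Sum>j\<in>UNIV. \<Sum>i\<in>UNIV. v $ j * v $ i * partial_deriv i (partial_deriv j h) (x + \<xi> *\<^sub>R v))"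
    by (simp add: \<phi>_def sum_distrib_left mult.assoc)
  moreover have "\<phi> 0 1 = \<phi> 0 0 + \<phi> 1 0 + 1/2 * \<phi> 2 \<xi>"
    unfolding \<xi>(3) by (simp add: eval_nat_numeral)
  moreover have "\<phi> 0 1 = h (x + v)" "\<phi> 0 0 = h x" "\<phi> 1 0 = (\<Sum>j\<in>UNIV. v $ j * partial_deriv j h x)"
    by (simp_all add: \<phi>_def)
  ultimately show thesis by (intro that[OF \<xi>(1,2)]) simp
qed

text \<open>Points at distance below 1 either both lie in the ball of radius \<open>R + 1\<close>,
  where compactness gives uniform continuity, or both lie outside the ball of radius R, where the
  function vanishes.\<close>

lemma compact_support_uniformly_continuous:
  fixes k :: "real^'n \<Rightarrow> real"
  assumes cont: "continuous_on UNIV k" and supp: "\<And>x. R < norm x \<Longrightarrow> k x = 0" and \<epsilon>: "0 < \<epsilon>"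
  obtains \<delta> where "0 < \<delta>" "\<And>x y. norm (x - y) < \<delta> \<Longrightarrow> \<bar>k x - k y\<bar> < \<epsilon>"
proof -
  have "uniformly_continuous_on (cball 0 (R + 1)) k"
    by (intro compact_uniformly_continuous continuous_on_subset[OF cont]) auto
  then obtain \<delta> where \<delta>: "0 < \<delta>"
    "\<And>x y. x \<in> cball 0 (R + 1) \<Longrightarrow> y \<in> cball 0 (R + 1) \<Longrightarrow> dist y x < \<delta> \<Longrightarrow> dist (k y) (k x) < \<epsilon>"
    unfolding uniformly_continuous_on_def using \<epsilon> by meson
  show thesis
  proof (rule that[of "min \<delta> 1"])
    fix x y :: "real^'n" assume xy: "norm (x - y) < min \<delta> 1"
    have n: "norm x \<le> norm y + norm (x - y)" "norm y \<le> norm x + norm (x - y)"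
      using norm_triangle_sub[of x y] norm_triangle_sub[of y x] by (simp_all add: norm_minus_commute)
    show "\<bar>k x - k y\<bar> < \<epsilon>"
    proof (cases "norm x \<le> R + 1 \<and> norm y \<le> R + 1")
      case True
      then show ?thesis using \<delta>(2)[of y x] xy by (simp add: dist_norm)
    next
      case False
      then have "R < norm x" "R < norm y" using n xy by auto
      then show ?thesis using supp \<epsilon> by simp
    qed
  qed (use \<delta> in simp)
qed

lemma compact_support_bounded:
  fixes k :: "real^'n \<Rightarrow> real"
  assumes cont: "continuous_on UNIV k" and supp: "\<And>x. R < norm x \<Longrightarrow> k x = 0"
  obtains B where "0 \<le> B" "\<And>x. \<bar>k x\<bar> \<le> B"
proof -
  have "bounded (k ` cball 0 R)"
    by (intro compact_imp_bounded compact_continuous_image continuous_on_subset[OF cont]) auto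
  then obtain B where B: "\<forall>y\<in>k ` cball 0 R. norm y \<le> B" unfolding bounded_iff by blast
  show thesis
  proof (rule that[of "max 0 B"])
    show "\<bar>k x\<bar> \<le> max 0 B" for x
    proof (cases "norm x \<le> R")
      case True
      then have "norm (k x) \<le> B" using B by auto
      then show ?thesis by simp
    qed (use supp in simp)
  qed simp
qed

text \<open>The complement of the closed ball is open, so the function vanishes on a neighbourhood
  of x.\<close>

lemma partial_deriv_eq_0:
  fixes k :: "real^'n \<Rightarrow> real"
  assumes "\<And>y. R < norm y \<Longrightarrow> k y = 0" "R < norm x"
  shows "partial_deriv i k x = 0"
proof -
  have "open {y :: real^'n. R < norm y}" by (intro open_Collect_less continuous_intros)
  moreover have "((\<lambda>s. x + s *\<^sub>R axis i 1) \<longlongrightarrow> x + 0 *\<^sub>R axis i 1) (nhds (0::real))"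
    by (intro tendsto_intros filterlim_ident)
  ultimately have "\<forall>\<^sub>F s in nhds 0. x + s *\<^sub>R axis i 1 \<in> {y :: real^'n. R < norm y}"
    using assms(2) by (auto dest: topological_tendstoD)
  then have "\<forall>\<^sub>F s in nhds 0. k (x + s *\<^sub>R axis i 1) = (0::real)"
    by eventually_elim (use assms(1) in auto)
  then have "deriv (\<lambda>s. k (x + s *\<^sub>R axis i 1)) 0 = deriv (\<lambda>_. 0) 0"
    by (rule deriv_cong_ev) simp
  then show ?thesis unfolding partial_deriv_def by simp
qed

section \<open>Test functions supported in a ball\<close>

locale test_function =
  fixes h :: "real^'n \<Rightarrow> real" and R :: real
  assumes C2: "C2 h" and R_pos: "0 < R" and supp: "\<And>x. R < norm x \<Longrightarrow> h x = 0"
begin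

abbreviation "D i \<equiv> partial_deriv i h"
abbreviation "DD i j \<equiv> partial_deriv i (partial_deriv j h)"

lemma D_supp: "R < norm x \<Longrightarrow> D i x = 0"
  by (rule partial_deriv_eq_0[of R]) (use supp in auto)

lemma DD_supp: "R < norm x \<Longrightarrow> DD i j x = 0"
  by (rule partial_deriv_eq_0[of R]) (use D_supp in auto)

lemma h_continuous: "continuous_on UNIV h"
  using C2 unfolding C2_def C1_def
  by (intro continuous_at_imp_continuous_on ballI differentiable_imp_continuous_within) auto

lemma D_continuous: "continuous_on UNIV (D i)"
  using C2 unfolding C2_def C1_def by blast

lemma DD_continuous: "continuous_on UNIV (DD i j)"
  using C2 unfolding C2_def C1_def by blast

lemma h_bounded_lipschitz:
  obtains B K where "bounded_lipschitz B K h"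
proof -
  obtain B where B: "0 \<le> B" "\<And>x. \<bar>h x\<bar> \<le> B"
    using compact_support_bounded[OF h_continuous supp] by blast
  have "\<exists>K. 0 \<le> K \<and> (\<forall>x. \<bar>D i x\<bar> \<le> K)" for i
    using compact_support_bounded[OF D_continuous D_supp] by metis
  then obtain K where K: "\<And>i. 0 \<le> K i" "\<And>i x. \<bar>D i x\<bar> \<le> K i" by metis
  have "\<bar>h y - h x\<bar> \<le> (\<Sum>i\<in>UNIV. K i) * norm (y - x)" for x y
  proof -
    let ?v = "y - x"
    have "((\<lambda>s. h (x + s *\<^sub>R ?v)) has_real_derivative (\<Sum>i\<in>UNIV. ?v $ i * D i (x + s *\<^sub>R ?v))) (at s)" for s
      by (rule partial_deriv_along_line) (use C2 in \<open>simp add: C2_def C1_def\<close>)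
    from MVT2[of 0 1 "\<lambda>s. h (x + s *\<^sub>R ?v)", OF _ this]
    obtain z where z: "h y - h x = (\<Sum>i\<in>UNIV. ?v $ i * D i (x + z *\<^sub>R ?v))" by auto
    have "\<bar>\<Sum>i\<in>UNIV. ?v $ i * D i (x + z *\<^sub>R ?v)\<bar> \<le> (\<Sum>i\<in>UNIV. \<bar>?v $ i * D i (x + z *\<^sub>R ?v)\<bar>)"
      by (rule sum_abs)
    also have "\<dots> \<le> (\<Sum>i\<in>UNIV. K i * norm ?v)"
    proof (rule sum_mono)
      fix i
      have "\<bar>?v $ i\<bar> * \<bar>D i (x + z *\<^sub>R ?v)\<bar> \<le> norm ?v * K i"
        by (rule mult_mono[OF component_le_norm_cart K(2)]) auto
      then show "\<bar>?v $ i * D i (x + z *\<^sub>R ?v)\<bar> \<le> K i * norm ?v"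
        by (simp add: abs_mult mult.commute)
    qed
    finally show ?thesis unfolding z by (simp add: sum_distrib_right)
  qed
  then have "bounded_lipschitz B (\<Sum>i\<in>UNIV. K i) h"
    unfolding bounded_lipschitz_def using B K(1) by (simp add: sum_nonneg)
  then show thesis by (rule that)
qed

lemma DD_bounded:
  obtains K where "0 \<le> K" "\<And>i j x. \<bar>DD i j x\<bar> \<le> K"
proof -
  have "\<forall>p. \<exists>K. 0 \<le> K \<and> (\<forall>x. \<bar>DD (fst p) (snd p) x\<bar> \<le> K)"
    using compact_support_bounded[OF DD_continuous DD_supp] by metis
  then obtain K where K: "\<forall>p. 0 \<le> K p \<and> (\<forall>x. \<bar>DD (fst p) (snd p) x\<bar> \<le> K p)"
    by (drule_tac choice) (elim exE, rule that)
  show thesis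
  proof (rule that[of "\<Sum>p\<in>UNIV. K p"])
    show "0 \<le> (\<Sum>p\<in>UNIV. K p)" by (rule sum_nonneg) (use K in blast)
    fix i j x
    have "\<bar>DD i j x\<bar> \<le> K (i, j)" using K[rule_format, of "(i, j)"] by simp
    also have "\<dots> \<le> (\<Sum>p\<in>UNIV. K p)" by (rule member_le_sum) (use K in auto)
    finally show "\<bar>DD i j x\<bar> \<le> (\<Sum>p\<in>UNIV. K p)" .
  qed
qed

lemma DD_uniformly_continuous:
  assumes "0 < \<epsilon>"
  obtains \<delta> where "0 < \<delta>" "\<And>i j (x :: real^'n) y. norm (x - y) < \<delta> \<Longrightarrow> \<bar>DD i j x - DD i j y\<bar> < \<epsilon>"
proof -
  have "\<forall>p. \<exists>\<delta>. 0 < \<delta> \<and> (\<forall>x y. norm (x - y) < \<delta> \<longrightarrow> \<bar>DD (fst p) (snd p) x - DD (fst p) (snd p) y\<bar> < \<epsilon>)"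
    using compact_support_uniformly_continuous[OF DD_continuous DD_supp assms] by metis
  then obtain \<delta> where \<delta>: "\<forall>p. 0 < \<delta> p \<and> (\<forall>x y. norm (x - y) < \<delta> p \<longrightarrow> \<bar>DD (fst p) (snd p) x - DD (fst p) (snd p) y\<bar> < \<epsilon>)"
    by (drule_tac choice) (elim exE, rule that)
  show thesis
  proof (rule that[of "Min (range \<delta>)"])
    show "0 < Min (range \<delta>)" using \<delta> by simp
    fix i j and x y :: "real^'n" assume "norm (x - y) < Min (range \<delta>)"
    moreover have "Min (range \<delta>) \<le> \<delta> (i, j)" by simp
    ultimately have "norm (x - y) < \<delta> (i, j)" by linarith
    then show "\<bar>DD i j x - DD i j y\<bar> < \<epsilon>" using \<delta>[rule_format, of "(i, j)"] by simp
  qed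
qed

text \<open>For a short \<open>v\<close> the second derivatives hardly change, by uniform
  continuity; for a long one they are merely bounded, and the quotient of \<open>norm v\<close> by
  the length \<delta> supplies the two further powers. So one estimate holds for all x and
  v.\<close>

lemma taylor_remainder:
  assumes \<epsilon>: "0 < \<epsilon>"
  obtains C where "0 \<le> C" "\<And>x v. \<bar>h (x + v) - h x - (\<Sum>j\<in>UNIV. v $ j * D j x)
      - 1/2 * (\<Sum>j\<in>UNIV. \<Sum>i\<in>UNIV. v $ j * v $ i * DD i j x)\<bar> \<le> \<epsilon> * (norm v)\<^sup>2 + C * (norm v)^4"
proof -
  let ?n = "real CARD('n)"
  have n: "0 < ?n" by simp
  \<comment> \<open>Compensates the factor \<open>1/2\<close> and the number of index pairs.\<close>
  define e where "e = 2 * \<epsilon> / ?n\<^sup>2"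
  have e: "0 < e" using \<epsilon> n by (simp add: e_def)
  obtain \<delta> where \<delta>: "0 < \<delta>" "\<And>i j x y. norm (x - y) < \<delta> \<Longrightarrow> \<bar>DD i j x - DD i j y\<bar> < e"
    using DD_uniformly_continuous[OF e] by metis
  obtain K where K: "0 \<le> K" "\<And>i j x. \<bar>DD i j x\<bar> \<le> K"
    using DD_bounded by metis
  define C where "C = ?n\<^sup>2 * K / \<delta>\<^sup>2"
  show thesis
  proof (rule that)
    show "0 \<le> C" using K by (simp add: C_def)
    fix x v
    obtain \<xi> where \<xi>: "0 < \<xi>" "\<xi> < 1" and taylor: "h (x + v) = h x + (\<Sum>j\<in>UNIV. v $ j * D j x)
       + 1/2 * (\<Sum>j\<in>UNIV. \<Sum>i\<in>UNIV. v $ j * v $ i * DD i j (x + \<xi> *\<^sub>R v))"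
      by (rule second_order_taylor[OF C2, of x v])
    \<comment> \<open>One bound for both regimes: the first term serves short \<open>v\<close>, the
      second is at least \<open>2 * K\<close> once \<open>norm v\<close> reaches \<delta>.\<close>
    let ?r = "e + 2 * K * (norm v)\<^sup>2 / \<delta>\<^sup>2"
    have diff: "\<bar>DD i j (x + \<xi> *\<^sub>R v) - DD i j x\<bar> \<le> ?r" for i j
    proof (cases "norm v < \<delta>")
      case True
      have "norm (\<xi> *\<^sub>R v) \<le> norm v" using \<xi> by (simp add: mult_left_le_one_le)
      then have "norm ((x + \<xi> *\<^sub>R v) - x) < \<delta>" using True by simp
      then have "\<bar>DD i j (x + \<xi> *\<^sub>R v) - DD i j x\<bar> < e" by (rule \<delta>(2))
      moreover have "0 \<le> 2 * K * (norm v)\<^sup>2 / \<delta>\<^sup>2" using K(1) by simp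
      ultimately show ?thesis by linarith
    next
      case False
      then have "\<delta>\<^sup>2 \<le> (norm v)\<^sup>2" using \<delta>(1) by (intro power_mono) auto
      then have "1 \<le> (norm v)\<^sup>2 / \<delta>\<^sup>2" using \<delta>(1) by simp
      then have "2 * K * 1 \<le> 2 * K * ((norm v)\<^sup>2 / \<delta>\<^sup>2)" using K(1) by (intro mult_left_mono) auto
      moreover have "\<bar>DD i j (x + \<xi> *\<^sub>R v) - DD i j x\<bar> \<le> K + K"
        using K(2)[of i j "x + \<xi> *\<^sub>R v"] K(2)[of i j x] by linarith
      ultimately show ?thesis using e by simp
    qed
    have r: "0 \<le> ?r" using e K(1) by simp
    have "h (x + v) - h x - (\<Sum>j\<in>UNIV. v $ j * D j x) - 1/2 * (\<Sum>j\<in>UNIV. \<Sum>i\<in>UNIV. v $ j * v $ i * DD i j x)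
        = 1/2 * (\<Sum>j\<in>UNIV. \<Sum>i\<in>UNIV. v $ j * v $ i * (DD i j (x + \<xi> *\<^sub>R v) - DD i j x))"
      unfolding taylor by (simp add: right_diff_distrib sum_subtractf)
    also have "\<bar>\<dots>\<bar> \<le> 1/2 * (\<Sum>j\<in>(UNIV :: 'n set). \<Sum>i\<in>(UNIV :: 'n set). (norm v)\<^sup>2 * ?r)"
    proof -
      have "\<bar>\<Sum>j\<in>UNIV. \<Sum>i\<in>UNIV. v $ j * v $ i * (DD i j (x + \<xi> *\<^sub>R v) - DD i j x)\<bar>
          \<le> (\<Sum>j\<in>(UNIV :: 'n set). \<Sum>i\<in>(UNIV :: 'n set). (norm v)\<^sup>2 * ?r)"
      proof (rule order_trans[OF sum_abs], rule sum_mono, rule order_trans[OF sum_abs], rule sum_mono)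
        fix i j
        have "\<bar>v $ j\<bar> * \<bar>v $ i\<bar> \<le> norm v * norm v"
          by (intro mult_mono component_le_norm_cart) auto
        then have "\<bar>v $ j\<bar> * \<bar>v $ i\<bar> * \<bar>DD i j (x + \<xi> *\<^sub>R v) - DD i j x\<bar> \<le> (norm v * norm v) * ?r"
          using diff[of i j] by (rule mult_mono) auto
        then show "\<bar>v $ j * v $ i * (DD i j (x + \<xi> *\<^sub>R v) - DD i j x)\<bar> \<le> (norm v)\<^sup>2 * ?r"
          by (simp add: abs_mult power2_eq_square)
      qed
      then show ?thesis by simp
    qed
    also have "\<dots> = \<epsilon> * (norm v)\<^sup>2 + C * (norm v)^4"
    proof -
      have "1/2 * (\<Sum>j\<in>(UNIV :: 'n set). \<Sum>i\<in>(UNIV :: 'n set). (norm v)\<^sup>2 * ?r)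
          = 1/2 * (?n\<^sup>2 * ((norm v)\<^sup>2 * ?r))" by (simp add: power2_eq_square)
      also have "\<dots> = (?n\<^sup>2 * e / 2) * (norm v)\<^sup>2 + (?n\<^sup>2 * K / \<delta>\<^sup>2) * ((norm v)\<^sup>2 * (norm v)\<^sup>2)"
        by (simp add: algebra_simps)
      also have "?n\<^sup>2 * e / 2 = \<epsilon>" by (simp add: e_def)
      also have "(norm v)\<^sup>2 * (norm v)\<^sup>2 = (norm v)^4" by (simp flip: power_add)
      finally show ?thesis unfolding C_def .
    qed
    finally show "\<bar>h (x + v) - h x - (\<Sum>j\<in>UNIV. v $ j * D j x)
      - 1/2 * (\<Sum>j\<in>UNIV. \<Sum>i\<in>UNIV. v $ j * v $ i * DD i j x)\<bar> \<le> \<epsilon> * (norm v)\<^sup>2 + C * (norm v)^4" .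
  qed
qed

end

lemma power4_add_le: "(a + b)^4 \<le> 8 * a^4 + 8 * b^4" for a b :: real
proof -
  have "((a + b)\<^sup>2)\<^sup>2 \<le> (2 * a\<^sup>2 + 2 * b\<^sup>2)\<^sup>2" by (intro power_mono power2_add_le) simp
  also have "\<dots> \<le> 2 * (2 * a\<^sup>2)\<^sup>2 + 2 * (2 * b\<^sup>2)\<^sup>2" by (rule power2_add_le)
  finally show ?thesis by (simp add: power_mult_distrib flip: power_mult)
qed

section \<open>Moments of a single Euler step\<close>

context wiener
begin

lemma coordinate_moments:
  fixes \<delta> :: real
  assumes \<delta>: "0 < \<delta>"
  shows "integrable M (\<lambda>\<omega>. \<omega> \<delta> $ a)" and "expectation (\<lambda>\<omega>. \<omega> \<delta> $ a) = 0"
    and "integrable M (\<lambda>\<omega>. \<omega> \<delta> $ a * \<omega> \<delta> $ b)"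
    and "expectation (\<lambda>\<omega>. \<omega> \<delta> $ a * \<omega> \<delta> $ b) = (if a = b then \<delta> else 0)"
    and "integrable M (\<lambda>\<omega>. (\<omega> \<delta> $ a)^4)" and "expectation (\<lambda>\<omega>. (\<omega> \<delta> $ a)^4) = 3 * \<delta>\<^sup>2"
    and "integrable M (\<lambda>\<omega>. (norm (\<omega> \<delta>))\<^sup>2)" and "expectation (\<lambda>\<omega>. (norm (\<omega> \<delta>))\<^sup>2) = CARD('d) * \<delta>"
proof -
  have z: "\<omega> 0 = 0" if "\<omega> \<in> space M" for \<omega> using that by (simp add: space_P path_0)
  have int_cong: "integrable M u \<longleftrightarrow> integrable M v" and E_cong: "expectation u = expectation v"
    if "\<And>\<omega>. \<omega> \<in> space M \<Longrightarrow> u \<omega> = v \<omega>" for u v :: "_ \<Rightarrow> real"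
    using that by (auto intro!: Bochner_Integration.integrable_cong Bochner_Integration.integral_cong)
  note m = increment_moments[OF order_refl \<delta>] and c = increment_cross_moment[OF order_refl \<delta>] and n = increment_norm_sq[OF order_refl \<delta>]
  show "integrable M (\<lambda>\<omega>. \<omega> \<delta> $ a)"
    by (rule int_cong[THEN iffD1, OF _ m(1)[of a 1]]) (simp add: z)
  show "expectation (\<lambda>\<omega>. \<omega> \<delta> $ a) = 0"
    by (rule trans[OF E_cong m(2)[of a]]) (simp add: z)
  show "integrable M (\<lambda>\<omega>. (\<omega> \<delta> $ a)^4)"
    by (rule int_cong[THEN iffD1, OF _ m(1)[of a 4]]) (simp add: z)
  show "expectation (\<lambda>\<omega>. (\<omega> \<delta> $ a)^4) = 3 * \<delta>\<^sup>2"
    by (rule trans[OF E_cong m(4)[of a, simplified]]) (simp add: z)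
  show "integrable M (\<lambda>\<omega>. (norm (\<omega> \<delta>))\<^sup>2)"
    by (rule int_cong[THEN iffD1, OF _ n(1)]) (simp add: z)
  show "expectation (\<lambda>\<omega>. (norm (\<omega> \<delta>))\<^sup>2) = CARD('d) * \<delta>"
    by (rule trans[OF E_cong n(2)[simplified]]) (simp add: z)
  show "integrable M (\<lambda>\<omega>. \<omega> \<delta> $ a * \<omega> \<delta> $ b)"
  proof (cases "a = b")
    case True
    show ?thesis by (rule int_cong[THEN iffD1, OF _ m(1)[of a 2]]) (simp add: z True power2_eq_square)
  next
    case False
    show ?thesis by (rule int_cong[THEN iffD1, OF _ c(1)[OF False]]) (simp add: z)
  qed
  show "expectation (\<lambda>\<omega>. \<omega> \<delta> $ a * \<omega> \<delta> $ b) = (if a = b then \<delta> else 0)"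
  proof (cases "a = b")
    case True
    have "expectation (\<lambda>\<omega>. \<omega> \<delta> $ a * \<omega> \<delta> $ b) = \<delta>"
      by (rule trans[OF E_cong m(3)[of a, simplified]]) (simp add: z True power2_eq_square)
    then show ?thesis using True by simp
  next
    case False
    have "expectation (\<lambda>\<omega>. \<omega> \<delta> $ a * \<omega> \<delta> $ b) = 0"
      by (rule trans[OF E_cong c(2)[OF False]]) (simp add: z)
    then show ?thesis using False by simp
  qed
qed

lemma norm4_moment:
  fixes \<delta> :: real
  assumes \<delta>: "0 < \<delta>"
  shows "integrable M (\<lambda>\<omega>. (norm (\<omega> \<delta>))^4)" and "expectation (\<lambda>\<omega>. (norm (\<omega> \<delta>))^4) \<le> 3 * (real CARD('d))\<^sup>2 * \<delta>\<^sup>2"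
proof -
  note c = coordinate_moments[OF \<delta>]
  have le: "(norm w)^4 \<le> real CARD('d) * (\<Sum>a\<in>UNIV. (w $ a)^4)" for w :: "real^'d"
  proof -
    have "(norm w)^4 = (\<Sum>a\<in>UNIV. 1 * (w $ a)\<^sup>2)\<^sup>2"
      unfolding norm_sq_vec[symmetric] by (simp add: norm_sq_vec[symmetric] flip: power_mult)
    also have "\<dots> \<le> (\<Sum>a\<in>(UNIV :: 'd set). 1\<^sup>2) * (\<Sum>a\<in>UNIV. ((w $ a)\<^sup>2)\<^sup>2)"
      by (rule Cauchy_Schwarz_ineq_sum)
    finally show ?thesis by (simp flip: power_mult)
  qed
  have int: "integrable M (\<lambda>\<omega>. real CARD('d) * (\<Sum>a\<in>UNIV. (\<omega> \<delta> $ a)^4))"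
    by (intro integrable_mult_right Bochner_Integration.integrable_sum c(5))
  have "(\<lambda>\<omega>. (norm (\<omega> \<delta>))^4) \<in> borel_measurable M"
    using measurable_coord_M[of \<delta>] \<delta> by simp
  then show int4: "integrable M (\<lambda>\<omega>. (norm (\<omega> \<delta>))^4)"
    by (rule Bochner_Integration.integrable_bound[OF int])
      (auto intro!: AE_I2 order_trans[OF le] simp: sum_nonneg)
  have "expectation (\<lambda>\<omega>. (norm (\<omega> \<delta>))^4) \<le> expectation (\<lambda>\<omega>. real CARD('d) * (\<Sum>a\<in>UNIV. (\<omega> \<delta> $ a)^4))"
    by (rule integral_mono[OF int4 int le])
  also have "\<dots> = 3 * (real CARD('d))\<^sup>2 * \<delta>\<^sup>2"
    using c(5,6) by (simp add: power2_eq_square)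
  finally show "expectation (\<lambda>\<omega>. (norm (\<omega> \<delta>))^4) \<le> 3 * (real CARD('d))\<^sup>2 * \<delta>\<^sup>2" .
qed

end

context lipschitz_coefficients
begin

definition linear_growth :: real where
  "linear_growth = L + norm (f 0) + norm (g 0)"

lemma linear_growth_nonneg: "0 \<le> linear_growth"
  unfolding linear_growth_def using L_nonneg by simp

lemma f_growth: "norm (f x) \<le> linear_growth * (1 + norm x)"
  and g_growth: "norm (g x) \<le> linear_growth * (1 + norm x)"
proof -
  have "linear_growth * (1 + norm x) = L * norm x + norm (f 0) + norm (g 0) + (L + (norm (f 0) + norm (g 0)) * norm x)"
    by (simp add: linear_growth_def algebra_simps)
  moreover have "0 \<le> L + (norm (f 0) + norm (g 0)) * norm x" using L_nonneg by simp
  ultimately have *: "L * norm x + norm (f 0) + norm (g 0) \<le> linear_growth * (1 + norm x)" by linarith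
  have "norm (f x - f 0) \<le> L * norm x" "norm (g x - g 0) \<le> L * norm x"
    using f_lipschitz[of x 0] g_lipschitz[of x 0] by simp_all
  then show "norm (f x) \<le> linear_growth * (1 + norm x)" "norm (g x) \<le> linear_growth * (1 + norm x)"
    using norm_triangle_sub[of "f x" "f 0"] norm_triangle_sub[of "g x" "g 0"] *
      norm_ge_zero[of "f 0"] norm_ge_zero[of "g 0"] by linarith+
qed

definition displacement :: "real \<Rightarrow> real^'n \<Rightarrow> (real \<Rightarrow> real^'d) \<Rightarrow> real^'n" where
  "displacement \<delta> x \<omega> = \<delta> *\<^sub>R f x + g x *v \<omega> \<delta>"

lemma euler_step_displacement: "euler_step f g \<delta> x (\<omega> \<delta>) = x + displacement \<delta> x \<omega>"
  by (simp add: euler_step_def displacement_def)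

lemma displacement_measurable: "0 \<le> \<delta> \<Longrightarrow> displacement \<delta> x \<in> borel_measurable M"
  unfolding displacement_def
  by (intro borel_measurable_add borel_measurable_const borel_measurable_matrix_vector_mult measurable_coord_M)

lemma displacement_nth: "displacement \<delta> x \<omega> $ j = \<delta> * f x $ j + (\<Sum>a\<in>UNIV. g x $ j $ a * \<omega> \<delta> $ a)"
  by (simp add: displacement_def matrix_vector_mult_def)

lemma displacement_mean:
  fixes \<delta> :: real
  assumes \<delta>: "0 < \<delta>"
  shows "integrable M (\<lambda>\<omega>. displacement \<delta> x \<omega> $ j)" "expectation (\<lambda>\<omega>. displacement \<delta> x \<omega> $ j) = \<delta> * f x $ j"
proof -
  note c = coordinate_moments[OF \<delta>]
  have int: "integrable M (\<lambda>\<omega>. \<Sum>a\<in>UNIV. g x $ j $ a * \<omega> \<delta> $ a)"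
    by (intro Bochner_Integration.integrable_sum integrable_mult_right c(1))
  show "integrable M (\<lambda>\<omega>. displacement \<delta> x \<omega> $ j)"
    unfolding displacement_nth by (intro Bochner_Integration.integrable_add integrable_const int)
  have "expectation (\<lambda>\<omega>. displacement \<delta> x \<omega> $ j) = expectation (\<lambda>_. \<delta> * f x $ j) + expectation (\<lambda>\<omega>. \<Sum>a\<in>UNIV. g x $ j $ a * \<omega> \<delta> $ a)"
    unfolding displacement_nth by (rule Bochner_Integration.integral_add[OF integrable_const int])
  also have "expectation (\<lambda>\<omega>. \<Sum>a\<in>UNIV. g x $ j $ a * \<omega> \<delta> $ a) = 0"
    using c(1,2) by simp
  finally show "expectation (\<lambda>\<omega>. displacement \<delta> x \<omega> $ j) = \<delta> * f x $ j"
    unfolding expectation_const by simp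
qed

text \<open>The mixed terms of drift and noise are centred, and the products of Brownian coordinates
  have mean \<delta> on the diagonal and 0 off it. The part linear in \<delta> is the diffusion
  matrix of the generator.\<close>

lemma displacement_covariance:
  fixes \<delta> :: real
  assumes \<delta>: "0 < \<delta>"
  shows "integrable M (\<lambda>\<omega>. displacement \<delta> x \<omega> $ j * displacement \<delta> x \<omega> $ i)"
    "expectation (\<lambda>\<omega>. displacement \<delta> x \<omega> $ j * displacement \<delta> x \<omega> $ i)
      = \<delta>\<^sup>2 * (f x $ j * f x $ i) + \<delta> * (\<Sum>a\<in>UNIV. g x $ j $ a * g x $ i $ a)"
proof -
  note c = coordinate_moments[OF \<delta>]
  let ?N = "\<lambda>j \<omega>. \<Sum>a\<in>UNIV. g x $ j $ a * \<omega> \<delta> $ a"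
  have N: "integrable M (?N j)" "expectation (?N j) = 0" for j
    using c(1,2) by (auto intro!: Bochner_Integration.integrable_sum integrable_mult_right)
  have NN_eq: "?N j \<omega> * ?N i \<omega> = (\<Sum>a\<in>UNIV. \<Sum>b\<in>UNIV. (g x $ j $ a * g x $ i $ b) * (\<omega> \<delta> $ a * \<omega> \<delta> $ b))" for \<omega>
    unfolding sum_product by (simp add: mult_ac)
  have intNN: "integrable M (\<lambda>\<omega>. ?N j \<omega> * ?N i \<omega>)"
    unfolding NN_eq by (intro Bochner_Integration.integrable_sum integrable_mult_right c(3))
  have ENN: "expectation (\<lambda>\<omega>. ?N j \<omega> * ?N i \<omega>) = \<delta> * (\<Sum>a\<in>UNIV. g x $ j $ a * g x $ i $ a)"
  proof -
    have "expectation (\<lambda>\<omega>. ?N j \<omega> * ?N i \<omega>)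
        = (\<Sum>a\<in>UNIV. \<Sum>b\<in>UNIV. (g x $ j $ a * g x $ i $ b) * expectation (\<lambda>\<omega>. \<omega> \<delta> $ a * \<omega> \<delta> $ b))"
      unfolding NN_eq using c(3) by (simp add: Bochner_Integration.integrable_sum)
    also have "\<dots> = (\<Sum>a\<in>UNIV. \<delta> * (g x $ j $ a * g x $ i $ a))"
      unfolding c(4) by (intro sum.cong) (simp_all add: if_distrib[where f = "\<lambda>z. _ * z"] cong: if_cong)
    finally show ?thesis by (simp add: sum_distrib_left)
  qed
  have eq: "displacement \<delta> x \<omega> $ j * displacement \<delta> x \<omega> $ i
      = \<delta>\<^sup>2 * (f x $ j * f x $ i) + (\<delta> * f x $ j) * ?N i \<omega> + (\<delta> * f x $ i) * ?N j \<omega> + ?N j \<omega> * ?N i \<omega>" for \<omega>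
    unfolding displacement_nth by (simp add: algebra_simps power2_eq_square)
  have int: "integrable M (\<lambda>\<omega>. (\<delta> * f x $ j) * ?N i \<omega>)" "integrable M (\<lambda>\<omega>. (\<delta> * f x $ i) * ?N j \<omega>)"
    "integrable M (\<lambda>\<omega>. \<delta>\<^sup>2 * (f x $ j * f x $ i))"
    by (rule integrable_mult_right[OF N(1)], rule integrable_mult_right[OF N(1)], rule integrable_const)
  show "integrable M (\<lambda>\<omega>. displacement \<delta> x \<omega> $ j * displacement \<delta> x \<omega> $ i)"
    unfolding eq by (intro Bochner_Integration.integrable_add int intNN)
  have "expectation (\<lambda>\<omega>. displacement \<delta> x \<omega> $ j * displacement \<delta> x \<omega> $ i)
      = expectation (\<lambda>_. \<delta>\<^sup>2 * (f x $ j * f x $ i)) + expectation (\<lambda>\<omega>. (\<delta> * f x $ j) * ?N i \<omega>)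
        + expectation (\<lambda>\<omega>. (\<delta> * f x $ i) * ?N j \<omega>) + expectation (\<lambda>\<omega>. ?N j \<omega> * ?N i \<omega>)"
    unfolding eq using int intNN by (subst Bochner_Integration.integral_add; (intro Bochner_Integration.integrable_add)?; simp)+
  then show "expectation (\<lambda>\<omega>. displacement \<delta> x \<omega> $ j * displacement \<delta> x \<omega> $ i)
      = \<delta>\<^sup>2 * (f x $ j * f x $ i) + \<delta> * (\<Sum>a\<in>UNIV. g x $ j $ a * g x $ i $ a)"
    unfolding expectation_const ENN integral_mult_right_zero N(2) by simp
qed

text \<open>The bound \<open>G\<close> on the coefficients at x is a parameter: near the support it
  is taken constant, far away proportional to \<open>norm x\<close>.\<close>

lemma displacement_moments:
  fixes \<delta> :: real
  assumes \<delta>: "0 < \<delta>" "\<delta> \<le> 1" and G: "norm (f x) \<le> G" "norm (g x) \<le> G"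
  shows "integrable M (\<lambda>\<omega>. (norm (displacement \<delta> x \<omega>))\<^sup>2)"
    "expectation (\<lambda>\<omega>. (norm (displacement \<delta> x \<omega>))\<^sup>2) \<le> 2 * (1 + real CARD('d)) * G\<^sup>2 * \<delta>"
    "integrable M (\<lambda>\<omega>. (norm (displacement \<delta> x \<omega>))^4)"
    "expectation (\<lambda>\<omega>. (norm (displacement \<delta> x \<omega>))^4) \<le> 8 * (1 + 3 * (real CARD('d))\<^sup>2) * G^4 * \<delta>\<^sup>2"
proof -
  let ?d = "real CARD('d)"
  note c = coordinate_moments[OF \<delta>(1)] and c4 = norm4_moment[OF \<delta>(1)]
  have meas: "displacement \<delta> x \<in> borel_measurable M" by (rule displacement_measurable) (use \<delta> in simp)
  have G0: "0 \<le> G" using G(1) norm_ge_zero[of "f x"] by linarith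
  have le: "norm (displacement \<delta> x \<omega>) \<le> \<delta> * G + G * norm (\<omega> \<delta>)" for \<omega>
  proof -
    have "norm (displacement \<delta> x \<omega>) \<le> norm (\<delta> *\<^sub>R f x) + norm (g x *v \<omega> \<delta>)"
      unfolding displacement_def by (rule norm_triangle_ineq)
    also have "\<dots> \<le> \<delta> * G + G * norm (\<omega> \<delta>)"
      using \<delta> G norm_matrix_vector_mult_le[of "g x" "\<omega> \<delta>"] mult_right_mono[OF G(2) norm_ge_zero, of "\<omega> \<delta>"]
      by (intro add_mono) (auto intro: mult_left_mono)
    finally show ?thesis .
  qed
  have le2: "(norm (displacement \<delta> x \<omega>))\<^sup>2 \<le> 2 * \<delta>\<^sup>2 * G\<^sup>2 + 2 * G\<^sup>2 * (norm (\<omega> \<delta>))\<^sup>2" for \<omega>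
    using order_trans[OF power_mono[OF le norm_ge_zero] power2_add_le, of \<omega>] by (simp add: power_mult_distrib)
  have le4: "(norm (displacement \<delta> x \<omega>))^4 \<le> 8 * \<delta>^4 * G^4 + 8 * G^4 * (norm (\<omega> \<delta>))^4" for \<omega>
    using order_trans[OF power_mono[OF le norm_ge_zero] power4_add_le, of \<omega>] by (simp add: power_mult_distrib)
  have i2: "integrable M (\<lambda>\<omega>. 2 * \<delta>\<^sup>2 * G\<^sup>2 + 2 * G\<^sup>2 * (norm (\<omega> \<delta>))\<^sup>2)"
    by (intro Bochner_Integration.integrable_add integrable_const integrable_mult_right c(7))
  have i4: "integrable M (\<lambda>\<omega>. 8 * \<delta>^4 * G^4 + 8 * G^4 * (norm (\<omega> \<delta>))^4)"
    by (intro Bochner_Integration.integrable_add integrable_const integrable_mult_right c4(1))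
  show int2: "integrable M (\<lambda>\<omega>. (norm (displacement \<delta> x \<omega>))\<^sup>2)"
    by (rule Bochner_Integration.integrable_bound[OF i2]) (use meas le2 in \<open>auto intro!: AE_I2\<close>)
  show int4: "integrable M (\<lambda>\<omega>. (norm (displacement \<delta> x \<omega>))^4)"
    by (rule Bochner_Integration.integrable_bound[OF i4]) (use meas le4 in \<open>auto intro!: AE_I2\<close>)
  have "\<delta>\<^sup>2 \<le> \<delta>" using \<delta> by (simp add: power2_eq_square mult_left_le)
  have "expectation (\<lambda>\<omega>. (norm (displacement \<delta> x \<omega>))\<^sup>2) \<le> expectation (\<lambda>\<omega>. 2 * \<delta>\<^sup>2 * G\<^sup>2 + 2 * G\<^sup>2 * (norm (\<omega> \<delta>))\<^sup>2)"
    by (rule integral_mono[OF int2 i2 le2])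
  also have "\<dots> = expectation (\<lambda>_. 2 * \<delta>\<^sup>2 * G\<^sup>2) + expectation (\<lambda>\<omega>. 2 * G\<^sup>2 * (norm (\<omega> \<delta>))\<^sup>2)"
    by (rule Bochner_Integration.integral_add) (intro integrable_const integrable_mult_right c(7))+
  also have "\<dots> = 2 * G\<^sup>2 * \<delta>\<^sup>2 + 2 * G\<^sup>2 * (?d * \<delta>)"
    unfolding expectation_const integral_mult_right_zero c(8) by (simp add: mult_ac)
  also have "\<dots> \<le> 2 * G\<^sup>2 * \<delta> + 2 * G\<^sup>2 * (?d * \<delta>)"
    using \<open>\<delta>\<^sup>2 \<le> \<delta>\<close> by (intro add_right_mono mult_left_mono) auto
  finally show "expectation (\<lambda>\<omega>. (norm (displacement \<delta> x \<omega>))\<^sup>2) \<le> 2 * (1 + ?d) * G\<^sup>2 * \<delta>"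
    by (simp add: algebra_simps)
  have "\<delta>^4 \<le> \<delta>\<^sup>2" using \<delta> by (intro power_decreasing) auto
  have "expectation (\<lambda>\<omega>. (norm (displacement \<delta> x \<omega>))^4) \<le> expectation (\<lambda>\<omega>. 8 * \<delta>^4 * G^4 + 8 * G^4 * (norm (\<omega> \<delta>))^4)"
    by (rule integral_mono[OF int4 i4 le4])
  also have "\<dots> = expectation (\<lambda>_. 8 * \<delta>^4 * G^4) + expectation (\<lambda>\<omega>. 8 * G^4 * (norm (\<omega> \<delta>))^4)"
    by (rule Bochner_Integration.integral_add) (intro integrable_const integrable_mult_right c4(1))+
  also have "\<dots> = 8 * G^4 * \<delta>^4 + 8 * G^4 * expectation (\<lambda>\<omega>. (norm (\<omega> \<delta>))^4)"
    unfolding expectation_const integral_mult_right_zero by (simp add: mult_ac)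
  also have "\<dots> \<le> 8 * G^4 * \<delta>\<^sup>2 + 8 * G^4 * (3 * ?d\<^sup>2 * \<delta>\<^sup>2)"
    using \<open>\<delta>^4 \<le> \<delta>\<^sup>2\<close> c4(2) by (intro add_mono mult_left_mono) auto
  finally show "expectation (\<lambda>\<omega>. (norm (displacement \<delta> x \<omega>))^4) \<le> 8 * (1 + 3 * ?d\<^sup>2) * G^4 * \<delta>\<^sup>2"
    by (simp add: algebra_simps)
qed

end

section \<open>The one-step expansion and the short-time displacement\<close>

context lipschitz_coefficients
begin

text \<open>Exchanging the sums and using the symmetry of the diffusion matrix brings the
  second-order part into the index order of Taylor's formula.\<close>

lemma sde_generator_alt:
  "sde_generator f g h x = (\<Sum>j\<in>UNIV. f x $ j * partial_deriv j h x)
    + 1/2 * (\<Sum>j\<in>UNIV. \<Sum>i\<in>UNIV. (\<Sum>a\<in>UNIV. g x $ j $ a * g x $ i $ a) * partial_deriv i (partial_deriv j h) x)"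
proof -
  have "(\<Sum>i\<in>UNIV. \<Sum>j\<in>UNIV. \<Sum>a\<in>UNIV. g x $ i $ a * g x $ j $ a * partial_deriv i (partial_deriv j h) x)
      = (\<Sum>j\<in>UNIV. \<Sum>i\<in>UNIV. (\<Sum>a\<in>UNIV. g x $ j $ a * g x $ i $ a) * partial_deriv i (partial_deriv j h) x)"
    (is "?l = ?r")
  proof -
    have "?l = (\<Sum>j\<in>UNIV. \<Sum>i\<in>UNIV. \<Sum>a\<in>UNIV. g x $ i $ a * g x $ j $ a * partial_deriv i (partial_deriv j h) x)"
      by (rule sum.swap)
    also have "\<dots> = ?r" unfolding sum_distrib_right by (simp only: mult.commute)
    finally show ?thesis .
  qed
  then show ?thesis unfolding sde_generator_def by simp
qed

lemma generator_continuous: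
  assumes "test_function h R"
  shows "continuous_on UNIV (sde_generator f g h)"
proof -
  interpret test_function h R by fact
  show ?thesis
    unfolding sde_generator_def[abs_def]
    by (intro continuous_intros f_continuous g_continuous D_continuous DD_continuous)
qed

lemma generator_support:
  assumes "test_function h R" "R < norm x"
  shows "sde_generator f g h x = 0"
proof -
  interpret test_function h R by fact
  show ?thesis unfolding sde_generator_def using D_supp[OF assms(2)] DD_supp[OF assms(2)] by simp
qed

text \<open>Taylor's formula near the support of \<open>h\<close>; away from it, a step from \<open>x\<close> into the support has length at
  least \<open>norm x / 2\<close>, and linear growth makes this unlikely, uniformly in \<open>x\<close>.\<close>

lemma euler_op_generator_near:
  assumes h: "test_function h R" and r: "0 < r" and \<epsilon>: "0 < \<epsilon>"
  obtains \<delta>0 where "0 < \<delta>0" "\<delta>0 \<le> 1" "\<And>\<delta> x. 0 < \<delta> \<Longrightarrow> \<delta> < \<delta>0 \<Longrightarrow> norm x \<le> r \<Longrightarrow>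
     \<bar>euler_op \<delta> h x - h x - \<delta> * sde_generator f g h x\<bar> \<le> \<epsilon> * \<delta>"
proof -
  interpret test_function h R by fact
  let ?d = "real CARD('d)" and ?n = "real CARD('n)"
  define G where "G = linear_growth * (1 + r)"
  have G: "norm (f x) \<le> G" "norm (g x) \<le> G" if "norm x \<le> r" for x
  proof -
    have "linear_growth * (1 + norm x) \<le> G"
      unfolding G_def using that linear_growth_nonneg by (intro mult_left_mono) auto
    then show "norm (f x) \<le> G" "norm (g x) \<le> G" using f_growth[of x] g_growth[of x] by linarith+
  qed
  define c2 where "c2 = 2 * (1 + ?d) * G\<^sup>2"
  define c4 where "c4 = 8 * (1 + 3 * ?d\<^sup>2) * G^4"
  have c: "0 \<le> c2" "0 \<le> c4" by (simp_all add: c2_def c4_def)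
  \<comment> \<open>The quadratic part of the Taylor remainder has mean at most
    \<open>e * (c2 * \<delta>)\<close>, thus at most half of the allowed error.\<close>
  define e where "e = \<epsilon> / (2 * (c2 + 1))"
  have e: "0 < e" using \<epsilon> c by (simp add: e_def)
  have ec: "e * c2 \<le> \<epsilon> / 2"
    using \<epsilon> c by (simp add: e_def field_simps)
  obtain C where C: "0 \<le> C" and taylor: "\<And>x v. \<bar>h (x + v) - h x - (\<Sum>j\<in>UNIV. v $ j * D j x)
      - 1/2 * (\<Sum>j\<in>UNIV. \<Sum>i\<in>UNIV. v $ j * v $ i * DD i j x)\<bar> \<le> e * (norm v)\<^sup>2 + C * (norm v)^4"
    by (rule taylor_remainder[OF e]) (rule that)
  obtain K where K: "0 \<le> K" "\<And>i j x. \<bar>DD i j x\<bar> \<le> K"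
    by (rule DD_bounded) (rule that)
  obtain B K' where bl: "bounded_lipschitz B K' h" by (rule h_bounded_lipschitz)
  note hD = bounded_lipschitzD[OF bl]
  define c3 where "c3 = 1/2 * (?n\<^sup>2 * (G\<^sup>2 * K))"
  have c3: "0 \<le> c3" using K by (simp add: c3_def)
  \<comment> \<open>Makes the terms of order \<open>\<delta>\<^sup>2\<close>, namely the fourth
    moment of the step and the squared drift, at most the other half.\<close>
  define \<delta>0 where "\<delta>0 = min 1 (\<epsilon> / (2 * (c3 + C * c4 + 1)))"
  have pos: "0 < c3 + C * c4 + 1" using c3 C c by (simp add: add_nonneg_pos)
  show thesis
  proof (rule that)
    show "0 < \<delta>0" "\<delta>0 \<le> 1" using pos \<epsilon> by (simp_all add: \<delta>0_def)
    fix \<delta> :: real and x :: "real^'n" assume \<delta>: "0 < \<delta>" "\<delta> < \<delta>0" and x: "norm x \<le> r"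
    have \<delta>1: "\<delta> \<le> 1" using \<delta> by (simp add: \<delta>0_def)
    note mom = displacement_moments[OF \<delta>(1) \<delta>1 G[OF x]]
    note mean = displacement_mean[OF \<delta>(1), of x] and cov = displacement_covariance[OF \<delta>(1), of x]
    let ?v = "displacement \<delta> x"
    have v_meas: "?v \<in> borel_measurable M" by (rule displacement_measurable) (use \<delta> in simp)
    have "(\<lambda>\<omega>. h (x + ?v \<omega>)) \<in> borel_measurable M"
      by (rule measurable_compose[OF _ hD(5)]) (use v_meas in simp)
    then have inth: "integrable M (\<lambda>\<omega>. h (x + ?v \<omega>))" by (rule integrable_bounded) (rule hD(3))
    have int1: "integrable M (\<lambda>\<omega>. \<Sum>j\<in>UNIV. ?v \<omega> $ j * D j x)"
      by (intro Bochner_Integration.integrable_sum integrable_mult_left mean(1))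
    have E1: "expectation (\<lambda>\<omega>. \<Sum>j\<in>UNIV. ?v \<omega> $ j * D j x) = \<delta> * (\<Sum>j\<in>UNIV. f x $ j * D j x)"
      using mean by (simp add: sum_distrib_left mult.assoc)
    have int2: "integrable M (\<lambda>\<omega>. \<Sum>j\<in>UNIV. \<Sum>i\<in>UNIV. ?v \<omega> $ j * ?v \<omega> $ i * DD i j x)"
      by (intro Bochner_Integration.integrable_sum integrable_mult_left cov(1))
    have E2: "expectation (\<lambda>\<omega>. \<Sum>j\<in>UNIV. \<Sum>i\<in>UNIV. ?v \<omega> $ j * ?v \<omega> $ i * DD i j x)
        = \<delta>\<^sup>2 * (\<Sum>j\<in>UNIV. \<Sum>i\<in>UNIV. f x $ j * f x $ i * DD i j x)
          + \<delta> * (\<Sum>j\<in>UNIV. \<Sum>i\<in>UNIV. (\<Sum>a\<in>UNIV. g x $ j $ a * g x $ i $ a) * DD i j x)"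
    proof -
      have "expectation (\<lambda>\<omega>. \<Sum>j\<in>UNIV. \<Sum>i\<in>UNIV. ?v \<omega> $ j * ?v \<omega> $ i * DD i j x)
          = (\<Sum>j\<in>UNIV. \<Sum>i\<in>UNIV. (\<delta>\<^sup>2 * (f x $ j * f x $ i) + \<delta> * (\<Sum>a\<in>UNIV. g x $ j $ a * g x $ i $ a)) * DD i j x)"
        using cov by (simp add: Bochner_Integration.integrable_sum)
      moreover have "(\<Sum>j\<in>UNIV. \<Sum>i\<in>UNIV. (p * u j i + q * s j i) * w j i)
          = p * (\<Sum>j\<in>UNIV. \<Sum>i\<in>UNIV. u j i * w j i) + q * (\<Sum>j\<in>UNIV. \<Sum>i\<in>UNIV. s j i * w j i)"
        for p q :: real and u s w :: "'n \<Rightarrow> 'n \<Rightarrow> real"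
        by (simp add: distrib_right sum.distrib sum_distrib_left mult.assoc)
      ultimately show ?thesis by (rule trans)
    qed
    \<comment> \<open>The Taylor remainder at the random displacement; its mean is computed exactly
      from the first two moments and bounded by \<open>taylor\<close>.\<close>
    define T where "T \<omega> = h (x + ?v \<omega>) - h x - (\<Sum>j\<in>UNIV. ?v \<omega> $ j * D j x)
        - 1/2 * (\<Sum>j\<in>UNIV. \<Sum>i\<in>UNIV. ?v \<omega> $ j * ?v \<omega> $ i * DD i j x)" for \<omega>
    have intT: "integrable M T"
      unfolding T_def by (intro Bochner_Integration.integrable_diff inth int1 integrable_mult_right int2 integrable_const)
    have ET: "expectation T = euler_op \<delta> h x - h x - \<delta> * (\<Sum>j\<in>UNIV. f x $ j * D j x)
        - 1/2 * (\<delta>\<^sup>2 * (\<Sum>j\<in>UNIV. \<Sum>i\<in>UNIV. f x $ j * f x $ i * DD i j x)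
          + \<delta> * (\<Sum>j\<in>UNIV. \<Sum>i\<in>UNIV. (\<Sum>a\<in>UNIV. g x $ j $ a * g x $ i $ a) * DD i j x))"
    proof -
      have "expectation T = expectation (\<lambda>\<omega>. h (x + ?v \<omega>) - h x - (\<Sum>j\<in>UNIV. ?v \<omega> $ j * D j x))
          - expectation (\<lambda>\<omega>. 1/2 * (\<Sum>j\<in>UNIV. \<Sum>i\<in>UNIV. ?v \<omega> $ j * ?v \<omega> $ i * DD i j x))"
        unfolding T_def by (intro Bochner_Integration.integral_diff Bochner_Integration.integrable_diff inth int1
            integrable_mult_right int2 integrable_const)
      also have "expectation (\<lambda>\<omega>. h (x + ?v \<omega>) - h x - (\<Sum>j\<in>UNIV. ?v \<omega> $ j * D j x))
          = expectation (\<lambda>\<omega>. h (x + ?v \<omega>) - h x) - expectation (\<lambda>\<omega>. \<Sum>j\<in>UNIV. ?v \<omega> $ j * D j x)"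
        by (intro Bochner_Integration.integral_diff Bochner_Integration.integrable_diff inth int1 integrable_const)
      also have "expectation (\<lambda>\<omega>. h (x + ?v \<omega>) - h x) = expectation (\<lambda>\<omega>. h (x + ?v \<omega>)) - expectation (\<lambda>_. h x)"
        by (intro Bochner_Integration.integral_diff inth integrable_const)
      finally show ?thesis
        unfolding integral_mult_right_zero E1 E2 expectation_const euler_op_def euler_step_displacement .
    qed
    have "\<bar>expectation T\<bar> \<le> expectation (\<lambda>\<omega>. \<bar>T \<omega>\<bar>)" by (rule integral_abs_bound)
    also have "\<dots> \<le> expectation (\<lambda>\<omega>. e * (norm (?v \<omega>))\<^sup>2 + C * (norm (?v \<omega>))^4)"
    proof (rule integral_mono[OF integrable_abs[OF intT]])
      show "integrable M (\<lambda>\<omega>. e * (norm (?v \<omega>))\<^sup>2 + C * (norm (?v \<omega>))^4)"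
        by (intro Bochner_Integration.integrable_add integrable_mult_right mom(1,3))
      show "\<bar>T \<omega>\<bar> \<le> e * (norm (?v \<omega>))\<^sup>2 + C * (norm (?v \<omega>))^4" for \<omega>
        unfolding T_def by (rule taylor)
    qed
    also have "\<dots> = e * expectation (\<lambda>\<omega>. (norm (?v \<omega>))\<^sup>2) + C * expectation (\<lambda>\<omega>. (norm (?v \<omega>))^4)"
      using mom(1,3) by simp
    also have "\<dots> \<le> e * (c2 * \<delta>) + C * (c4 * \<delta>\<^sup>2)"
      using mom(2,4) e C unfolding c2_def c4_def by (intro add_mono mult_left_mono) auto
    finally have T_le: "\<bar>expectation T\<bar> \<le> e * (c2 * \<delta>) + C * (c4 * \<delta>\<^sup>2)" .
    let ?S = "\<Sum>j\<in>UNIV. \<Sum>i\<in>UNIV. f x $ j * f x $ i * DD i j x"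
    have S: "\<bar>?S\<bar> \<le> ?n\<^sup>2 * (G\<^sup>2 * K)"
    proof -
      have "\<bar>?S\<bar> \<le> (\<Sum>j\<in>(UNIV :: 'n set). \<Sum>i\<in>(UNIV :: 'n set). G\<^sup>2 * K)"
      proof (rule order_trans[OF sum_abs], rule sum_mono, rule order_trans[OF sum_abs], rule sum_mono)
        fix i j
        have fG: "\<bar>f x $ k\<bar> \<le> G" for k using component_le_norm_cart[of "f x" k] G(1)[OF x] by linarith
        have "\<bar>f x $ j\<bar> * \<bar>f x $ i\<bar> \<le> G * G"
          using fG[of i] fG[of j] by (intro mult_mono) auto
        then have "\<bar>f x $ j\<bar> * \<bar>f x $ i\<bar> * \<bar>DD i j x\<bar> \<le> (G * G) * K"
          using K(2)[of i j x] by (rule mult_mono) auto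
        then show "\<bar>f x $ j * f x $ i * DD i j x\<bar> \<le> G\<^sup>2 * K"
          by (simp add: abs_mult power2_eq_square)
      qed
      then show ?thesis by (simp add: power2_eq_square)
    qed
    \<comment> \<open>Apart from the mean remainder, the expansion misses the generator only by the
      squared drift, which enters the second moment with a factor
      \<open>\<delta>\<^sup>2\<close>.\<close>
    have "euler_op \<delta> h x - h x - \<delta> * sde_generator f g h x = expectation T + 1/2 * (\<delta>\<^sup>2 * ?S)"
      unfolding ET sde_generator_alt by (simp add: algebra_simps)
    also have "\<bar>\<dots>\<bar> \<le> \<bar>expectation T\<bar> + 1/2 * (\<delta>\<^sup>2 * \<bar>?S\<bar>)"
      using abs_triangle_ineq[of "expectation T" "1/2 * (\<delta>\<^sup>2 * ?S)"] by (simp add: abs_mult)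
    also have "\<dots> \<le> (e * (c2 * \<delta>) + C * (c4 * \<delta>\<^sup>2)) + 1/2 * (\<delta>\<^sup>2 * (?n\<^sup>2 * (G\<^sup>2 * K)))"
      using T_le S by (intro add_mono mult_left_mono) auto
    also have "\<dots> = (e * c2) * \<delta> + (\<delta> * (c3 + C * c4)) * \<delta>"
      by (simp add: c3_def power2_eq_square algebra_simps)
    also have "\<dots> \<le> (\<epsilon> / 2) * \<delta> + (\<epsilon> / 2) * \<delta>"
    proof (rule add_mono; rule mult_right_mono)
      have "\<delta> * (c3 + C * c4) \<le> \<delta> * (c3 + C * c4 + 1)" using \<delta> by (intro mult_left_mono) auto
      also have "\<dots> \<le> \<epsilon> / (2 * (c3 + C * c4 + 1)) * (c3 + C * c4 + 1)"
        using \<delta>(2) pos by (intro mult_right_mono) (auto simp: \<delta>0_def)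
      also have "\<dots> = \<epsilon> / 2"
      proof -
        have "\<epsilon> / (2 * z) * z = \<epsilon> / 2" if "0 < z" for z using that by simp
        then show ?thesis using pos by blast
      qed
      finally show "\<delta> * (c3 + C * c4) \<le> \<epsilon> / 2" .
    qed (use ec \<delta> in auto)
    also have "\<dots> = \<epsilon> * \<delta>" by simp
    finally show "\<bar>euler_op \<delta> h x - h x - \<delta> * sde_generator f g h x\<bar> \<le> \<epsilon> * \<delta>" .
  qed
qed

text \<open>Here \<open>h\<close> and the generator vanish at x, and \<open>h (x + v)\<close> can
  differ from 0 only if \<open>norm v\<close> is at least \<open>norm x / 2\<close>. A Markov bound
  of order four has \<open>(norm x)^4\<close> in the denominator and, by linear growth, in the
  fourth moment; they cancel and leave \<open>\<delta>\<^sup>2\<close>.\<close>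

lemma euler_op_generator_far:
  assumes h: "test_function h R"
  obtains c where "0 \<le> c" "\<And>\<delta> x. 0 < \<delta> \<Longrightarrow> \<delta> \<le> 1 \<Longrightarrow> 2 * R + 1 < norm x \<Longrightarrow>
     \<bar>euler_op \<delta> h x - h x - \<delta> * sde_generator f g h x\<bar> \<le> c * \<delta>\<^sup>2"
proof -
  interpret test_function h R by fact
  let ?d = "real CARD('d)"
  obtain B K' where bl: "bounded_lipschitz B K' h" by (rule h_bounded_lipschitz)
  note hD = bounded_lipschitzD[OF bl]
  define c where "c = B * (16 * (8 * (1 + 3 * ?d\<^sup>2) * (2 * linear_growth)^4))"
  show thesis
  proof (rule that)
    show "0 \<le> c" using hD(1) by (simp add: c_def)
    fix \<delta> :: real and x :: "real^'n" assume \<delta>: "0 < \<delta>" "\<delta> \<le> 1" and x: "2 * R + 1 < norm x"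
    let ?v = "displacement \<delta> x"
    have x1: "1 \<le> norm x" "R < norm x" using x R_pos by auto
    have x0: "x \<noteq> 0" using x1(2) R_pos by auto
    have "linear_growth * (1 + norm x) \<le> 2 * linear_growth * norm x"
      using mult_left_mono[OF x1(1) linear_growth_nonneg] by (simp add: algebra_simps)
    then have G: "norm (f x) \<le> 2 * linear_growth * norm x" "norm (g x) \<le> 2 * linear_growth * norm x"
      using f_growth[of x] g_growth[of x] by linarith+
    note mom = displacement_moments[OF \<delta> G]
    have v_meas: "?v \<in> borel_measurable M" by (rule displacement_measurable) (use \<delta> in simp)
    have "(\<lambda>\<omega>. h (x + ?v \<omega>)) \<in> borel_measurable M"
      by (rule measurable_compose[OF _ hD(5)]) (use v_meas in simp)
    then have inth: "integrable M (\<lambda>\<omega>. h (x + ?v \<omega>))" by (rule integrable_bounded) (rule hD(3))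
    have le: "\<bar>h (x + ?v \<omega>)\<bar> \<le> B * (16 / (norm x)^4) * (norm (?v \<omega>))^4" for \<omega>
    proof (cases "norm x \<le> 2 * norm (?v \<omega>)")
      case True
      then have "(norm x)^4 \<le> (2 * norm (?v \<omega>))^4" by (intro power_mono) auto
      then have "1 \<le> 16 / (norm x)^4 * (norm (?v \<omega>))^4"
        using x0 by (simp add: power_mult_distrib le_divide_eq)
      then have "B * 1 \<le> B * (16 / (norm x)^4 * (norm (?v \<omega>))^4)" using hD(1) by (rule mult_left_mono)
      then show ?thesis using hD(3)[of "x + ?v \<omega>"] by simp
    next
      case False
      have "norm x \<le> norm (x + ?v \<omega>) + norm (?v \<omega>)"
        using norm_triangle_ineq4[of "x + ?v \<omega>" "?v \<omega>"] by simp
      then have "R < norm (x + ?v \<omega>)" using False x by simp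
      then show ?thesis using supp hD(1) by simp
    qed
    have "\<bar>euler_op \<delta> h x\<bar> \<le> expectation (\<lambda>\<omega>. \<bar>h (x + ?v \<omega>)\<bar>)"
      unfolding euler_op_def euler_step_displacement by (rule integral_abs_bound)
    also have "\<dots> \<le> expectation (\<lambda>\<omega>. B * (16 / (norm x)^4) * (norm (?v \<omega>))^4)"
      by (rule integral_mono) (use inth mom(3) le in auto)
    also have "\<dots> = B * (16 / (norm x)^4) * expectation (\<lambda>\<omega>. (norm (?v \<omega>))^4)" by simp
    also have "\<dots> \<le> B * (16 / (norm x)^4) * (8 * (1 + 3 * ?d\<^sup>2) * (2 * linear_growth * norm x)^4 * \<delta>\<^sup>2)"
      using mom(4) hD(1) by (intro mult_left_mono) auto
    also have "\<dots> = c * \<delta>\<^sup>2"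
    proof -
      show ?thesis using x0 unfolding c_def power_mult_distrib by (simp add: field_simps)
    qed
    finally show "\<bar>euler_op \<delta> h x - h x - \<delta> * sde_generator f g h x\<bar> \<le> c * \<delta>\<^sup>2"
      using supp[OF x1(2)] generator_support[OF h x1(2)] by simp
  qed
qed

lemma euler_op_generator:
  assumes h: "test_function h R" and \<epsilon>: "0 < \<epsilon>"
  obtains \<delta>0 where "0 < \<delta>0" "\<delta>0 \<le> 1" "\<And>\<delta> x. 0 < \<delta> \<Longrightarrow> \<delta> < \<delta>0 \<Longrightarrow>
     \<bar>euler_op \<delta> h x - h x - \<delta> * sde_generator f g h x\<bar> \<le> \<epsilon> * \<delta>"
proof -
  interpret test_function h R by fact
  have r: "0 < 2 * R + 1" using R_pos by simp
  obtain \<delta>1 where \<delta>1: "0 < \<delta>1" "\<delta>1 \<le> 1" "\<And>\<delta> x. 0 < \<delta> \<Longrightarrow> \<delta> < \<delta>1 \<Longrightarrow> norm x \<le> 2 * R + 1 \<Longrightarrow>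
     \<bar>euler_op \<delta> h x - h x - \<delta> * sde_generator f g h x\<bar> \<le> \<epsilon> * \<delta>"
    by (rule euler_op_generator_near[OF h r \<epsilon>]) (rule that)
  obtain c where c: "0 \<le> c" "\<And>\<delta> x. 0 < \<delta> \<Longrightarrow> \<delta> \<le> 1 \<Longrightarrow> 2 * R + 1 < norm x \<Longrightarrow>
     \<bar>euler_op \<delta> h x - h x - \<delta> * sde_generator f g h x\<bar> \<le> c * \<delta>\<^sup>2"
    by (rule euler_op_generator_far[OF h]) (rule that)
  show thesis
  proof (rule that[of "min \<delta>1 (\<epsilon> / (c + 1))"])
    show "0 < min \<delta>1 (\<epsilon> / (c + 1))" "min \<delta>1 (\<epsilon> / (c + 1)) \<le> 1" using \<delta>1 c \<epsilon> by auto
    fix \<delta> :: real and x :: "real^'n" assume \<delta>: "0 < \<delta>" "\<delta> < min \<delta>1 (\<epsilon> / (c + 1))"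
    show "\<bar>euler_op \<delta> h x - h x - \<delta> * sde_generator f g h x\<bar> \<le> \<epsilon> * \<delta>"
    proof (cases "norm x \<le> 2 * R + 1")
      case True
      then show ?thesis using \<delta> by (intro \<delta>1(3)) auto
    next
      case False
      have "\<bar>euler_op \<delta> h x - h x - \<delta> * sde_generator f g h x\<bar> \<le> c * \<delta>\<^sup>2"
        using False \<delta> \<delta>1(2) by (intro c(2)) auto
      also have "\<dots> = (c * \<delta>) * \<delta>" by (simp add: power2_eq_square)
      also have "\<dots> \<le> \<epsilon> * \<delta>"
      proof (rule mult_right_mono)
        have "c * \<delta> \<le> (c + 1) * \<delta>" using \<delta> by simp
        also have "\<dots> \<le> (c + 1) * (\<epsilon> / (c + 1))" using \<delta> c(1) by (intro mult_left_mono) auto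
        also have "\<dots> = \<epsilon>" using c(1) by simp
        finally show "c * \<delta> \<le> \<epsilon>" .
      qed (use \<delta> in simp)
      finally show ?thesis .
    qed
  qed
qed

text \<open>Chebyshev's inequality for the displacement, at a radius adapted to x:
  \<open>\<rho> / 2\<close> near the support, by uniform continuity, and \<open>norm x / 2\<close>
  far from it, where \<phi> vanishes at both points. In the far case linear growth cancels the
  dependence on x.\<close>

lemma euler_stays_close:
  fixes \<phi> :: "real^'n \<Rightarrow> real"
  assumes cont: "continuous_on UNIV \<phi>" and R: "0 < R" and supp: "\<And>x. R < norm x \<Longrightarrow> \<phi> x = 0" and \<epsilon>: "0 < \<epsilon>"
  obtains t0 where "0 < t0" "\<And>m \<tau> p x. fine_partition 1 m \<tau> \<Longrightarrow> p \<le> m \<Longrightarrow> \<tau> p \<le> t0 \<Longrightarrow>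
     \<bar>expectation (\<lambda>\<omega>. \<phi> (euler f g \<tau> x p \<omega>)) - \<phi> x\<bar> \<le> \<epsilon>"
proof -
  obtain B where B: "0 \<le> B" "\<And>x. \<bar>\<phi> x\<bar> \<le> B"
    by (rule compact_support_bounded[OF cont supp]) (assumption, rule that)
  have \<epsilon>2: "0 < \<epsilon> / 2" using \<epsilon> by simp
  obtain \<rho> where \<rho>: "0 < \<rho>" "\<And>x y. norm (x - y) < \<rho> \<Longrightarrow> \<bar>\<phi> x - \<phi> y\<bar> < \<epsilon> / 2"
    by (rule compact_support_uniformly_continuous[OF cont supp \<epsilon>2]) (assumption, rule that)
  have \<phi>_meas: "\<phi> \<in> borel_measurable borel" by (rule borel_measurable_continuous_onI[OF cont])
  let ?c = "growth_rate L"
  have c: "0 < ?c" by (rule growth_rate_pos[OF L_nonneg])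
  \<comment> \<open>The time factor of the displacement bound; it tends to 0 with t.\<close>
  define q where "q t = exp (?c * t) * (?c * t)" for t
  define G where "G = 2 * (linear_growth * (2 + 2 * R))"
  \<comment> \<open>Bounds the squared coefficients divided by the squared radius in both cases; the
    far case gives 64 as the square of 4 over the square of \<open>1/2\<close>.\<close>
  define Z where "Z = max (G\<^sup>2 / (\<rho> / 2)\<^sup>2) (64 * linear_growth\<^sup>2)"
  have "((\<lambda>t. 2 * B * (q t * Z)) \<longlongrightarrow> 2 * B * (exp (?c * 0) * (?c * 0) * Z)) (at_right 0)"
    unfolding q_def by (intro tendsto_intros)
  then have "\<forall>\<^sub>F t in at_right 0. 2 * B * (q t * Z) < \<epsilon> / 2"
    using \<epsilon>2 by (intro order_tendstoD(2)) auto
  moreover have "\<forall>\<^sub>F t in at_right (0::real). 0 < t" by (rule eventually_at_right_less)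
  ultimately have "\<forall>\<^sub>F t in at_right 0. 2 * B * (q t * Z) < \<epsilon> / 2 \<and> 0 < t" by (rule eventually_conj)
  then have "\<exists>t. 2 * B * (q t * Z) < \<epsilon> / 2 \<and> 0 < t"
    by (rule eventually_happens'[OF trivial_limit_at_right_real])
  then obtain t0 where t0: "2 * B * (q t0 * Z) < \<epsilon> / 2" "0 < t0" by blast
  show thesis
  proof (rule that[OF t0(2)])
    fix m \<tau> p x assume \<tau>: "fine_partition 1 m \<tau>" "p \<le> m" "\<tau> p \<le> t0"
    let ?e = "euler f g \<tau> x p"
    have e_meas: "?e \<in> borel_measurable M"
      by (rule measurable_F_M[OF euler_measurable[OF \<tau>(1,2)]])
    have d_meas: "(\<lambda>\<omega>. norm (?e \<omega> - x)) \<in> borel_measurable M" using e_meas by simp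
    have "0 \<le> \<tau> p" by (rule fine_partitionD(5)[OF \<tau>(1,2)])
    then have q_le: "q (\<tau> p) \<le> q t0"
      unfolding q_def using \<tau>(3) c by (intro mult_mono) auto
    have q0: "0 \<le> q t0" unfolding q_def using c t0(2) by simp
    have moment: "expectation (\<lambda>\<omega>. (norm (?e \<omega> - x))\<^sup>2) \<le> q t0 * (norm (f x) + norm (g x))\<^sup>2"
    proof -
      have "expectation (\<lambda>\<omega>. (norm (?e \<omega> - x))\<^sup>2) \<le> q (\<tau> p) * (norm (f x) + norm (g x))\<^sup>2"
        using euler_displacement(2)[OF \<tau>(1,2), of x] unfolding q_def by (simp add: mult.assoc)
      also have "\<dots> \<le> q t0 * (norm (f x) + norm (g x))\<^sup>2" by (rule mult_right_mono[OF q_le]) simp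
      finally show ?thesis .
    qed
    have bound: "\<bar>expectation (\<lambda>\<omega>. \<phi> (?e \<omega>)) - \<phi> x\<bar> \<le> \<epsilon>"
      if r: "0 < r" and close: "\<And>y. norm (y - x) \<le> r \<Longrightarrow> \<bar>\<phi> y - \<phi> x\<bar> \<le> \<epsilon> / 2"
        and Z: "(norm (f x) + norm (g x))\<^sup>2 / r\<^sup>2 \<le> Z" for r
    proof -
      let ?A = "{\<omega>\<in>space M. \<bar>norm (?e \<omega> - x)\<bar> > r}"
      have A: "?A \<in> sets M" using d_meas by measurable
      have "prob ?A \<le> expectation (\<lambda>\<omega>. (norm (?e \<omega> - x))\<^sup>2) / r\<^sup>2"
        by (rule prob_gt_le_second_moment[OF d_meas euler_displacement(1)[OF \<tau>(1,2)] r])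
      also have "\<dots> \<le> q t0 * (norm (f x) + norm (g x))\<^sup>2 / r\<^sup>2"
        by (rule divide_right_mono[OF moment]) simp
      also have "\<dots> \<le> q t0 * Z"
        using mult_left_mono[OF Z q0] by simp
      finally have PA: "prob ?A \<le> q t0 * Z" .
      have "\<bar>expectation (\<lambda>\<omega>. \<phi> (?e \<omega>)) - expectation (\<lambda>_. \<phi> x)\<bar> \<le> \<epsilon> / 2 + 2 * B * prob ?A"
        by (rule expectation_diff_le[OF e_meas _ \<phi>_meas B(2) \<phi>_meas B(2) A, where Z = "\<lambda>_. x"])
          (use close \<epsilon> in \<open>auto simp: not_less\<close>)
      also have "2 * B * prob ?A \<le> 2 * B * (q t0 * Z)"
        using PA B(1) by (intro mult_left_mono) auto
      finally show ?thesis using t0(1) unfolding expectation_const by linarith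
    qed
    show "\<bar>expectation (\<lambda>\<omega>. \<phi> (?e \<omega>)) - \<phi> x\<bar> \<le> \<epsilon>"
    proof (cases "norm x \<le> 2 * R + 1")
      case True
      show ?thesis
      proof (rule bound[of "\<rho> / 2"])
        show "\<bar>\<phi> y - \<phi> x\<bar> \<le> \<epsilon> / 2" if "norm (y - x) \<le> \<rho> / 2" for y
          using \<rho>(2)[of y x] that \<rho>(1) by simp
        have "linear_growth * (1 + norm x) \<le> linear_growth * (2 + 2 * R)"
          using True linear_growth_nonneg by (intro mult_left_mono) auto
        then have "norm (f x) + norm (g x) \<le> G" using f_growth[of x] g_growth[of x] unfolding G_def by linarith
        then have "(norm (f x) + norm (g x))\<^sup>2 \<le> G\<^sup>2" by (rule power_mono) simp
        then have "(norm (f x) + norm (g x))\<^sup>2 / (\<rho> / 2)\<^sup>2 \<le> G\<^sup>2 / (\<rho> / 2)\<^sup>2"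
          by (rule divide_right_mono) simp
        then show "(norm (f x) + norm (g x))\<^sup>2 / (\<rho> / 2)\<^sup>2 \<le> Z" unfolding Z_def by simp
      qed (use \<rho> in simp)
    next
      case False
      then have x: "2 * R + 1 < norm x" "1 \<le> norm x" "R < norm x" using R by auto
      show ?thesis
      proof (rule bound[of "norm x / 2"])
        show "\<bar>\<phi> y - \<phi> x\<bar> \<le> \<epsilon> / 2" if "norm (y - x) \<le> norm x / 2" for y
        proof -
          have "R < norm y" using that x(1) norm_triangle_sub[of x y] by (simp add: norm_minus_commute)
          then show ?thesis using supp[of y] supp[OF x(3)] \<epsilon> by simp
        qed
        have "linear_growth * (1 + norm x) \<le> linear_growth * (2 * norm x)"
          using x(2) linear_growth_nonneg by (intro mult_left_mono) auto
        then have "norm (f x) + norm (g x) \<le> 4 * linear_growth * norm x"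
          using f_growth[of x] g_growth[of x] by linarith
        then have "(norm (f x) + norm (g x))\<^sup>2 \<le> (4 * linear_growth * norm x)\<^sup>2" by (rule power_mono) simp
        then have "(norm (f x) + norm (g x))\<^sup>2 / (norm x / 2)\<^sup>2 \<le> (4 * linear_growth * norm x)\<^sup>2 / (norm x / 2)\<^sup>2"
          by (rule divide_right_mono) simp
        also have "\<dots> = 64 * linear_growth\<^sup>2"
        proof -
          have "x \<noteq> 0" using x(2) by auto
          then show ?thesis by (simp add: power_mult_distrib power_divide)
        qed
        finally show "(norm (f x) + norm (g x))\<^sup>2 / (norm x / 2)\<^sup>2 \<le> Z" unfolding Z_def by simp
      qed (use x in auto)
    qed
  qed
qed

end

section \<open>From one Euler step to the generator of the semigroup\<close>

context sde_flow
begin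

text \<open>Each step of length \<delta> costs at most \<open>\<epsilon> * \<delta>\<close> for the
  one-step expansion and as much again for replacing the generator term at the current position by
  its value at x. The total is free of the number of steps and of x, so it survives the
  limit.\<close>

lemma expectation_generator_estimate:
  assumes h: "test_function h R" and \<epsilon>: "0 < \<epsilon>"
  obtains t0 where "0 < t0" "\<And>t x. 0 < t \<Longrightarrow> t \<le> t0 \<Longrightarrow>
     \<bar>expectation (\<lambda>\<omega>. h (X t x \<omega>)) - h x - t * sde_generator f g h x\<bar> \<le> 2 * \<epsilon> * t"
proof -
  interpret test_function h R by fact
  let ?A = "sde_generator f g h"
  have A_cont: "continuous_on UNIV ?A" by (rule generator_continuous[OF h])
  have A_supp: "\<And>x. R < norm x \<Longrightarrow> ?A x = 0" by (rule generator_support[OF h])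
  have A_meas: "?A \<in> borel_measurable borel" by (rule borel_measurable_continuous_onI[OF A_cont])
  obtain BA where BA: "\<And>x. \<bar>?A x\<bar> \<le> BA"
    by (rule compact_support_bounded[OF A_cont A_supp]) (assumption, rule that)
  obtain B K where bl: "bounded_lipschitz B K h" by (rule h_bounded_lipschitz)
  note hD = bounded_lipschitzD[OF bl]
  obtain t0 where t0: "0 < t0" and close: "\<And>m \<tau> p x. fine_partition 1 m \<tau> \<Longrightarrow> p \<le> m \<Longrightarrow> \<tau> p \<le> t0 \<Longrightarrow>
     \<bar>expectation (\<lambda>\<omega>. ?A (euler f g \<tau> x p \<omega>)) - ?A x\<bar> \<le> \<epsilon>"
    by (rule euler_stays_close[OF A_cont R_pos A_supp \<epsilon>]) (assumption, rule that)
  obtain \<delta>0 where \<delta>0: "0 < \<delta>0" "\<delta>0 \<le> 1" and gen: "\<And>\<delta> x. 0 < \<delta> \<Longrightarrow> \<delta> < \<delta>0 \<Longrightarrow>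
     \<bar>euler_op \<delta> h x - h x - \<delta> * ?A x\<bar> \<le> \<epsilon> * \<delta>"
    by (rule euler_op_generator[OF h \<epsilon>]) (rule that)
  show thesis
  proof (rule that[OF t0])
    fix t x assume t: "0 < t" "t \<le> t0"
    have step: "\<bar>(euler_op (t / real (Suc n)) ^^ Suc n) h x - h x - t * ?A x\<bar> \<le> 2 * \<epsilon> * t"
      if n: "t / real (Suc n) < \<delta>0" for n
    proof -
      define \<delta> where "\<delta> = t / real (Suc n)"
      have "0 < \<delta>" "\<delta> < \<delta>0" using t n by (simp_all add: \<delta>_def)
      then have \<delta>: "0 < \<delta>" "\<delta> < \<delta>0" "\<delta> < 1" using \<delta>0(2) by auto
      let ?\<tau> = "\<lambda>k. real k * \<delta>"
      have N\<delta>: "real (Suc n) * \<delta> = t" by (simp add: \<delta>_def)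
      have fine: "fine_partition 1 (Suc n) ?\<tau>" by (rule fine_partition_uniform[OF \<delta>(1,3)])
      let ?e = "euler f g ?\<tau> x"
      \<comment> \<open>The telescoping sum in inductive form; the second error of a step needs its
        node not to exceed \<open>t0\<close>, which holds because t does not.\<close>
      have "\<bar>expectation (\<lambda>\<omega>. h (?e p \<omega>)) - h x - real p * (\<delta> * ?A x)\<bar> \<le> real p * (2 * \<epsilon> * \<delta>)" if "p \<le> Suc n" for p
        using that
      proof (induction p)
        case 0
        then show ?case unfolding euler.simps expectation_const by simp
      next
        case (Suc p)
        then have p: "p < Suc n" "p \<le> Suc n" by auto
        have e_meas: "?e p \<in> borel_measurable M"
          by (rule measurable_F_M[OF euler_measurable[OF fine p(2)]])
        note Q = euler_op_bounded_measurable[OF less_imp_le[OF \<delta>(1)] hD(5,3)]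
        have ints: "integrable M (\<lambda>\<omega>. h (?e p \<omega>))" "integrable M (\<lambda>\<omega>. euler_op \<delta> h (?e p \<omega>))" "integrable M (\<lambda>\<omega>. ?A (?e p \<omega>))"
          by (rule integrable_bounded[OF measurable_compose[OF e_meas hD(5)] hD(3)],
              rule integrable_bounded[OF measurable_compose[OF e_meas Q(1)] Q(2)],
              rule integrable_bounded[OF measurable_compose[OF e_meas A_meas] BA])
        have "expectation (\<lambda>\<omega>. h (?e (Suc p) \<omega>)) = expectation (\<lambda>\<omega>. euler_op (?\<tau> (Suc p) - ?\<tau> p) h (?e p \<omega>))"
          by (rule expectation_euler_Suc[OF fine p(1) hD(5,3)])
        also have "?\<tau> (Suc p) - ?\<tau> p = \<delta>" by (simp add: algebra_simps)
        finally have Suc_eq: "expectation (\<lambda>\<omega>. h (?e (Suc p) \<omega>)) = expectation (\<lambda>\<omega>. euler_op \<delta> h (?e p \<omega>))" .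
        have "expectation (\<lambda>\<omega>. euler_op \<delta> h (?e p \<omega>) - h (?e p \<omega>) - \<delta> * ?A (?e p \<omega>))
            = expectation (\<lambda>\<omega>. euler_op \<delta> h (?e p \<omega>)) - expectation (\<lambda>\<omega>. h (?e p \<omega>)) - \<delta> * expectation (\<lambda>\<omega>. ?A (?e p \<omega>))"
          using ints by simp
        moreover have "\<bar>expectation (\<lambda>\<omega>. euler_op \<delta> h (?e p \<omega>) - h (?e p \<omega>) - \<delta> * ?A (?e p \<omega>))\<bar> \<le> \<epsilon> * \<delta>"
        proof -
          have "\<bar>expectation (\<lambda>\<omega>. euler_op \<delta> h (?e p \<omega>) - h (?e p \<omega>) - \<delta> * ?A (?e p \<omega>))\<bar>
              \<le> expectation (\<lambda>\<omega>. \<bar>euler_op \<delta> h (?e p \<omega>) - h (?e p \<omega>) - \<delta> * ?A (?e p \<omega>)\<bar>)"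
            by (rule integral_abs_bound)
          also have "\<dots> \<le> expectation (\<lambda>_. \<epsilon> * \<delta>)"
            by (rule integral_mono) (use ints gen[OF \<delta>(1,2)] in auto)
          finally show ?thesis unfolding expectation_const .
        qed
        moreover have "\<bar>\<delta> * expectation (\<lambda>\<omega>. ?A (?e p \<omega>)) - \<delta> * ?A x\<bar> \<le> \<delta> * \<epsilon>"
        proof -
          have "?\<tau> p \<le> real (Suc n) * \<delta>" using p \<delta>(1) by (intro mult_right_mono) auto
          then have "?\<tau> p \<le> t0" using t(2) N\<delta> by linarith
          from close[OF fine p(2) this, of x]
          have "\<delta> * \<bar>expectation (\<lambda>\<omega>. ?A (?e p \<omega>)) - ?A x\<bar> \<le> \<delta> * \<epsilon>"
            using \<delta>(1) by (intro mult_left_mono) auto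
          moreover have "\<delta> * expectation (\<lambda>\<omega>. ?A (?e p \<omega>)) - \<delta> * ?A x = \<delta> * (expectation (\<lambda>\<omega>. ?A (?e p \<omega>)) - ?A x)"
            by (simp add: right_diff_distrib)
          ultimately show ?thesis using \<delta>(1) by (simp only: abs_mult abs_of_pos)
        qed
        moreover have "\<bar>expectation (\<lambda>\<omega>. h (?e p \<omega>)) - h x - real p * (\<delta> * ?A x)\<bar> \<le> real p * (2 * \<epsilon> * \<delta>)"
          by (rule Suc.IH[OF p(2)])
        moreover have "real (Suc p) * (\<delta> * ?A x) = real p * (\<delta> * ?A x) + \<delta> * ?A x"
          "real (Suc p) * (2 * \<epsilon> * \<delta>) = real p * (2 * \<epsilon> * \<delta>) + \<epsilon> * \<delta> + \<delta> * \<epsilon>"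
          by (simp_all add: algebra_simps)
        ultimately show ?case unfolding Suc_eq by linarith
      qed
      from this[OF order_refl]
      have "\<bar>expectation (\<lambda>\<omega>. h (?e (Suc n) \<omega>)) - h x - (real (Suc n) * \<delta>) * ?A x\<bar> \<le> 2 * \<epsilon> * (real (Suc n) * \<delta>)"
        by (simp only: mult_ac)
      then show ?thesis
        unfolding N\<delta> \<delta>_def[symmetric] euler_op_iterate[OF \<delta>(1) hD(5,3)] .
    qed
    have "(\<lambda>n. \<bar>(euler_op (t / real (Suc n)) ^^ Suc n) h x - h x - t * ?A x\<bar>)
        \<longlonglongrightarrow> \<bar>expectation (\<lambda>\<omega>. h (X t x \<omega>)) - h x - t * ?A x\<bar>"
      by (intro tendsto_intros euler_op_iterate_tendsto[OF bl t(1)])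
    moreover have "\<forall>\<^sub>F n in sequentially. \<bar>(euler_op (t / real (Suc n)) ^^ Suc n) h x - h x - t * ?A x\<bar> \<le> 2 * \<epsilon> * t"
      using order_tendstoD(2)[OF mesh_tendsto_0 \<delta>0(1), of t] by eventually_elim (rule step)
    ultimately show "\<bar>expectation (\<lambda>\<omega>. h (X t x \<omega>)) - h x - t * ?A x\<bar> \<le> 2 * \<epsilon> * t"
      by (rule tendsto_upperbound) simp
  qed
qed

lemma has_generator_expected_op: "has_generator (expected_op P X) (sde_generator f g)"
  unfolding has_generator_def
proof (intro allI impI)
  fix h :: "real^'n \<Rightarrow> real" assume h: "C2 h \<and> compact (closure {x. h x \<noteq> 0})"
  then have "bounded {x. h x \<noteq> 0}" using compact_imp_bounded bounded_subset closure_subset by blast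
  then obtain R where R: "0 < R" "\<And>x. h x \<noteq> 0 \<Longrightarrow> norm x \<le> R"
    unfolding bounded_pos by auto
  have tf: "test_function h R"
    by unfold_locales (use h R in force)+
  show "uniform_limit UNIV (\<lambda>t x. (expected_op P X t h x - h x) / t) (sde_generator f g h) (at_right 0)"
  proof (rule uniform_limitI)
    fix e :: real assume e: "0 < e"
    \<comment> \<open>The estimate carries a factor 2, and \<open>2 * (e / 3)\<close> leaves room
      for the strict inequality.\<close>
    then have e3: "0 < e / 3" by simp
    obtain t0 where t0: "0 < t0" and est: "\<And>t x. 0 < t \<Longrightarrow> t \<le> t0 \<Longrightarrow>
       \<bar>expectation (\<lambda>\<omega>. h (X t x \<omega>)) - h x - t * sde_generator f g h x\<bar> \<le> 2 * (e / 3) * t"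
      by (rule expectation_generator_estimate[OF tf e3]) (rule that)
    have "\<forall>\<^sub>F t in at_right 0. t \<in> {0<..<t0}" by (rule eventually_at_right_real[OF t0])
    then show "\<forall>\<^sub>F t in at_right 0. \<forall>x\<in>UNIV. dist ((expected_op P X t h x - h x) / t) (sde_generator f g h x) < e"
    proof eventually_elim
      case (elim t)
      show ?case
      proof
        fix x
        have t: "0 < t" "t \<le> t0" using elim by auto
        have "(expected_op P X t h x - h x) / t - sde_generator f g h x
            = (expectation (\<lambda>\<omega>. h (X t x \<omega>)) - h x - t * sde_generator f g h x) / t"
          unfolding expected_op_eq using t by (simp add: field_simps)
        also have "\<bar>\<dots>\<bar> = \<bar>expectation (\<lambda>\<omega>. h (X t x \<omega>)) - h x - t * sde_generator f g h x\<bar> / t"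
          using t by simp
        also have "\<dots> \<le> 2 * (e / 3)"
          using est[OF t, of x] t by (simp add: divide_le_eq)
        finally show "dist ((expected_op P X t h x - h x) / t) (sde_generator f g h x) < e"
          using e by (simp add: dist_real_def)
      qed
    qed
  qed
qed

end

theorem theorem3p7:
  fixes P :: "(real \<Rightarrow> real^'d) measure"
    and f :: "real^'n \<Rightarrow> real^'n"
    and g :: "real^'n \<Rightarrow> real^'d^'n"
    and X :: "real \<Rightarrow> real^'n \<Rightarrow> (real \<Rightarrow> real^'d) \<Rightarrow> real^'n"
  assumes "wiener_measure P"
    and "locally_bounded f" and "\<exists>C. C-lipschitz_on UNIV f"
    and "locally_bounded g" and "\<exists>C. C-lipschitz_on UNIV g"
    and "\<And>x. sde_solution P f g x (\<lambda>t. X t x)"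
    and "AE \<omega> in P. continuous_on ({0..} \<times> UNIV) (\<lambda>(t, x). X t x \<omega>)"
  shows "(\<forall>t\<ge>0. \<forall>h. bounded_measurable h \<longrightarrow>
            (\<forall>x. expected_op P X t h x = (LINT \<omega>|completion P. h (X t x \<omega>)))) \<and>
         markov_semigroup (expected_op P X) \<and>
         has_generator (expected_op P X) (sde_generator f g)"
proof -
  obtain Cf Cg where C: "Cf-lipschitz_on UNIV f" "Cg-lipschitz_on UNIV g"
    using assms(3,5) by blast
  have lip: "norm (F x - F y) \<le> max Cf Cg * norm (x - y)"
    if "C-lipschitz_on UNIV F" "C \<le> max Cf Cg" for F :: "real^'n \<Rightarrow> 'b::real_normed_vector" and C x y
  proof -
    have "norm (F x - F y) \<le> C * norm (x - y)"
      using lipschitz_onD[OF that(1), of x y] by (simp add: dist_norm)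
    also have "\<dots> \<le> max Cf Cg * norm (x - y)" using that(2) by (rule mult_right_mono) simp
    finally show ?thesis .
  qed
  interpret sde_flow P f g "max Cf Cg" X
  proof unfold_locales
    show "wiener_measure P" by (rule assms(1))
    show "0 \<le> max Cf Cg" using lipschitz_on_nonneg[OF C(1)] by simp
    show "norm (f x - f y) \<le> max Cf Cg * norm (x - y)" for x y by (rule lip[OF C(1)]) simp
    show "norm (g x - g y) \<le> max Cf Cg * norm (x - y)" for x y by (rule lip[OF C(2)]) simp
    show "sde_solution P f g x (\<lambda>t. X t x)" for x by (rule assms(6))
  qed
  show ?thesis
    using expected_op_eq markov_semigroup_expected_op has_generator_expected_op by blast
qed

end
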